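(* Let $F$ be an element of the Selberg class $\mathcal{S}$, let $\xi_F$ be its completed function, and let $g_F:\mathbb{R}\to\mathbb{C}$ be the function $$g_F(t)= -\frac{m_0}{2}\,t^2 + iB_F t + \sum_{\gamma\neq 0} m_\gamma\,\frac{e^{-i\gamma t}-1}{\gamma^2},$$ where $\gamma$ runs over the distinct nonzero zeros of the entire function $z\mapsto \xi_F(1/2-iz)$, $m_\gamma$ is the multiplicity of $\gamma$, $m_0\ge 0$ is the order of vanishing of $\xi_F(1/2-iz)$ at $z=0$, and $B_F$ is the constant defined below. Then the following two statements are equivalent: (1) the Grand Riemann Hypothesis for $F$ is true; (2) the function $t\mapsto \exp(g_F(t))$ on $\mathbb{R}$ is the characteristic function of an infinitely divisible distribution on $\mathbb{R}$.
   Context: The Selberg class $\mathcal{S}$ consists of Dirichlet series $F(s)=\sum_{n\ge1} a_F(n)n^{-s}$ satisfying: (S1) the series converges absolutely for $\Re(s)>1$; (S2) there is an integer $m\ge0$ such that $(s-1)^mF(s)$ extends to an entire function of finite order, and the smallest such $m$ is denoted $m_F$; (S3) $F$ satisfies the functional equation $\xi_F(s)=\omega\,\overline{\xi_F(1-\bar s)}$, where $\xi_F(s)=s^{m_F}(s-1)^{m_F}Q^s\prod_{j=1}^r\Gamma(\lambda_j s+\mu_j)\,F(s)$ with parameters $r\ge0$, $Q>0$, $\lambda_j>0$, $\mu_j\in\mathbb{C}$ with $\Re(\mu_j)\ge0$, and $\omega\in\mathbb{C}$ with $|\omega|=1$ (here $\xi_F$ is entire, of order one); (S4) $a_F(n)\ll_\varepsilon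 n^{\varepsilon}$ for every $\varepsilon>0$; (S5) $\log F(s)=\sum_{n\ge1} b_F(n)n^{-s}$ where $b_F(n)=0$ unless $n=p^m$ is a prime power with $m\ge1$, and $b_F(n)\ll n^{\theta}$ for some $\theta<1/2$. The nontrivial zeros of $F$ are the zeros of $\xi_F$; the Grand Riemann Hypothesis (GRH) for $F$ is the assertion that all zeros of $\xi_F(s)$ lie on the line $\Re(s)=1/2$, equivalently that all zeros of $z\mapsto\xi_F(1/2-iz)$ are real. The constant $B_F$ is defined by the Hadamard factorization $\xi_F(1/2-iz)=e^{A_F-B_Fz}z^{m_0}\prod_{\gamma\neq0}\big[(1-z/\gamma)e^{z/\gamma}\big]^{m_\gamma}$ (with $A_F$ a constant); equivalently $B_F=i\lim_{s\to1/2}\big(\tfrac{\xi_F'}{\xi_F}(s)-\tfrac{m_0}{s-1/2}\big)$, which equals $i\,\tfrac{\xi_F'}{\xi_F}(1/2)$ when $\xi_F(1/2)\neq0$. The series defining $g_F$ converges absolutely and uniformly on compact subsets of $\mathbb{R}$, so $g_F$ is continuous. A distribution $\mu$ on $\mathbb{R}$ is infinitely divisible if for every positive integer $n$ it is the $n$-fold convolution of some distribution $\mu_n$ on $\mathbb{R}$; its characteristic function is $\widehat\mu(t)=\int e^{itx}\mu(dx)$. *)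

theory Defs
  imports
    "HOL-Complex_Analysis.Complex_Analysis"
    "HOL-Number_Theory.Prime_Powers"
    "HOL-Probability.Probability"
    "HOL-Library.Landau_Symbols"
begin

section \<open>The Selberg class\<close>

text \<open>
  A Dirichlet series is represented by its coefficient sequence \<open>a\<close>; the value \<open>a 0\<close> plays no role.
\<close>

definition dirichlet_term :: "(nat \<Rightarrow> complex) \<Rightarrow> complex \<Rightarrow> nat \<Rightarrow> complex" where
  "dirichlet_term a s n = a n / of_nat n powr s"

definition dirichlet_sum :: "(nat \<Rightarrow> complex) \<Rightarrow> complex \<Rightarrow> complex" where
  "dirichlet_sum a s = (\<Sum>\<^sub>\<infinity>n\<in>{1..}. dirichlet_term a s n)"

definition finite_order :: "(complex \<Rightarrow> complex) \<Rightarrow> bool" where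
  "finite_order f \<longleftrightarrow>
     (\<exists>\<rho>::real. (\<lambda>s. norm (f s)) \<in> O[at_infinity](\<lambda>s. exp (norm s powr \<rho>)))"

definition entire_extension :: "(nat \<Rightarrow> complex) \<Rightarrow> nat \<Rightarrow> (complex \<Rightarrow> complex) \<Rightarrow> bool" where
  "entire_extension a m G \<longleftrightarrow>
     G holomorphic_on UNIV \<and> finite_order G \<and>
     (\<forall>s. Re s > 1 \<longrightarrow> G s = (s - 1) ^ m * dirichlet_sum a s)"

definition selberg_m :: "(nat \<Rightarrow> complex) \<Rightarrow> nat" where
  "selberg_m a = (LEAST m. \<exists>G. entire_extension a m G)"

text \<open>
  The meromorphic continuation of the Dirichlet series. By the identity theorem the entire function
  \<open>G\<close> below is unique. The value at \<open>s = 1\<close> is meaningful only if there is no pole.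
\<close>

definition selberg_fun :: "(nat \<Rightarrow> complex) \<Rightarrow> complex \<Rightarrow> complex" where
  "selberg_fun a s = (THE G. entire_extension a (selberg_m a) G) s / (s - 1) ^ selberg_m a"

text \<open>
  The completed function. The operator \<open>remove_sings\<close> supplies the correct values at the removable
  singularities of the defining product: at \<open>s = 1\<close>, and at the poles of the Gamma factors (where
  HOL's total \<open>Gamma\<close> has the conventional value 0).
\<close>

definition selberg_xi ::
  "(nat \<Rightarrow> complex) \<Rightarrow> real \<Rightarrow> nat \<Rightarrow> (nat \<Rightarrow> real) \<Rightarrow> (nat \<Rightarrow> complex) \<Rightarrow> complex \<Rightarrow> complex" where
  "selberg_xi a Q r lam mu = remove_sings (\<lambda>s.
     s ^ selberg_m a * (s - 1) ^ selberg_m a * of_real Q powr s *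
     (\<Prod>j=1..r. Gamma (of_real (lam j) * s + mu j)) * selberg_fun a s)"

definition selberg_functional_equation ::
  "(nat \<Rightarrow> complex) \<Rightarrow> real \<Rightarrow> nat \<Rightarrow> (nat \<Rightarrow> real) \<Rightarrow> (nat \<Rightarrow> complex) \<Rightarrow> complex \<Rightarrow> bool" where
  "selberg_functional_equation a Q r lam mu \<omega> \<longleftrightarrow>
     Q > 0 \<and> (\<forall>j\<in>{1..r}. lam j > 0 \<and> Re (mu j) \<ge> 0) \<and> norm \<omega> = 1 \<and>
     (\<forall>s. selberg_xi a Q r lam mu s = \<omega> * cnj (selberg_xi a Q r lam mu (1 - cnj s)))"

text \<open>
  In the last clause, \<open>log F(s) = \<Sum> b(n) n\<^sup>-\<^sup>s\<close> is expressed by saying that the series on the right is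
  a logarithm of \<open>F(s)\<close>. The branch is determined, since \<open>b(1) = 0\<close> makes the series vanish
  as \<open>Re s\<close> tends to infinity.
\<close>

definition selberg_class :: "(nat \<Rightarrow> complex) \<Rightarrow> bool" where
  "selberg_class a \<longleftrightarrow>
     (\<forall>s. Re s > 1 \<longrightarrow> (\<lambda>n. norm (dirichlet_term a s n)) summable_on {1..}) \<and>
     (\<exists>m G. entire_extension a m G) \<and>
     (\<exists>Q r lam mu \<omega>. selberg_functional_equation a Q r lam mu \<omega>) \<and>
     (\<forall>\<epsilon>>0::real. (\<lambda>n. norm (a n)) \<in> O(\<lambda>n. real n powr \<epsilon>)) \<and>
     (\<exists>b. (\<forall>n\<ge>1. \<not> primepow n \<longrightarrow> b n = 0) \<and>
          (\<exists>\<theta><1/2. (\<lambda>n. norm (b n)) \<in> O(\<lambda>n. real n powr \<theta>)) \<and>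
          (\<forall>s. Re s > 1 \<longrightarrow>
             (\<lambda>n. norm (dirichlet_term b s n)) summable_on {1..} \<and>
             dirichlet_sum a s = exp (dirichlet_sum b s)))"

definition grand_riemann_hypothesis :: "(complex \<Rightarrow> complex) \<Rightarrow> bool" where
  "grand_riemann_hypothesis \<xi> \<longleftrightarrow> (\<forall>s. \<xi> s = 0 \<longrightarrow> Re s = 1/2)"

section \<open>The function \<open>g\<^sub>F\<close>\<close>

definition critical_rotation :: "(complex \<Rightarrow> complex) \<Rightarrow> complex \<Rightarrow> complex" where
  "critical_rotation \<xi> z = \<xi> (1/2 - \<i> * z)"

definition nonzero_zeros :: "(complex \<Rightarrow> complex) \<Rightarrow> complex set" where
  "nonzero_zeros f = {\<gamma>. f \<gamma> = 0 \<and> \<gamma> \<noteq> 0}"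

text \<open>Order of vanishing, for an entire function that is not identically zero; 0 where \<open>f z \<noteq> 0\<close>.\<close>

definition zero_mult :: "(complex \<Rightarrow> complex) \<Rightarrow> complex \<Rightarrow> nat" where
  "zero_mult f z = nat (zorder f z)"

text \<open>
  The product over the zeros is taken unconditionally, as the limit over finite sets of zeros (the
  multiplicative analogue of \<open>has_sum\<close>).
\<close>

definition hadamard_factorization ::
  "(complex \<Rightarrow> complex) \<Rightarrow> complex \<Rightarrow> complex \<Rightarrow> bool" where
  "hadamard_factorization f A B \<longleftrightarrow>
     (\<forall>z. ((\<lambda>S. exp (A - B * z) * z ^ zero_mult f 0 *
               (\<Prod>\<gamma>\<in>S. ((1 - z / \<gamma>) * exp (z / \<gamma>)) ^ zero_mult f \<gamma>)) \<longlongrightarrow> f z)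
          (finite_subsets_at_top (nonzero_zeros f)))"

text \<open>\<open>B\<close> is unique, while \<open>A\<close> is determined only modulo \<open>2 \<pi> i\<close>.\<close>

definition hadamard_B :: "(complex \<Rightarrow> complex) \<Rightarrow> complex" where
  "hadamard_B f = (THE B. \<exists>A. hadamard_factorization f A B)"

definition selberg_g :: "(complex \<Rightarrow> complex) \<Rightarrow> real \<Rightarrow> complex" where
  "selberg_g \<xi> t = (let f = critical_rotation \<xi> in
     - (of_nat (zero_mult f 0) / 2) * of_real t ^ 2 + \<i> * hadamard_B f * of_real t +
     (\<Sum>\<^sub>\<infinity>\<gamma>\<in>nonzero_zeros f.
        of_nat (zero_mult f \<gamma>) * ((exp (- \<i> * \<gamma> * of_real t) - 1) / \<gamma> ^ 2)))"

section \<open>Infinitely divisible distributions\<close>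

primrec convolution_power :: "real measure \<Rightarrow> nat \<Rightarrow> real measure" where
  "convolution_power \<nu> 0 = return borel 0"
| "convolution_power \<nu> (Suc n) = convolution \<nu> (convolution_power \<nu> n)"

definition infinitely_divisible :: "real measure \<Rightarrow> bool" where
  "infinitely_divisible \<nu> \<longleftrightarrow> real_distribution \<nu> \<and>
     (\<forall>n\<ge>1. \<exists>\<nu>'. real_distribution \<nu>' \<and> \<nu> = convolution_power \<nu>' n)"

end

theory Submission
  imports Defs
begin

text \<open>
  Write \<open>f z = \<xi> (1/2 - \<i> z)\<close>, an entire function of order at most one whose zeros \<open>\<gamma>\<close> (with
  multiplicity \<open>m\<^sub>\<gamma>\<close>) lie in a horizontal strip and are symmetric under conjugation. Since the order is
  less than two, \<open>\<Sum> m\<^sub>\<gamma> / \<bar>\<gamma>\<bar>\<^sup>2\<close> converges and the Hadamard factorization has genus one; by symmetry its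
  constant \<open>B\<close> is real.

  If all \<open>\<gamma>\<close> are real, then \<open>g\<close> is the exponent of the sum of a Gaussian variable and an independent
  compound Poisson variable with jumps \<open>-\<gamma>\<close> of intensity \<open>m\<^sub>\<gamma> / \<gamma>\<^sup>2\<close>; dividing the parameters by
  \<open>n\<close> gives \<open>n\<close>-th convolution roots.

  Conversely, let \<open>exp g\<close> be the characteristic function of an infinitely divisible distribution and
  \<open>h = - Re g\<close>. The inequality \<open>1 - \<bar>\<phi> (2 t)\<bar> \<le> 4 (1 - \<bar>\<phi> t\<bar>)\<close> for the characteristic functions \<open>\<phi>\<close> of
  the convolution roots gives \<open>0 \<le> h (2 t) \<le> 4 h t\<close>, hence \<open>h t = O (1 + t\<^sup>2)\<close>. On the other hand
  \<open>h t - m\<^sub>0 t\<^sup>2 / 2 = \<Sum> m\<^sub>\<gamma> (1 - cos (\<gamma> t)) / \<gamma>\<^sup>2\<close> has the Laplace transform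
  \<open>- (\<i> / z) \<Sum> m\<^sub>\<gamma> / (z\<^sup>2 - \<gamma>\<^sup>2)\<close>, so the quadratic bound excludes poles in the upper half-plane. As the
  residues at \<open>\<plusminus> \<gamma>\<close> cannot cancel, all \<open>\<gamma>\<close> are real.
\<close>

section \<open>Hadamard factorization for order less than two\<close>

text \<open>Two obstacles shape the proof. First, (S2) grants only some finite order, whereas genus
  one needs growth with an exponent below 2. The exponent 3/2 is a convenient choice strictly
  between 1 and 2: it lets a square root replace the logarithm in Stirling's estimate. It holds
  where the Dirichlet series is bounded, the functional equation mirrors it, and in the strip
  between, the unknown order only serves as the a priori growth in a Phragmen-Lindelof argument.
  Second, the converse does not go through a Levy-Khintchine representation: the doubling inequality
  is all that is extracted from infinite divisibility. Iterating it gives polynomial growth, while a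
  zero off the real axis would contribute exponentially growing cosines. The residues cannot cancel
  because all terms singular at a given \<open>z0\<close> share the factor 1 / (z^2 - z0^2) and
  carry positive weights.\<close>

lemma norm_prod_minus_1_le:
  fixes a :: "'i \<Rightarrow> 'a :: {real_normed_div_algebra,comm_ring_1}"
  assumes "\<And>i. i \<in> S \<Longrightarrow> norm (a i - 1) \<le> b i - 1"
  shows "norm (prod a S - 1) \<le> prod b S - 1"
  using assms
proof (induction S rule: infinite_finite_induct)
  case (insert x S)
  have b: "b i \<ge> 1" if "i \<in> insert x S" for i
    using insert.prems[OF that] norm_ge_zero[of "a i - 1"] by linarith
  have IH: "norm (prod a S - 1) \<le> prod b S - 1"
    using insert by auto
  \<comment> \<open>This splitting has nonnegative coefficients when written for \<open>b\<close>,
    so each norm is dominated by the corresponding expression in \<open>b\<close>.\<close>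
  have "prod a (insert x S) - 1 = a x * (prod a S - 1) + (a x - 1)"
    using insert.hyps by (simp add: algebra_simps)
  hence "norm (prod a (insert x S) - 1) \<le> norm (a x) * norm (prod a S - 1) + norm (a x - 1)"
    by (metis norm_mult norm_triangle_ineq)
  also have "\<dots> \<le> b x * (prod b S - 1) + (b x - 1)"
  proof (intro add_mono mult_mono)
    show "norm (a x) \<le> b x"
      using insert.prems[of x] norm_triangle_ineq[of "a x - 1" 1] by simp
  qed (use IH insert.prems b in \<open>auto intro: order.trans[OF zero_le_one]\<close>)
  also have "\<dots> = prod b (insert x S) - 1"
    using insert.hyps by (simp add: algebra_simps)
  finally show ?case .
qed auto

text \<open>The majorant bound is applied twice with b = exp (norm (a - 1)), first to the repeated
  factors of one power and then to the product of the powers; it is admissible because exp x - 1 >=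
  x.\<close>

lemma norm_prod_power_minus_1_le:
  fixes a :: "'i \<Rightarrow> 'a :: {real_normed_div_algebra,comm_ring_1}"
  shows "norm ((\<Prod>i\<in>S. a i ^ m i) - 1) \<le> exp (\<Sum>i\<in>S. m i * norm (a i - 1)) - 1"
proof (cases "finite S")
  case True
  have "norm ((\<Prod>i\<in>S. a i ^ m i) - 1) \<le> (\<Prod>i\<in>S. exp (m i * norm (a i - 1))) - 1"
  proof (rule norm_prod_minus_1_le)
    fix i assume "i \<in> S"
    have "norm ((\<Prod>k<m i. a i) - 1) \<le> (\<Prod>k<m i. exp (norm (a i - 1))) - 1"
      using exp_ge_add_one_self[of "norm (a i - 1)"] by (intro norm_prod_minus_1_le) linarith
    thus "norm (a i ^ m i - 1) \<le> exp (m i * norm (a i - 1)) - 1"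
      by (simp add: exp_of_nat_mult)
  qed
  thus ?thesis
    by (simp add: exp_sum True)
qed auto

section \<open>Dividing zeros out of an entire function\<close>

lemma divide_zero:
  assumes hol: "f holomorphic_on UNIV" and nz: "f w \<noteq> 0"
  obtains q where "q holomorphic_on UNIV" "\<And>z. f z = (z - c) ^ zero_mult f c * q z" "q c \<noteq> 0"
    "\<And>z. z \<noteq> c \<Longrightarrow> zero_mult q z = zero_mult f z"
proof -
  obtain r where r: "r > 0" "zor_poly f c holomorphic_on cball c r"
    "\<And>w. w \<in> cball c r \<Longrightarrow> f w = zor_poly f c w * (w - c) ^ zero_mult f c \<and> zor_poly f c w \<noteq> 0"
    using zorder_exist_zero[of f UNIV c] hol nz unfolding zero_mult_def
    by (metis UNIV_I connected_UNIV open_UNIV)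
  \<comment> \<open>Near \<open>c\<close> this agrees with \<open>zor_poly f c\<close>, and away
    from \<open>c\<close> it is a quotient with nonzero denominator; the two open sets cover the
    plane.\<close>
  define q where "q = (\<lambda>z. if z = c then zor_poly f c c else f z / (z - c) ^ zero_mult f c)"
  have q_ball: "q z = zor_poly f c z" if "z \<in> ball c r" for z
    using r(3)[of z] that by (auto simp: q_def)
  have "q holomorphic_on ball c r"
    using holomorphic_on_subset[OF r(2) ball_subset_cball]
    by (rule holomorphic_transform) (simp add: q_ball)
  moreover have "q holomorphic_on (- {c})"
  proof (rule holomorphic_transform)
    show "(\<lambda>z. f z / (z - c) ^ zero_mult f c) holomorphic_on (- {c})"
      by (intro holomorphic_intros holomorphic_on_subset[OF hol]) auto
  qed (auto simp: q_def)
  ultimately have "q holomorphic_on (ball c r \<union> - {c})"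
    by (intro holomorphic_on_Un) auto
  moreover have "ball c r \<union> - {c} = UNIV"
    using r(1) by auto
  ultimately have holq: "q holomorphic_on UNIV" by simp
  have eq: "f z = (z - c) ^ zero_mult f c * q z" for z
    using r(3)[of c] r(1) by (cases "z = c") (auto simp: q_def)
  have ev: "eventually (\<lambda>z. f z \<noteq> 0) (at z)" for z
    by (rule non_zero_neighbour_alt[OF hol, of z w, THEN eventually_mono]) (use nz in auto)
  show ?thesis
  proof
    show "zero_mult q z = zero_mult f z" if "z \<noteq> c" for z
    proof -
      have an: "(\<lambda>z. (z - c) ^ zero_mult f c) analytic_on {z}" "q analytic_on {z}"
        using analytic_on_subset[of q UNIV "{z}"] holq
        by (simp_all add: analytic_on_open) (intro analytic_intros)
      have "zorder (\<lambda>z. (z - c) ^ zero_mult f c * q z) z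
              = zorder (\<lambda>z. (z - c) ^ zero_mult f c) z + zorder q z"
        using zorder_times_analytic[OF an] ev[of z] by (simp only: flip: eq)
      hence "zorder f z = zorder (\<lambda>z. (z - c) ^ zero_mult f c) z + zorder q z"
        by (simp only: flip: eq)
      moreover have "zorder (\<lambda>z. (z - c) ^ zero_mult f c) z = 0"
        by (rule zorder_eq_0I) (use an that in auto)
      ultimately show ?thesis by (simp add: zero_mult_def)
    qed
  qed (use holq eq r in \<open>auto simp: q_def\<close>)
qed

lemma divide_zeros:
  assumes hol: "f holomorphic_on UNIV" and nz: "f w \<noteq> 0" and "finite T"
  obtains q where "q holomorphic_on UNIV" "\<And>z. f z = (\<Prod>c\<in>T. (z - c) ^ zero_mult f c) * q z"
    "\<And>c. c \<in> T \<Longrightarrow> q c \<noteq> 0" "\<And>z. z \<notin> T \<Longrightarrow> zero_mult q z = zero_mult f z"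
  using \<open>finite T\<close>
proof (induction T arbitrary: thesis rule: finite_induct)
  case empty
  show ?case using empty[OF hol] by simp
next
  case (insert c T)
  obtain q where q: "q holomorphic_on UNIV" "\<And>z. f z = (\<Prod>c\<in>T. (z - c) ^ zero_mult f c) * q z"
    "\<And>c. c \<in> T \<Longrightarrow> q c \<noteq> 0" "\<And>z. z \<notin> T \<Longrightarrow> zero_mult q z = zero_mult f z"
    using insert.IH by blast
  have "q w \<noteq> 0" using nz q(2)[of w] by auto
  then obtain p where p: "p holomorphic_on UNIV" "\<And>z. q z = (z - c) ^ zero_mult q c * p z" "p c \<noteq> 0"
    "\<And>z. z \<noteq> c \<Longrightarrow> zero_mult p z = zero_mult q z"
    using divide_zero[OF q(1)] by metis
  show ?case
  proof (rule insert.prems[OF p(1)])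
    show "f z = (\<Prod>c\<in>insert c T. (z - c) ^ zero_mult f c) * p z" for z
      using insert.hyps q(2)[of z] p(2)[of z] q(4)[of c] by simp
    show "p d \<noteq> 0" if "d \<in> insert c T" for d
      using that p(3) q(3)[of d] p(2)[of d] by auto
    show "zero_mult p z = zero_mult f z" if "z \<notin> insert c T" for z
      using that p(4) q(4) by auto
  qed
qed

text \<open>The Moebius map \<kappa> / (2 D - \<kappa>) sends the half-plane
  \<open>Re \<kappa> < D\<close> into the unit disc, so the Schwarz lemma bounds
  \<open>k - k 0\<close> by 2 D on the disc of radius R / 2. Cauchy's inequality on circles of
  radius R / 4 then bounds the second derivative by 2! * 2 D / (R / 4)^2 = 64 D / R^2, and Taylor's
  formula gives the claim.\<close>

lemma Borel_Caratheodory_second_order: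
  assumes hol: "k holomorphic_on ball 0 R" and R: "R > 0"
    and le: "\<And>z. z \<in> ball 0 R \<Longrightarrow> Re (k z) \<le> M" and z: "norm z \<le> R / 4"
  shows "norm (k z - k 0 - deriv k 0 * z) \<le> 64 * (M + 1 - Re (k 0)) / R\<^sup>2 * norm z ^ 2"
proof -
  \<comment> \<open>The summand 1 makes \<open>D\<close> strictly positive even if \<open>M\<close>
    equals \<open>Re (k 0)\<close>.\<close>
  define D where "D = M + 1 - Re (k 0)"
  have "Re (k 0) \<le> M" using le[of 0] R by simp
  hence D: "D > 0" by (simp add: D_def)
  define w where "w = (\<lambda>\<zeta>::complex. (k (R * \<zeta>) - k 0) / (2 * D - (k (R * \<zeta>) - k 0)))"
  have inb: "R * \<zeta> \<in> ball 0 R" if "norm \<zeta> < 1" for \<zeta> :: complex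
    using that R by (simp add: norm_mult)
  have less: "Re (k (R * \<zeta>) - k 0) < D" if "norm \<zeta> < 1" for \<zeta> :: complex
    using le[OF inb[OF that]] by (simp add: D_def)
  have key: "norm \<kappa> < norm (2 * D - \<kappa>)" if "Re \<kappa> < D" for \<kappa> :: complex
  proof -
    have "(norm \<kappa>)\<^sup>2 < (norm (2 * D - \<kappa>))\<^sup>2"
      using that D mult_strict_left_mono[OF that D]
      unfolding cmod_power2 by (simp add: power2_diff power2_eq_square algebra_simps)
    thus ?thesis by (rule power2_less_imp_less) simp
  qed
  have nz: "2 * D - (k (R * \<zeta>) - k 0) \<noteq> 0" if "norm \<zeta> < 1" for \<zeta> :: complex
    using key[OF less[OF that]] by (metis norm_eq_zero norm_ge_zero not_less)
  have holw: "w holomorphic_on ball 0 1"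
  proof -
    have "(k \<circ> (\<lambda>\<zeta>. R * \<zeta>)) holomorphic_on ball 0 1"
      by (intro holomorphic_on_compose_gen[OF _ hol] holomorphic_intros) (use inb in auto)
    thus ?thesis unfolding w_def by (intro holomorphic_intros) (use nz in \<open>auto simp: o_def\<close>)
  qed
  have w1: "norm (w \<zeta>) < 1" if "norm \<zeta> < 1" for \<zeta>
    using key[OF less[OF that]] nz[OF that] by (simp add: w_def norm_divide)
  have w2: "norm (w \<zeta>) \<le> norm \<zeta>" if "norm \<zeta> < 1" for \<zeta>
    by (rule Schwarz_Lemma(1)[OF holw _ w1 that]) (simp add: w_def)
  have half: "norm (k x - k 0) \<le> 2 * D" if x: "norm x \<le> R / 2" for x
  proof -
    define \<zeta> where "\<zeta> = x / R"
    have \<zeta>: "norm \<zeta> \<le> 1/2" "R * \<zeta> = x" using x R by (simp_all add: \<zeta>_def norm_divide field_simps)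
    define \<kappa> where "\<kappa> = k x - k 0"
    have "norm (w \<zeta>) \<le> 1/2" using w2[of \<zeta>] \<zeta> by simp
    hence "norm \<kappa> \<le> norm (2 * D - \<kappa>) / 2"
      using nz[of \<zeta>] \<zeta> by (simp add: w_def norm_divide \<kappa>_def field_simps)
    also have "norm (2 * D - \<kappa>) \<le> 2 * D + norm \<kappa>"
      using norm_triangle_ineq4[of "2 * D" \<kappa>] D by (simp add: norm_mult)
    finally show ?thesis by (simp add: \<kappa>_def)
  qed
  have k2: "norm ((deriv ^^ 2) k x) \<le> 64 * D / R\<^sup>2" if x: "x \<in> ball 0 (R / 4) \<or> norm x \<le> R / 4" for x
  proof -
    have sub: "cball x (R/4) \<subseteq> ball 0 R"
    proof
      fix y assume "y \<in> cball x (R/4)"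
      hence "norm (x - y) \<le> R/4" by (simp add: dist_norm)
      thus "y \<in> ball 0 R" using x R norm_triangle_ineq4[of x "x - y"] by auto
    qed
    have hk: "(\<lambda>y. k y - k 0) holomorphic_on cball x (R/4)"
      by (intro holomorphic_intros holomorphic_on_subset[OF hol] sub)
    have "norm ((deriv ^^ 2) (\<lambda>y. k y - k 0) x) \<le> fact 2 * (2 * D) / (R / 4) ^ 2"
    proof (rule Cauchy_inequality)
      show "norm (k y - k 0) \<le> 2 * D" if "norm (x - y) = R / 4" for y
        using half[of y] x that norm_triangle_ineq4[of x "x - y"] by auto
    qed (use R holomorphic_on_subset[OF hk ball_subset_cball] holomorphic_on_imp_continuous_on[OF hk] in auto)
    moreover have "(deriv ^^ 2) (\<lambda>y. k y - k 0) x = (deriv ^^ 2) k x"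
    proof -
      have "(deriv ^^ 2) (\<lambda>y. k y - k 0) x = (deriv ^^ 2) k x - (deriv ^^ 2) (\<lambda>y. k 0) x"
        using subsetD[OF sub, of x] R by (intro higher_deriv_diff[OF hol]) auto
      thus ?thesis by (simp add: numeral_2_eq_2)
    qed
    ultimately show ?thesis by (simp add: field_simps power2_eq_square)
  qed
  have "norm ((deriv ^^ 0) k z - (\<Sum>i\<le>1. (deriv ^^ i) k 0 * (z - 0) ^ i / fact i))
          \<le> 64 * D / R\<^sup>2 * norm (z - 0) ^ Suc 1 / fact 1"
  proof (rule complex_Taylor[where S = "cball 0 (R/4)"])
    fix i and x :: complex assume "x \<in> cball 0 (R / 4)" 
    hence "x \<in> ball (0::complex) R" using R by auto
    thus "((deriv ^^ i) k has_field_derivative (deriv ^^ Suc i) k x) (at x within cball 0 (R / 4))"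
      using holomorphic_derivI[OF holomorphic_higher_deriv[OF hol open_ball] open_ball, of x i]
      by (simp add: has_field_derivative_at_within)
  next
    fix x :: complex assume "x \<in> cball 0 (R / 4)"
    thus "norm ((deriv ^^ Suc 1) k x) \<le> 64 * D / R\<^sup>2" using k2[of x] by (simp add: numeral_2_eq_2)
  qed (use z R in auto)
  thus ?thesis by (simp add: D_def numeral_2_eq_2 algebra_simps)
qed

section \<open>Zero counting below order two\<close>

text \<open>Here \<open>u\<close> is \<open>f\<close> without its zero at the origin, so that values
  and logarithmic derivatives at 0 are available for normalization, while the growth hypothesis
  stays on \<open>f\<close>.\<close>

locale subquadratic_entire =
  fixes f u :: "complex \<Rightarrow> complex" and C \<kappa> :: real
  assumes hol_u: "u holomorphic_on UNIV" and f_eq: "f z = z ^ zero_mult f 0 * u z" and u_0: "u 0 \<noteq> 0"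
    and mult_u: "z \<noteq> 0 \<Longrightarrow> zero_mult u z = zero_mult f z"
    and growth: "norm (f z) \<le> exp (C * (1 + norm z) powr \<kappa>)"
    and C_nonneg: "C \<ge> 0" and \<kappa>_pos: "0 < \<kappa>" and \<kappa>_less: "\<kappa> < 2"
begin

lemma hol_f: "f holomorphic_on UNIV"
proof -
  have "(\<lambda>z. z ^ zero_mult f 0 * u z) holomorphic_on UNIV"
    by (intro holomorphic_intros hol_u)
  thus ?thesis by (simp only: flip: f_eq)
qed

lemma u_eq_0_iff: "u z = 0 \<longleftrightarrow> z \<in> nonzero_zeros f"
  using f_eq[of z] u_0 by (auto simp: nonzero_zeros_def)

lemma finite_zeros: "finite (nonzero_zeros f \<inter> cball 0 R)"
proof -
  have "finite {z \<in> cball 0 R. u z = 0}"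
  proof (cases "\<exists>z. u z = 0")
    case True
    hence "\<not> u constant_on UNIV" using u_0 unfolding constant_on_def by (metis UNIV_I)
    thus ?thesis by (intro holomorphic_compact_finite_zeros[OF hol_u]) auto
  qed auto
  moreover have "nonzero_zeros f \<inter> cball 0 R = {z \<in> cball 0 R. u z = 0}"
    using u_eq_0_iff by auto
  ultimately show ?thesis by simp
qed

lemma factor:
  assumes "finite T" "T \<subseteq> nonzero_zeros f"
  obtains q where "q holomorphic_on UNIV" "\<And>z. u z = (\<Prod>c\<in>T. (1 - z / c) ^ zero_mult f c) * q z"
    "\<And>c. c \<in> T \<Longrightarrow> q c \<noteq> 0" "q 0 = u 0"
proof -
  have T0: "c \<noteq> 0" if "c \<in> T" for c using that assms by (auto simp: nonzero_zeros_def)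
  obtain q where q: "q holomorphic_on UNIV" "\<And>z. u z = (\<Prod>c\<in>T. (z - c) ^ zero_mult u c) * q z"
    "\<And>c. c \<in> T \<Longrightarrow> q c \<noteq> 0"
    using divide_zeros[OF hol_u u_0 assms(1)] by metis
  \<comment> \<open>This constant trades the monic factors \<open>z - c\<close> for factors with
    value 1 at the origin, which is what yields \<open>q 0 = u 0\<close>.\<close>
  define a where "a = (\<Prod>c\<in>T. (-c) ^ zero_mult f c)"
  have "a \<noteq> 0" using T0 assms(1) by (auto simp: a_def)
  have "(\<Prod>c\<in>T. (z - c) ^ zero_mult u c) = (\<Prod>c\<in>T. (1 - z / c) ^ zero_mult f c) * a" for z
    unfolding a_def prod.distrib[symmetric] power_mult_distrib[symmetric]
    by (intro prod.cong refl arg_cong2[where f = "(^)"]) (simp_all add: T0 mult_u field_simps)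
  hence eq: "u z = (\<Prod>c\<in>T. (1 - z / c) ^ zero_mult f c) * (a * q z)" for z
    using q(2)[of z] by simp
  show ?thesis
    by (rule that[OF _ eq]) (use q \<open>a \<noteq> 0\<close> eq[of 0] in \<open>auto intro!: holomorphic_intros\<close>)
qed

text \<open>On the circle of radius 3 R a zero \<open>c\<close> with norm at most \<open>R\<close>
  satisfies |z / c| >= 3, so each removed factor has norm at least 2 there. The maximum principle
  carries the resulting gain inside.\<close>

lemma norm_cofactor_le:
  assumes T: "finite T" "T \<subseteq> nonzero_zeros f" "T \<subseteq> cball 0 R" and R: "R \<ge> 1"
    and q: "q holomorphic_on UNIV" "\<And>z. u z = (\<Prod>c\<in>T. (1 - z / c) ^ zero_mult f c) * q z"
    and z: "norm z \<le> 3 * R"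
  shows "norm (q z) \<le> exp (C * (1 + 3 * R) powr \<kappa>) / 2 ^ (\<Sum>c\<in>T. zero_mult f c)"
proof (rule maximum_modulus_frontier[where f = q and S = "cball 0 (3 * R)"])
  fix z :: complex assume "z \<in> frontier (cball 0 (3 * R))"
  hence z: "norm z = 3 * R" using R by simp
  have "2 ^ (\<Sum>c\<in>T. zero_mult f c) = (\<Prod>c\<in>T. 2 ^ zero_mult f c :: real)"
    by (simp add: power_sum)
  also have "\<dots> \<le> (\<Prod>c\<in>T. norm (1 - z / c) ^ zero_mult f c)"
  proof (intro prod_mono conjI power_mono)
    fix c assume "c \<in> T"
    hence c: "norm c \<le> R" "c \<noteq> 0" using T by (auto simp: nonzero_zeros_def)
    have "3 * norm c \<le> norm z" using c z by simp
    hence "3 \<le> norm (z / c)" using c by (simp add: norm_divide field_simps)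
    thus "2 \<le> norm (1 - z / c)" using norm_triangle_ineq3[of "z / c" 1] by (simp add: norm_minus_commute)
  qed auto
  finally have "2 ^ (\<Sum>c\<in>T. zero_mult f c) * norm (q z) \<le> norm (u z)"
    by (subst q(2)) (simp add: norm_mult norm_power mult_right_mono flip: prod_norm)
  \<comment> \<open>Since |z| >= 1 on this circle, restoring the zero at the origin only enlarges
    the norm.\<close>
  also have "\<dots> \<le> norm z ^ zero_mult f 0 * norm (u z)"
    using R z mult_right_mono[OF one_le_power[of "norm z" "zero_mult f 0"], of "norm (u z)"] by simp
  also have "\<dots> = norm (f z)" by (metis f_eq norm_mult norm_power)
  also have "\<dots> \<le> exp (C * (1 + 3 * R) powr \<kappa>)" using growth[of z] z by simp
  finally show "norm (q z) \<le> exp (C * (1 + 3 * R) powr \<kappa>) / 2 ^ (\<Sum>c\<in>T. zero_mult f c)"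
    by (simp add: field_simps)
qed (use z in \<open>auto intro!: holomorphic_on_imp_continuous_on holomorphic_on_subset[OF q(1)]\<close>)

text \<open>A substitute for Jensen's formula: evaluating the cofactor bound at 0, where the
  cofactor equals \<open>u 0\<close>, shows that 2 to the number of zeros is at most exp (C * (1 + 3
  R) powr \<kappa>) / |u 0|.\<close>

lemma zero_count:
  obtains K where "K \<ge> 0" "\<And>T R. \<lbrakk>finite T; T \<subseteq> nonzero_zeros f; T \<subseteq> cball 0 R; R \<ge> 1\<rbrakk> \<Longrightarrow>
    (\<Sum>c\<in>T. real (zero_mult f c)) \<le> K * R powr \<kappa>"
proof
  \<comment> \<open>For R >= 1 both 1 + 3 R <= 4 R and R powr \<kappa> >= 1 hold, so the two
    contributions are absorbed in a multiple of R powr \<kappa>.\<close>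
  let ?K = "(C * 4 powr \<kappa> + \<bar>ln (norm (u 0))\<bar>) / ln 2"
  show "?K \<ge> 0" using C_nonneg by simp
  fix T and R :: real assume *: "finite T" "T \<subseteq> nonzero_zeros f" "T \<subseteq> cball 0 R" "R \<ge> 1"
  obtain q where q: "q holomorphic_on UNIV" "\<And>z. u z = (\<Prod>c\<in>T. (1 - z / c) ^ zero_mult f c) * q z"
    "q 0 = u 0" using factor[OF *(1,2)] by metis
  have "norm (u 0) \<le> exp (C * (1 + 3 * R) powr \<kappa>) / 2 ^ (\<Sum>c\<in>T. zero_mult f c)"
    using norm_cofactor_le[OF * q(1,2), of 0] * q(3) by simp
  hence "ln (norm (u 0)) \<le> ln (exp (C * (1 + 3 * R) powr \<kappa>) / 2 ^ (\<Sum>c\<in>T. zero_mult f c))"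
    using u_0 by (subst ln_le_cancel_iff) auto
  hence "(\<Sum>c\<in>T. real (zero_mult f c)) * ln 2 \<le> C * (1 + 3 * R) powr \<kappa> + \<bar>ln (norm (u 0))\<bar>"
    by (simp add: ln_div ln_realpow)
  also have "\<dots> \<le> C * (4 powr \<kappa> * R powr \<kappa>) + \<bar>ln (norm (u 0))\<bar> * R powr \<kappa>"
  proof (intro add_mono mult_left_mono)
    show "(1 + 3 * R) powr \<kappa> \<le> 4 powr \<kappa> * R powr \<kappa>"
      using * \<kappa>_pos by (subst powr_mult[symmetric]) (auto intro!: powr_mono2)
    show "\<bar>ln (norm (u 0))\<bar> \<le> \<bar>ln (norm (u 0))\<bar> * R powr \<kappa>"
      using * \<kappa>_pos mult_left_mono[OF ge_one_powr_ge_zero[of R \<kappa>], of "\<bar>ln (norm (u 0))\<bar>"] by simp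
  qed (use C_nonneg in auto)
  finally show "(\<Sum>c\<in>T. real (zero_mult f c)) \<le> ?K * R powr \<kappa>"
    by (simp add: field_simps)
qed

text \<open>A dyadic decomposition: a zero with norm about 2^k has weight comparable to 1 / 4^k, and
  the count in the disc of radius 2^k is of size 2^(k \<kappa>). The ratio \<open>\<rho>\<close> of
  the resulting geometric series is below 1 because \<kappa> < 2.\<close>

lemma summable_zeros: "(\<lambda>c. zero_mult f c / norm c ^ 2) summable_on nonzero_zeros f"
proof (rule nonneg_bdd_above_summable_on)
  obtain K where K: "K \<ge> 0" "\<And>T R. \<lbrakk>finite T; T \<subseteq> nonzero_zeros f; T \<subseteq> cball 0 R; R \<ge> 1\<rbrakk> \<Longrightarrow>
    (\<Sum>c\<in>T. real (zero_mult f c)) \<le> K * R powr \<kappa>"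
    using zero_count by blast
  define t where "t = (\<lambda>c. zero_mult f c / norm c ^ 2)"
  have t0: "t c \<ge> 0" for c by (simp add: t_def)
  define \<rho> where "\<rho> = 2 powr \<kappa> / 4"
  have \<rho>: "0 < \<rho>" "\<rho> < 1" using powr_less_mono[OF \<kappa>_less, of 2] by (simp_all add: \<rho>_def)
  show "bdd_above (sum t ` {F. F \<subseteq> nonzero_zeros f \<and> finite F})"
  proof (rule bdd_aboveI2)
    fix S assume "S \<in> {F. F \<subseteq> nonzero_zeros f \<and> finite F}"
    hence S: "S \<subseteq> nonzero_zeros f" "finite S" by auto
    obtain N where N: "S \<subseteq> cball 0 (2 ^ N)"
    proof -
      obtain B where B: "\<And>x. x \<in> S \<Longrightarrow> norm x \<le> B"
        using finite_imp_bounded[OF S(2)] by (auto simp: bounded_iff)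
      obtain N where "B < 2 ^ N" using real_arch_pow[of 2 B] by auto
      thus ?thesis using B by (intro that[of N]) force
    qed
    define S1 where "S1 = S \<inter> cball 0 1"
    define S2 where "S2 = S - cball 0 1"
    have "sum t S = sum t S1 + sum t S2"
      unfolding S1_def S2_def using S by (metis sum.Int_Diff)
    also have "sum t S1 \<le> sum t (nonzero_zeros f \<inter> cball 0 1)"
      using finite_zeros[of 1] S t0 by (intro sum_mono2) (auto simp: S1_def)
    also have "sum t S2 \<le> 4 * K * (1 / (1 - \<rho>))"
    proof -
      \<comment> \<open>Each zero is charged to every disc that contains it, not only to its shell.
        This overcounts, but after swapping the sums the inner ones are counts over discs, as in
        \<open>zero_count\<close>.\<close>
      have "sum t S2 \<le> (\<Sum>c\<in>S2. \<Sum>k\<le>N. if norm c \<le> 2 ^ k then 4 * zero_mult f c / 4 ^ k else 0)"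
      proof (rule sum_mono)
        fix c assume c: "c \<in> S2"
        define k where "k = (LEAST k. norm c \<le> 2 ^ k)"
        have cN: "norm c \<le> 2 ^ N" and c1: "norm c > 1" using c N by (auto simp: S2_def)
        have k: "norm c \<le> 2 ^ k" "k \<le> N"
          unfolding k_def using LeastI[of "\<lambda>k. norm c \<le> 2 ^ k", OF cN] Least_le[of "\<lambda>k. norm c \<le> 2 ^ k", OF cN] by auto
        have "k \<noteq> 0" using k(1) c1 by (cases k) auto
        then obtain l where l: "k = Suc l" by (cases k) auto
        have "\<not> norm c \<le> 2 ^ l"
          using not_less_Least[of l "\<lambda>k. norm c \<le> 2 ^ k"] l by (simp add: k_def)
        hence "2 ^ k / 2 \<le> norm c" by (simp add: l)
        hence "(2 ^ k / 2) ^ 2 \<le> norm c ^ 2" by (intro power_mono) auto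
        hence *: "4 ^ k / 4 \<le> norm c ^ 2"
          by (simp add: power_divide power2_eq_square flip: power_mult_distrib)
        have "t c \<le> zero_mult f c / (4 ^ k / 4)"
          unfolding t_def by (intro divide_left_mono * mult_pos_pos) (use c1 in auto)
        also have "\<dots> = (if norm c \<le> 2 ^ k then 4 * zero_mult f c / 4 ^ k else 0)"
          using k by simp
        also have "\<dots> \<le> (\<Sum>k\<le>N. if norm c \<le> 2 ^ k then 4 * zero_mult f c / 4 ^ k else 0)"
          using k by (intro member_le_sum) auto
        finally show "t c \<le> (\<Sum>k\<le>N. if norm c \<le> 2 ^ k then 4 * zero_mult f c / 4 ^ k else 0)" .
      qed
      also have "\<dots> = (\<Sum>k\<le>N. \<Sum>c\<in>S2. if norm c \<le> 2 ^ k then 4 * zero_mult f c / 4 ^ k else 0)"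
        by (rule sum.swap)
      also have "\<dots> \<le> (\<Sum>k\<le>N. 4 * K * \<rho> ^ k)"
      proof (rule sum_mono)
        fix k
        have fin: "finite S2" using S by (simp add: S2_def)
        have "(\<Sum>c\<in>S2. if norm c \<le> 2 ^ k then 4 * zero_mult f c / 4 ^ k else 0)
                = 4 / 4 ^ k * (\<Sum>c\<in>S2 \<inter> cball 0 (2 ^ k). real (zero_mult f c))"
          using fin by (simp add: sum_distrib_left sum.inter_restrict if_distrib cong: if_cong)
        also have "\<dots> \<le> 4 / 4 ^ k * (K * (2 ^ k) powr \<kappa>)"
          using S fin by (intro mult_left_mono K(2)) (auto simp: S2_def)
        also have "(2 ^ k) powr \<kappa> = (2 powr \<kappa>) ^ k"
          by (simp add: powr_powr mult.commute flip: powr_realpow)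
        also have "4 / 4 ^ k * (K * (2 powr \<kappa>) ^ k) = 4 * K * \<rho> ^ k"
          by (simp add: \<rho>_def power_divide)
        finally show "(\<Sum>c\<in>S2. if norm c \<le> 2 ^ k then 4 * zero_mult f c / 4 ^ k else 0) \<le> 4 * K * \<rho> ^ k" .
      qed
      also have "\<dots> = 4 * K * (\<Sum>k\<le>N. \<rho> ^ k)" by (simp add: sum_distrib_left)
      also have "\<dots> \<le> 4 * K * (1 / (1 - \<rho>))"
        using \<rho> K sum_le_suminf[of "\<lambda>k. \<rho> ^ k" "{..N}"] suminf_geometric[of \<rho>]
        by (intro mult_left_mono) auto
      finally show ?thesis .
    qed
    finally show "sum t S \<le> sum t (nonzero_zeros f \<inter> cball 0 1) + 4 * K * (1 / (1 - \<rho>))" by simp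
  qed
qed auto

end

lemma prod_one_minus_has_field_derivative:
  fixes m :: "complex \<Rightarrow> nat"
  assumes "finite T"
  shows "((\<lambda>z. \<Prod>c\<in>T. (1 - z / c) ^ m c) has_field_derivative - (\<Sum>c\<in>T. of_nat (m c) / c)) (at 0)"
  using assms
proof (induction T rule: finite_induct)
  case (insert c T)
  have "((\<lambda>z. (1 - z / c) ^ m c) has_field_derivative - (of_nat (m c) / c)) (at 0)"
    \<comment> \<open>At c = 0 the factor is constantly 1 and \<open>of_nat (m c) / c\<close> is 0,
      both by division by zero.\<close>
    by (cases "c = 0") (auto intro!: derivative_eq_intros)
  from DERIV_mult[OF this insert.IH] show ?case
    using insert.hyps by (simp add: algebra_simps)
qed auto

context subquadratic_entire
begin

text \<open>
  Dividing \<open>f\<close> by its zeros of modulus at most \<open>R\<close> leaves \<open>exp k\<close> on the ball of radius \<open>R\<close>. The maximum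
  modulus principle on the ball of radius \<open>3 R\<close> bounds \<open>Re k\<close>, and Borel-Caratheodory shows that \<open>k\<close> is
  almost affine.
\<close>

lemma partial_product_error:
  fixes A B z :: complex and R :: real
  defines "T \<equiv> nonzero_zeros f \<inter> cball 0 R"
  assumes A: "exp A = u 0" and B: "B = - deriv u 0 / u 0" and R: "R \<ge> 1" "norm z \<le> R / 4"
  obtains d where "exp (A - B * z) * z ^ zero_mult f 0 * (\<Prod>c\<in>T. ((1 - z / c) * exp (z / c)) ^ zero_mult f c)
      = f z * exp (- d)" "norm d \<le> 64 * (C * (1 + 3 * R) powr \<kappa> + 1 - Re A) / R\<^sup>2 * norm z ^ 2"
proof -
  have T: "finite T" "T \<subseteq> nonzero_zeros f" "T \<subseteq> cball 0 R"
    using finite_zeros by (auto simp: T_def)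
  obtain q where q: "q holomorphic_on UNIV" "\<And>z. u z = (\<Prod>c\<in>T. (1 - z / c) ^ zero_mult f c) * q z"
    "\<And>c. c \<in> T \<Longrightarrow> q c \<noteq> 0" "q 0 = u 0" using factor[OF T(1,2)] by metis
  have q_nz: "q x \<noteq> 0" if "x \<in> ball 0 R" for x
  proof (cases "x \<in> T")
    case False
    hence "u x \<noteq> 0" using that by (auto simp: T_def u_eq_0_iff)
    thus ?thesis using q(2)[of x] by auto
  qed (use q in auto)
  obtain k0 where k0: "k0 holomorphic_on ball 0 R" "\<And>x. x \<in> ball 0 R \<Longrightarrow> exp (k0 x) = q x"
    using holomorphic_logarithm_exists[OF convex_ball open_ball holomorphic_on_subset[OF q(1)], of 0 R 0] q_nz R
    by auto
  \<comment> \<open>The logarithm \<open>k0\<close> is determined only up to a constant; the shift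
    selects the branch with \<open>k 0 = A\<close>.\<close>
  define k where "k = (\<lambda>x. k0 x - k0 0 + A)"
  have hk: "k holomorphic_on ball 0 R" unfolding k_def by (intro holomorphic_intros k0)
  have k_exp: "exp (k x) = q x" if "x \<in> ball 0 R" for x
    using k0(2)[OF that] k0(2)[of 0] R q(4) A u_0 by (simp add: k_def exp_add exp_diff)
  define M where "M = C * (1 + 3 * R) powr \<kappa>"
  have Re_k: "Re (k x) \<le> M" if "x \<in> ball 0 R" for x
  proof -
    have "exp (Re (k x)) = norm (q x)" using k_exp[OF that] by (metis norm_exp_eq_Re)
    also have "\<dots> \<le> exp M / 2 ^ (\<Sum>c\<in>T. zero_mult f c)"
      unfolding M_def using that R by (intro norm_cofactor_le T q) auto
    also have "\<dots> \<le> exp M / 1" by (intro divide_left_mono) auto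
    finally show ?thesis by simp
  qed
  define d where "d = k z - k 0 - deriv k 0 * z"
  have k_0: "k 0 = A" by (simp add: k_def)
  have d: "norm d \<le> 64 * (M + 1 - Re A) / R\<^sup>2 * norm z ^ 2"
    using Borel_Caratheodory_second_order[OF hk _ Re_k R(2)] R k_0 by (simp add: d_def)
  \<comment> \<open>Comparing derivatives at 0 in u = product * exp k identifies the linear part of
    \<open>k\<close>: it consists of the -B z of the prefactor and exactly the exponents z / c of
    the Weierstrass factors.\<close>
  have dk: "deriv k 0 = - B + (\<Sum>c\<in>T. of_nat (zero_mult f c) / c)"
  proof -
    have 1: "((\<lambda>x. (\<Prod>c\<in>T. (1 - x / c) ^ zero_mult f c) * exp (k x)) has_field_derivative
        - (\<Sum>c\<in>T. of_nat (zero_mult f c) / c) * exp (k 0) + deriv k 0 * exp (k 0) * 1) (at 0)"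
      using DERIV_mult[OF prod_one_minus_has_field_derivative[OF T(1), of "zero_mult f"]
          DERIV_fun_exp[OF holomorphic_derivI[OF hk open_ball, of 0]]] R by (simp add: algebra_simps)
    have eq: "(\<Prod>c\<in>T. (1 - x / c) ^ zero_mult f c) * exp (k x) = u x" if "x \<in> ball 0 R" for x
      by (simp only: k_exp[OF that] flip: q(2))
    have "0 \<in> ball (0::complex) R" using R by simp
    from has_field_derivative_transform_within_open[OF 1 open_ball this eq]
    have "deriv u 0 = - (\<Sum>c\<in>T. of_nat (zero_mult f c) / c) * exp (k 0) + deriv k 0 * exp (k 0) * 1"
      by (rule DERIV_imp_deriv)
    hence "deriv u 0 = (- (\<Sum>c\<in>T. of_nat (zero_mult f c) / c) + deriv k 0) * u 0"
      using A k_0 by (simp add: algebra_simps)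
    hence "deriv u 0 / u 0 = - (\<Sum>c\<in>T. of_nat (zero_mult f c) / c) + deriv k 0"
      using u_0 by simp
    thus ?thesis using B by simp
  qed
  have zR: "z \<in> ball 0 R" using R by simp
  have E: "(\<Prod>c\<in>T. ((1 - z / c) * exp (z / c)) ^ zero_mult f c)
      = (\<Prod>c\<in>T. (1 - z / c) ^ zero_mult f c) * exp (\<Sum>c\<in>T. of_nat (zero_mult f c) / c * z)"
    by (simp add: power_mult_distrib prod.distrib exp_sum T(1) flip: exp_of_nat_mult)
  have "exp (A - B * z) * z ^ zero_mult f 0 * (\<Prod>c\<in>T. ((1 - z / c) * exp (z / c)) ^ zero_mult f c)
      = z ^ zero_mult f 0 * (\<Prod>c\<in>T. (1 - z / c) ^ zero_mult f c) *
        exp (A - B * z + (\<Sum>c\<in>T. of_nat (zero_mult f c) / c * z))"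
    unfolding E exp_add by (simp only: mult_ac)
  also have "A - B * z + (\<Sum>c\<in>T. of_nat (zero_mult f c) / c * z) = k z - d"
    by (simp add: d_def dk k_0 algebra_simps sum_distrib_left)
  also have "exp (k z - d) = q z * exp (- d)"
    by (simp add: exp_diff exp_minus k_exp[OF zR] field_simps)
  also have "z ^ zero_mult f 0 * (\<Prod>c\<in>T. (1 - z / c) ^ zero_mult f c) * (q z * exp (- d)) = f z * exp (- d)"
    using f_eq[of z] q(2)[of z] by simp
  finally show ?thesis by (rule that) (rule d[unfolded M_def])
qed

text \<open>The error exponent is at most a multiple of (1 + 3 n) powr \<kappa> / n^2 plus a
  multiple of 1 / n^2, which vanishes in the limit because \<kappa> < 2. So far the zeros are only
  exhausted by discs.\<close>

lemma partial_products_tendsto: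
  assumes A: "exp A = u 0" and B: "B = - deriv u 0 / u 0"
  shows "(\<lambda>n. exp (A - B * z) * z ^ zero_mult f 0 *
      (\<Prod>c\<in>nonzero_zeros f \<inter> cball 0 (real n). ((1 - z / c) * exp (z / c)) ^ zero_mult f c)) \<longlonglongrightarrow> f z"
    (is "?P \<longlonglongrightarrow> _")
proof -
  define \<epsilon> where "\<epsilon> = (\<lambda>n. 64 * (C * (1 + 3 * real n) powr \<kappa> + 1 - Re A) / (real n)\<^sup>2 * norm z ^ 2)"
  have ex: "\<exists>d. ?P n = f z * exp (- d) \<and> norm d \<le> \<epsilon> n" if "real n \<ge> 1" "norm z \<le> real n / 4" for n
    unfolding \<epsilon>_def by (rule partial_product_error[OF A B that]) blast
  define d where "d = (\<lambda>n. SOME d. ?P n = f z * exp (- d) \<and> norm d \<le> \<epsilon> n)"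
  have d: "?P n = f z * exp (- d n) \<and> norm (d n) \<le> \<epsilon> n" if "real n \<ge> 1" "norm z \<le> real n / 4" for n
    unfolding d_def by (rule someI_ex) (rule ex[OF that])
  have ev: "eventually (\<lambda>n. real n \<ge> 1 \<and> norm z \<le> real n / 4) sequentially"
    using eventually_ge_at_top[of "max 1 (nat \<lceil>4 * norm z\<rceil>)"] by eventually_elim linarith
  have pw: "(\<lambda>n. (1 + 3 * real n) powr \<kappa> / (real n)\<^sup>2) \<longlonglongrightarrow> 0"
  proof (rule tendsto_sandwich[of "\<lambda>_. 0" _ _ "\<lambda>n. 4 powr \<kappa> * real n powr (\<kappa> - 2)"])
    show "\<forall>\<^sub>F n in sequentially. (1 + 3 * real n) powr \<kappa> / (real n)\<^sup>2 \<le> 4 powr \<kappa> * real n powr (\<kappa> - 2)"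
      using eventually_ge_at_top[of 1]
    proof eventually_elim
      case (elim n)
      have "(1 + 3 * real n) powr \<kappa> \<le> 4 powr \<kappa> * real n powr \<kappa>"
        using elim \<kappa>_pos by (subst powr_mult[symmetric]) (auto intro!: powr_mono2)
      thus ?case using elim by (simp add: powr_diff field_simps)
    qed
    have "(\<lambda>n. real n powr - (2 - \<kappa>)) \<longlonglongrightarrow> 0"
      by (rule tendsto_neg_powr) (use \<kappa>_less filterlim_real_sequentially in auto)
    thus "(\<lambda>n. 4 powr \<kappa> * real n powr (\<kappa> - 2)) \<longlonglongrightarrow> 0"
      by (auto intro: tendsto_mult_right_zero)
  qed auto
  have "\<epsilon> = (\<lambda>n. (64 * C * norm z ^ 2) * ((1 + 3 * real n) powr \<kappa> / (real n)\<^sup>2) +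
              64 * (1 - Re A) * norm z ^ 2 * (inverse (real n))\<^sup>2)"
    by (auto simp: \<epsilon>_def fun_eq_iff field_simps add_divide_distrib diff_divide_distrib)
  moreover have "\<dots> \<longlonglongrightarrow> (64 * C * norm z ^ 2) * 0 + 64 * (1 - Re A) * norm z ^ 2 * 0\<^sup>2"
    by (intro tendsto_intros pw lim_inverse_n)
  ultimately have "\<epsilon> \<longlonglongrightarrow> 0" by simp
  hence "d \<longlonglongrightarrow> 0"
    by (rule tendsto_0_le[where K = 1]) (use ev d in \<open>force elim!: eventually_mono\<close>)
  hence "(\<lambda>n. f z * exp (- d n)) \<longlonglongrightarrow> f z * exp (- 0)"
    by (intro tendsto_intros)
  hence "(\<lambda>n. f z * exp (- d n)) \<longlonglongrightarrow> f z" by simp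
  moreover have "eventually (\<lambda>n. f z * exp (- d n) = ?P n) sequentially"
    using ev by eventually_elim (use d in auto)
  ultimately show ?thesis by (rule Lim_transform_eventually)
qed

end

lemma summable_on_tail_small:
  fixes t :: "'i \<Rightarrow> real"
  assumes t: "t summable_on Z" "\<And>x. x \<in> Z \<Longrightarrow> t x \<ge> 0" and "\<epsilon> > 0"
  obtains S0 where "finite S0" "S0 \<subseteq> Z" "\<And>S. finite S \<Longrightarrow> S \<subseteq> Z \<Longrightarrow> S \<inter> S0 = {} \<Longrightarrow> sum t S < \<epsilon>"
proof -
  obtain S0 where S0: "finite S0" "S0 \<subseteq> Z" "dist (sum t S0) (infsum t Z) \<le> \<epsilon> / 2"
    using infsum_finite_approximation[OF t(1), of "\<epsilon> / 2"] \<open>\<epsilon> > 0\<close> by auto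
  show ?thesis
  proof (rule that[OF S0(1,2)])
    fix S assume S: "finite S" "S \<subseteq> Z" "S \<inter> S0 = {}"
    have "sum t S + sum t S0 = sum t (S \<union> S0)"
      using S S0 by (simp add: sum.union_disjoint)
    also have "\<dots> \<le> infsum t Z"
      using S S0 t by (intro finite_sum_le_infsum) auto
    finally show "sum t S < \<epsilon>" using S0(3) \<open>\<epsilon> > 0\<close> unfolding dist_real_def by linarith
  qed
qed

context subquadratic_entire
begin

text \<open>Convergence along discs becomes unconditional convergence: each factor of a distant zero
  is 1 + O(|z / c|^2), so adjoining any finite set of zeros outside a large disc multiplies the
  partial product by a number close to 1.\<close>

theorem hadamard:
  assumes A: "exp A = u 0" and B: "B = - deriv u 0 / u 0"
  shows "hadamard_factorization f A B"
  unfolding hadamard_factorization_def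
proof
  fix z
  define p where "p = (\<lambda>S. \<Prod>c\<in>S. ((1 - z / c) * exp (z / c)) ^ zero_mult f c)"
  define a where "a = exp (A - B * z) * z ^ zero_mult f 0"
  define T where "T = (\<lambda>n. nonzero_zeros f \<inter> cball 0 (real n))"
  define t where "t = (\<lambda>c. zero_mult f c / norm c ^ 2)"
  have t_sum: "t summable_on nonzero_zeros f" unfolding t_def by (rule summable_zeros)
  have t_nonneg: "t c \<ge> 0" for c by (simp add: t_def)
  have lim: "(\<lambda>n. a * p (T n)) \<longlonglongrightarrow> f z"
    using partial_products_tendsto[OF A B, of z] by (simp add: a_def p_def T_def)
  have tail: "norm (p S - 1) \<le> exp (3 * norm z ^ 2 * sum t S) - 1"
    if S: "\<And>c. c \<in> S \<Longrightarrow> norm z \<le> norm c / 2" "S \<subseteq> nonzero_zeros f" for S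
  proof -
    have "norm (p S - 1) \<le> exp (\<Sum>c\<in>S. zero_mult f c * norm ((1 - z / c) * exp (z / c) - 1)) - 1"
      unfolding p_def by (rule norm_prod_power_minus_1_le)
    also have "(\<Sum>c\<in>S. zero_mult f c * norm ((1 - z / c) * exp (z / c) - 1)) \<le> (\<Sum>c\<in>S. 3 * norm z ^ 2 * t c)"
    proof (rule sum_mono)
      fix c assume c: "c \<in> S"
      hence "c \<noteq> 0" using S by (auto simp: nonzero_zeros_def)
      hence "norm (z / c) \<le> 1 / 2" using S(1)[OF c] by (simp add: norm_divide field_simps)
      from weierstrass_factor_bound[OF this, of 1]
      have "norm ((1 - z / c) * exp (z / c) - 1) \<le> 3 * norm (z / c) ^ 2"
        by (simp add: weierstrass_factor_def power2_eq_square)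
      from mult_left_mono[OF this, of "real (zero_mult f c)"]
      show "zero_mult f c * norm ((1 - z / c) * exp (z / c) - 1) \<le> 3 * norm z ^ 2 * t c"
        by (simp add: t_def norm_divide power_divide mult_ac)
    qed
    finally show ?thesis by (simp add: sum_distrib_left)
  qed
  show "((\<lambda>S. exp (A - B * z) * z ^ zero_mult f 0 * (\<Prod>\<gamma>\<in>S. ((1 - z / \<gamma>) * exp (z / \<gamma>)) ^ zero_mult f \<gamma>))
      \<longlongrightarrow> f z) (finite_subsets_at_top (nonzero_zeros f))"
  proof (rule tendstoI)
    fix e :: real assume e: "e > 0"
    \<comment> \<open>\<open>N\<close> bounds the norm of the partial product over the chosen disc,
      and \<open>\<delta>\<close> solves exp ((3 |z|^2 + 1) * \<delta>) - 1 = e / (2 N). The 3 is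
      the constant in the estimate of a Weierstrass factor; the extra 1 avoids a zero denominator at
      z = 0.\<close>
    define N where "N = norm (f z) + e"
    define \<delta> where "\<delta> = ln (1 + e / (2 * N)) / (3 * norm z ^ 2 + 1)"
    have N: "N > 0" using e by (simp add: N_def add_nonneg_pos)
    have \<delta>: "\<delta> > 0" using e N by (auto simp: \<delta>_def add_nonneg_pos)
    obtain S0 where S0: "finite S0" "S0 \<subseteq> nonzero_zeros f"
      "\<And>S. finite S \<Longrightarrow> S \<subseteq> nonzero_zeros f \<Longrightarrow> S \<inter> S0 = {} \<Longrightarrow> sum t S < \<delta>"
      by (rule summable_on_tail_small[OF t_sum t_nonneg \<delta>]) (assumption | rule that)+
    obtain b where b: "\<And>c. c \<in> S0 \<Longrightarrow> norm c \<le> b"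
      using finite_imp_bounded[OF S0(1)] by (auto simp: bounded_iff)
    have "eventually (\<lambda>n. dist (a * p (T n)) (f z) < e / 2) sequentially"
      using tendstoD[OF lim, of "e / 2"] e by simp
    moreover have "eventually (\<lambda>n. b \<le> real n \<and> 2 * norm z \<le> real n) sequentially"
      using eventually_ge_at_top[of "nat \<lceil>max b (2 * norm z)\<rceil>"] by eventually_elim linarith
    ultimately have "eventually (\<lambda>n. dist (a * p (T n)) (f z) < e / 2 \<and> b \<le> real n \<and> 2 * norm z \<le> real n) sequentially"
      by eventually_elim auto
    \<comment> \<open>The disc of radius \<open>n\<close> contains \<open>S0\<close>, so what lies
      outside it has small total weight, and outside it every zero has at least twice the norm of
      \<open>z\<close>.\<close>
    then obtain n where n: "dist (a * p (T n)) (f z) < e / 2" "b \<le> real n" "2 * norm z \<le> real n"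
      using eventually_happens' sequentially_bot by blast
    have "finite (T n)" unfolding T_def by (rule finite_zeros)
    have "dist (a * p S) (f z) < e" if S: "finite S" "T n \<subseteq> S" "S \<subseteq> nonzero_zeros f" for S
    proof -
      have "S0 \<subseteq> T n" using S0(2) b n(2) by (force simp: T_def)
      hence tl: "sum t (S - T n) < \<delta>" using S by (intro S0(3)) auto
      have "norm (p (S - T n) - 1) \<le> exp (3 * norm z ^ 2 * sum t (S - T n)) - 1"
        using S n(3) by (intro tail) (auto simp: T_def)
      also have "3 * norm z ^ 2 * sum t (S - T n) \<le> (3 * norm z ^ 2 + 1) * \<delta>"
        using tl \<delta> by (intro mult_mono) (auto simp: t_def sum_nonneg)
      also have "(3 * norm z ^ 2 + 1) * \<delta> = ln (1 + e / (2 * N))"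
        by (simp add: \<delta>_def add_nonneg_eq_0_iff)
      also have "exp \<dots> - 1 = e / (2 * N)" using e N by (simp add: add_pos_nonneg)
      finally have small: "norm (p (S - T n) - 1) \<le> e / (2 * N)" by simp
      have "p S = p (T n) * p (S - T n)"
        unfolding p_def using prod.subset_diff[OF S(2,1)] by (simp only: mult.commute)
      hence "a * p S - a * p (T n) = a * p (T n) * (p (S - T n) - 1)" by (simp add: algebra_simps)
      hence "norm (a * p S - a * p (T n)) = norm (a * p (T n)) * norm (p (S - T n) - 1)"
        by (metis norm_mult)
      also have "\<dots> \<le> N * (e / (2 * N))"
      proof (intro mult_mono small)
        show "norm (a * p (T n)) \<le> N"
          using n(1) norm_triangle_ineq2[of "a * p (T n)" "f z"] e by (simp add: N_def dist_norm)
      qed (use N in auto)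
      also have "\<dots> = e / 2" using less_imp_neq[OF N] by (simp only: times_divide_eq_right mult_divide_mult_cancel_left_if mult.commute[of 2 N]) auto
      finally have "norm (a * p S - a * p (T n)) \<le> e / 2" .
      thus ?thesis using n(1) norm_triangle_ineq[of "a * p S - a * p (T n)" "a * p (T n) - f z"]
        by (simp add: dist_norm)
    qed
    hence "\<forall>\<^sub>F S in finite_subsets_at_top (nonzero_zeros f). dist (a * p S) (f z) < e"
      unfolding eventually_finite_subsets_at_top
      using \<open>finite (T n)\<close> by (intro exI[of _ "T n"]) (auto simp: T_def)
    thus "\<forall>\<^sub>F S in finite_subsets_at_top (nonzero_zeros f). dist (exp (A - B * z) * z ^ zero_mult f 0 *
        (\<Prod>\<gamma>\<in>S. ((1 - z / \<gamma>) * exp (z / \<gamma>)) ^ zero_mult f \<gamma>)) (f z) < e"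
      by (simp add: a_def p_def)
  qed
qed

end

section \<open>Uniqueness and symmetry of the factorization\<close>

lemma zero_mult_pos:
  assumes "f holomorphic_on UNIV" "f w \<noteq> 0" "f z = 0"
  shows "zero_mult f z > 0"
  using zorder_exist_zero[of f UNIV z] assms by (auto simp: zero_mult_def)

text \<open>Both factorizations share the product over the zeros, so the quotient \<open>h\<close>
  of the exponential prefactors satisfies f * h = f. It is 1 on the open set where \<open>f\<close>
  does not vanish, hence everywhere, and its derivative at 0 is B - B'.\<close>

lemma hadamard_factorization_unique_B:
  assumes hol: "f holomorphic_on UNIV" and nz: "f w \<noteq> 0"
    and AB: "hadamard_factorization f A B" "hadamard_factorization f A' B'"
  shows "B = B'"
proof -
  define h where "h = (\<lambda>z. exp ((A' - B' * z) - (A - B * z)))"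
  have eq: "f z * h z = f z" for z
  proof -
    let ?P = "\<lambda>A B S. exp (A - B * z) * z ^ zero_mult f 0 *
               (\<Prod>\<gamma>\<in>S. ((1 - z / \<gamma>) * exp (z / \<gamma>)) ^ zero_mult f \<gamma>)"
    have "((\<lambda>S. ?P A B S * h z) \<longlongrightarrow> f z * h z) (finite_subsets_at_top (nonzero_zeros f))"
      using AB(1) by (intro tendsto_mult tendsto_const) (auto simp: hadamard_factorization_def)
    moreover have "(\<lambda>S. ?P A B S * h z) = ?P A' B'"
      by (simp add: fun_eq_iff h_def exp_diff)
    ultimately have "(?P A' B' \<longlongrightarrow> f z * h z) (finite_subsets_at_top (nonzero_zeros f))"
      by simp
    thus ?thesis
      using AB(2) unfolding hadamard_factorization_def
      by (meson tendsto_unique finite_subsets_at_top_neq_bot)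
  qed
  have "h z = 1" for z
  proof (rule analytic_continuation_open[where s = "{z. f z \<noteq> 0}" and s' = UNIV and f = h and g = "\<lambda>_. 1"])
    show "open {z. f z \<noteq> 0}"
      using open_Collect_neq[OF holomorphic_on_imp_continuous_on[OF hol] continuous_on_const] by simp
    show "h holomorphic_on UNIV" unfolding h_def by (intro holomorphic_intros)
    show "h z = 1" if "z \<in> {z. f z \<noteq> 0}" for z using eq[of z] that by simp
  qed (use nz in auto)
  hence "h = (\<lambda>_. 1)" by auto
  moreover have "(h has_field_derivative (B - B') * h 0) (at 0)"
    unfolding h_def by (auto intro!: derivative_eq_intros)
  ultimately show "B = B'"
    using DERIV_unique[of "\<lambda>_. 1" "B - B'" 0 0] by simp
qed

lemma
  assumes hol: "f holomorphic_on UNIV" and nz: "f w \<noteq> 0" and \<omega>: "\<omega> \<noteq> 0"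
    and sym: "\<And>z. f z = \<omega> * cnj (f (cnj z))"
  shows zero_mult_cnj: "zero_mult f (cnj c) = zero_mult f c"
    and nonzero_zeros_cnj: "cnj ` nonzero_zeros f = nonzero_zeros f"
proof -
  obtain q where q: "q holomorphic_on UNIV" "\<And>z. f z = (z - c) ^ zero_mult f c * q z" "q c \<noteq> 0"
    using divide_zero[OF hol nz] by metis
  \<comment> \<open>Reflecting the factorization at \<open>c\<close> gives one at
    \<open>cnj c\<close> with the same exponent.\<close>
  have eq: "f z = (\<omega> * (cnj \<circ> q \<circ> cnj) z) * (z - cnj c) ^ zero_mult f c" for z
    by (subst sym, subst q(2)) simp
  have "zorder f (cnj c) = int (zero_mult f c)"
  proof (rule zorder_eqI)
    have "(cnj \<circ> q \<circ> cnj) holomorphic_on UNIV"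
      using q(1) by (intro holomorphic_on_compose_cnj_cnj) (auto intro: holomorphic_on_subset)
    thus "(\<lambda>z. \<omega> * (cnj \<circ> q \<circ> cnj) z) holomorphic_on UNIV" by (intro holomorphic_intros)
    show "f z = \<omega> * (cnj \<circ> q \<circ> cnj) z * (z - cnj c) powi int (zero_mult f c)" for z
      using eq[of z] by simp
  qed (use q(3) \<omega> in auto)
  thus "zero_mult f (cnj c) = zero_mult f c" by (simp add: zero_mult_def)
  have "cnj z \<in> nonzero_zeros f" if "z \<in> nonzero_zeros f" for z
    using that sym[of z] \<omega> by (auto simp: nonzero_zeros_def)
  thus "cnj ` nonzero_zeros f = nonzero_zeros f"
    by (metis complex_cnj_cnj image_eqI image_subsetI subsetI subset_antisym)
qed

lemma subquadratic_entireI: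
  assumes "f holomorphic_on UNIV" "f w \<noteq> 0" "\<And>z. norm (f z) \<le> exp (C * (1 + norm z) powr \<kappa>)"
    "C \<ge> 0" "0 < \<kappa>" "\<kappa> < 2"
  obtains u where "subquadratic_entire f u C \<kappa>"
proof -
  obtain u where u: "u holomorphic_on UNIV" "\<And>z. f z = (z - 0) ^ zero_mult f 0 * u z" "u 0 \<noteq> 0"
    "\<And>z. z \<noteq> 0 \<Longrightarrow> zero_mult u z = zero_mult f z"
    using divide_zero[OF assms(1,2), of 0] by metis
  show ?thesis
    by (rule that, unfold_locales) (fact u u(2)[unfolded diff_zero] assms)+
qed

context subquadratic_entire
begin

text \<open>The origin itself may be a zero, so the witness comes from elsewhere: if
  \<open>f\<close> vanished identically, the unit disc would be finite.\<close>

lemma f_nonzero: obtains w where "f w \<noteq> 0"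
proof (rule ccontr)
  assume "\<not> thesis"
  hence "f z = 0" for z using that by blast
  hence "- {0} \<subseteq> nonzero_zeros f" by (auto simp: nonzero_zeros_def)
  hence "cball 0 1 \<subseteq> insert 0 (nonzero_zeros f \<inter> cball 0 1)" by auto
  hence "finite (cball (0::complex) 1)" using finite_zeros by (meson finite_insert finite_subset)
  thus False using islimpt_eq_infinite_cball[of "0::complex" UNIV] islimpt_UNIV by auto
qed

lemma hadamard_B_eq: "hadamard_B f = - deriv u 0 / u 0"
  unfolding hadamard_B_def
proof (rule the_equality)
  have "exp (Ln (u 0)) = u 0" using u_0 by simp
  from hadamard[OF this refl] show ex: "\<exists>A. hadamard_factorization f A (- deriv u 0 / u 0)" by blast
  fix B assume "\<exists>A. hadamard_factorization f A B"
  then obtain A A' where "hadamard_factorization f A B" "hadamard_factorization f A' (- deriv u 0 / u 0)"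
    using ex by auto
  moreover obtain w where "f w \<noteq> 0" by (rule f_nonzero)
  ultimately show "B = - deriv u 0 / u 0"
    using hadamard_factorization_unique_B[OF hol_f] by metis
qed

text \<open>The power of z at the origin commutes with conjugation, so \<open>u\<close> inherits the
  symmetry of \<open>f\<close> off 0, and at 0 by continuation. In the logarithmic derivative of
  \<open>u\<close> at 0 the factor \<open>\<omega>\<close> cancels, so that quotient is its own
  conjugate.\<close>

lemma hadamard_B_real:
  assumes \<omega>: "\<omega> \<noteq> 0" and sym: "\<And>z. f z = \<omega> * cnj (f (cnj z))"
  shows "hadamard_B f \<in> \<real>"
proof -
  have hc: "(cnj \<circ> u \<circ> cnj) holomorphic_on UNIV"
    using hol_u by (intro holomorphic_on_compose_cnj_cnj) (auto intro: holomorphic_on_subset)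
  have u_sym: "u z = \<omega> * (cnj \<circ> u \<circ> cnj) z" for z
  proof (rule analytic_continuation_open[where s = "- {0}" and s' = UNIV and g = "\<lambda>z. \<omega> * (cnj \<circ> u \<circ> cnj) z"])
    fix z :: complex assume "z \<in> - {0}"
    moreover from sym[of z] have "z ^ zero_mult f 0 * u z = z ^ zero_mult f 0 * (\<omega> * cnj (u (cnj z)))"
      unfolding f_eq[of z] f_eq[of "cnj z"] by simp
    ultimately show "u z = \<omega> * (cnj \<circ> u \<circ> cnj) z" by simp
  qed (use hol_u hc in \<open>auto intro!: holomorphic_intros simp del: o_apply\<close>)
  have "(u has_field_derivative deriv u 0) (at 0)"
    using hol_u by (intro holomorphic_derivI) auto
  hence "((cnj \<circ> u \<circ> cnj) has_field_derivative cnj (deriv u 0)) (at 0)"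
    using has_field_derivative_cnj_cnj[of u "deriv u 0" 0] by simp
  hence "((\<lambda>z. \<omega> * (cnj \<circ> u \<circ> cnj) z) has_field_derivative \<omega> * cnj (deriv u 0)) (at 0)"
    by (rule DERIV_cmult)
  moreover have "(\<lambda>z. \<omega> * (cnj \<circ> u \<circ> cnj) z) = u"
    by (rule ext) (rule u_sym[symmetric])
  ultimately have "deriv u 0 = \<omega> * cnj (deriv u 0)"
    by (intro DERIV_imp_deriv) simp
  moreover have "u 0 = \<omega> * cnj (u 0)" using u_sym[of 0] by (simp only: o_apply complex_cnj_zero)
  ultimately have "cnj (deriv u 0 / u 0) = deriv u 0 / u 0"
    using \<omega> u_0 by (metis complex_cnj_divide mult_divide_mult_cancel_left)
  hence "deriv u 0 / u 0 \<in> \<real>" by (simp add: Reals_cnj_iff)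
  thus ?thesis by (simp add: hadamard_B_eq)
qed

end

section \<open>Infinitely divisible distributions\<close>

lemma real_distribution_convolution:
  assumes "real_distribution M" "real_distribution N"
  shows "real_distribution (convolution M N)"
proof -
  interpret M: real_distribution M by fact
  interpret N: real_distribution N by fact
  interpret pair_prob_space M N ..
  show ?thesis unfolding convolution_def by (intro real_distribution_distr) simp
qed

lemma char_convolution:
  assumes "real_distribution M" "real_distribution N"
  shows "char (convolution M N) t = char M t * char N t"
proof -
  interpret M: real_distribution M by fact
  interpret N: real_distribution N by fact
  interpret pair_prob_space M N ..
  have "char (convolution M N) t = (CLINT p|M \<Otimes>\<^sub>M N. iexp (t * (fst p + snd p)))"
    unfolding char_def convolution_def by (subst integral_distr) (auto simp: case_prod_beta)
  also have "\<dots> = (CLINT x|M. CLINT y|N. iexp (t * (x + y)))"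
    by (subst integral_fst'[symmetric]) (auto intro!: integrable_const_bound[of _ 1] simp: case_prod_beta simp flip: of_real_mult of_real_add)
  also have "\<dots> = (CLINT x|M. CLINT y|N. iexp (t * x) * iexp (t * y))"
    by (simp add: exp_add algebra_simps)
  also have "\<dots> = char M t * char N t"
    by (simp add: char_def)
  finally show ?thesis .
qed

lemma real_distribution_return: "real_distribution (return borel (x::real))"
  unfolding real_distribution_def real_distribution_axioms_def
  by (auto intro: prob_space_return)

lemma char_return: "char (return borel x) t = iexp (t * x)"
  unfolding char_def by (subst integral_return) auto

lemma
  assumes "real_distribution \<nu>"
  shows real_distribution_convolution_power: "real_distribution (convolution_power \<nu> n)"
    and char_convolution_power: "char (convolution_power \<nu> n) t = char \<nu> t ^ n"
proof (induction n)
  case 0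
  show "real_distribution (convolution_power \<nu> 0)" "char (convolution_power \<nu> 0) t = char \<nu> t ^ 0"
    by (simp_all add: real_distribution_return char_return)
next
  case (Suc n)
  show "real_distribution (convolution_power \<nu> (Suc n))" "char (convolution_power \<nu> (Suc n)) t = char \<nu> t ^ Suc n"
    using assms Suc by (simp_all add: real_distribution_convolution char_convolution)
qed

section \<open>Construction of Gaussian and compound Poisson laws\<close>

text \<open>An affine image of the standard normal law, unlike a normal density, also makes sense
  for \<sigma> = 0. This degenerate case occurs when the rotated function does not vanish at
  0.\<close>

lemma gaussian_distribution:
  fixes \<sigma> b :: real
  obtains \<nu> where "real_distribution \<nu>" "\<And>t. char \<nu> t = exp (- (\<sigma>\<^sup>2 / 2) * t\<^sup>2 + \<i> * b * t)"
proof -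
  interpret S: real_distribution std_normal_distribution by (rule real_dist_normal_dist)
  define \<nu> where "\<nu> = distr std_normal_distribution borel (\<lambda>x. \<sigma> * x + b)"
  have "real_distribution \<nu>" unfolding \<nu>_def by (intro S.real_distribution_distr) simp
  moreover have "char \<nu> t = exp (- (\<sigma>\<^sup>2 / 2) * t\<^sup>2 + \<i> * b * t)" for t
  proof -
    have "char \<nu> t = (CLINT x|std_normal_distribution. iexp (t * (\<sigma> * x + b)))"
      unfolding char_def \<nu>_def by (subst integral_distr) auto
    also have "\<dots> = (CLINT x|std_normal_distribution. iexp (t * \<sigma> * x) * iexp (t * b))"
      by (simp add: exp_add algebra_simps)
    also have "\<dots> = char std_normal_distribution (t * \<sigma>) * iexp (t * b)"
      by (simp add: char_def mult.assoc)
    also have "\<dots> = exp (complex_of_real (- (\<sigma>\<^sup>2 / 2) * t\<^sup>2)) * exp (\<i> * b * t)"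
      unfolding char_std_normal_distribution by (simp add: power_mult_distrib mult_ac flip: exp_of_real)
    finally show ?thesis by (simp add: mult_exp_exp)
  qed
  ultimately show ?thesis by (rule that)
qed

text \<open>The mixture in which an index is drawn from \<open>P\<close> and then a point from
  \<open>K n\<close>. With a Poisson index and \<open>K n\<close> an n-th convolution power it is a
  compound Poisson law.\<close>

lemma char_bind_pmf:
  fixes K :: "nat \<Rightarrow> real measure" and P :: "nat pmf"
  assumes K: "\<And>n. real_distribution (K n)"
  shows "real_distribution (bind (measure_pmf P) K)"
    and "char (bind (measure_pmf P) K) t = (CLINT n|measure_pmf P. char (K n) t)"
proof -
  have Kd: "K n \<in> space (subprob_algebra borel)" for n
  proof -
    interpret real_distribution "K n" by (rule K)
    show ?thesis using prob_space_imp_subprob_space[OF prob_space_axioms] by (simp add: space_subprob_algebra)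
  qed
  hence Km: "K \<in> measurable (measure_pmf P) (subprob_algebra borel)" by simp
  have "prob_space (bind (measure_pmf P) K)"
    using K by (intro measure_pmf.prob_space_bind[OF _ Km]) (auto simp: real_distribution_def)
  moreover have s: "sets (bind (measure_pmf P) K) = sets borel"
    by (rule sets_bind) (use K in \<open>auto simp: real_distribution_def real_distribution_axioms_def\<close>)
  ultimately show rd: "real_distribution (bind (measure_pmf P) K)"
    by (simp add: real_distribution_def real_distribution_axioms_def)
  have iexp_int: "integrable M (\<lambda>x. iexp (t * x))" if "real_distribution M" for M
  proof -
    interpret real_distribution M by fact
    show ?thesis by (intro integrable_iexp) auto
  qed
  have one: "emeasure (K n) (space (K n)) \<le> ennreal 1" for n
  proof -
    interpret real_distribution "K n" by (rule K)
    show ?thesis using emeasure_space_1 by (simp del: space_eq_univ)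
  qed
  \<comment> \<open>The exchange of integrals is carried out for the bounded real functions cosine
    and sine, and the two results are reassembled at the end.\<close>
  have re: "Re (char M t) = (LINT x|M. cos (t * x))" "Im (char M t) = (LINT x|M. sin (t * x))"
    if "real_distribution M" for M
    unfolding char_def integral_Re[OF iexp_int[OF that], symmetric] integral_Im[OF iexp_int[OF that], symmetric]
    by (simp_all only: cis_conv_exp[symmetric] cis.sel)
  have int: "integrable (measure_pmf P) (\<lambda>n. char (K n) t)"
    using real_distribution.cmod_char_le_1[OF K] by (intro measure_pmf.integrable_const_bound[of _ 1]) auto
  have "Re (char (bind (measure_pmf P) K) t) = (LINT n|measure_pmf P. Re (char (K n) t))"
    unfolding re[OF rd] re[OF K]
    by (rule integral_bind[where K = borel and B = 1 and B' = 1, OF _ _ Km]) (use one in \<open>auto intro: measure_pmf.finite_measure\<close>)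
  moreover have "Im (char (bind (measure_pmf P) K) t) = (LINT n|measure_pmf P. Im (char (K n) t))"
    unfolding re[OF rd] re[OF K]
    by (rule integral_bind[where K = borel and B = 1 and B' = 1, OF _ _ Km]) (use one in \<open>auto intro: measure_pmf.finite_measure\<close>)
  ultimately show "char (bind (measure_pmf P) K) t = (CLINT n|measure_pmf P. char (K n) t)"
    using int by (simp add: complex_eq_iff)
qed

lemma integral_poisson_pmf_power:
  fixes z :: complex
  assumes c: "c > 0" and z: "norm z \<le> 1"
  shows "(CLINT n|measure_pmf (poisson_pmf c). z ^ n) = exp (c * (z - 1))"
proof -
  have "(\<lambda>n. exp (- c) * ((c * z) ^ n /\<^sub>R fact n)) sums (exp (- c) * exp (c * z))"
    by (intro sums_mult exp_converges)
  also have "(\<lambda>n. exp (- c) * ((c * z) ^ n /\<^sub>R fact n)) = (\<lambda>n. pmf (poisson_pmf c) n *\<^sub>R z ^ n)"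
    using c by (simp add: fun_eq_iff power_mult_distrib scaleR_conv_of_real field_simps exp_of_real flip: of_real_minus)
  finally have sums: "(\<lambda>n. pmf (poisson_pmf c) n *\<^sub>R z ^ n) sums exp (c * (z - 1))"
    by (simp add: mult_exp_exp algebra_simps flip: exp_of_real)
  have "integrable (measure_pmf (poisson_pmf c)) (\<lambda>n. z ^ n)"
    using z by (intro measure_pmf.integrable_const_bound[of _ 1]) (auto simp: norm_power power_le_one)
  hence "integrable (count_space UNIV) (\<lambda>n. pmf (poisson_pmf c) n *\<^sub>R z ^ n)"
    unfolding measure_pmf_eq_density by (subst (asm) integrable_density) auto
  hence "(CLINT n|count_space UNIV. pmf (poisson_pmf c) n *\<^sub>R z ^ n) = (\<Sum>n. pmf (poisson_pmf c) n *\<^sub>R z ^ n)"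
    by (rule integral_count_space_nat)
  thus ?thesis using sums unfolding measure_pmf_eq_density
    by (subst integral_density) (auto simp: sums_iff)
qed

text \<open>The weights sit on abstract indices, and \<open>X\<close> may send several of them to
  the same real number; pushing a pmf forward along \<open>X\<close> merges such atoms.\<close>

lemma char_atomic_distribution:
  fixes w :: "'a \<Rightarrow> real" and X :: "'a \<Rightarrow> real"
  assumes w: "\<And>z. z \<in> Z \<Longrightarrow> w z \<ge> 0" "(w has_sum 1) Z"
  obtains \<mu> where "real_distribution \<mu>" "\<And>t. ((\<lambda>z. w z * iexp (t * X z)) has_sum char \<mu> t) Z"
proof -
  \<comment> \<open>Extension by zero turns the weights on \<open>Z\<close> into a mass function on
    the whole type.\<close>
  define v where "v z = (if z \<in> Z then w z else 0)" for z
  have v: "v z \<ge> 0" for z using w by (simp add: v_def)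
  have v_sum: "(v has_sum 1) UNIV"
  proof -
    have "(v has_sum 1) UNIV \<longleftrightarrow> (w has_sum 1) Z"
      by (rule has_sum_cong_neutral) (auto simp: v_def)
    thus ?thesis using w(2) by simp
  qed
  have v_abs: "Infinite_Set_Sum.abs_summable_on v UNIV"
  proof -
    have "(\<lambda>z. norm (v z)) = v" using v by auto
    thus ?thesis using v_sum by (subst abs_summable_equivalent[symmetric]) (simp add: has_sum_iff)
  qed
  have prob: "(\<integral>\<^sup>+x. ennreal (v x) \<partial>count_space UNIV) = 1"
    using nn_integral_conv_infsetsum[OF v_abs] v infsetsum_infsum[OF v_abs] v_sum by (simp add: has_sum_iff)
  define p where "p = embed_pmf v"
  have p: "pmf p z = v z" for z unfolding p_def by (rule pmf_embed_pmf[OF v prob])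
  define \<mu> where "\<mu> = distr (measure_pmf p) borel X"
  have "real_distribution \<mu>" unfolding \<mu>_def by (intro prob_space.real_distribution_distr[OF measure_pmf.prob_space_axioms]) simp
  moreover have "((\<lambda>z. w z * iexp (t * X z)) has_sum char \<mu> t) Z" for t
  proof -
    have "integrable (measure_pmf p) (\<lambda>z. iexp (t * X z))"
      by (intro prob_space.integrable_iexp[OF measure_pmf.prob_space_axioms]) auto
    hence "integrable (count_space UNIV) (\<lambda>z. v z *\<^sub>R iexp (t * X z))"
      unfolding measure_pmf_eq_density p by (subst (asm) integrable_density) (auto simp: v)
    hence abs: "Infinite_Set_Sum.abs_summable_on (\<lambda>z. v z *\<^sub>R iexp (t * X z)) UNIV"
      by (simp add: Infinite_Set_Sum.abs_summable_on_def)
    have "char \<mu> t = (CLINT z|measure_pmf p. iexp (t * X z))"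
      unfolding \<mu>_def char_def by (subst integral_distr) auto
    also have "\<dots> = (CLINT z|count_space UNIV. v z *\<^sub>R iexp (t * X z))"
      unfolding measure_pmf_eq_density p by (subst integral_density) (auto simp: v)
    also have "\<dots> = infsetsum (\<lambda>z. v z *\<^sub>R iexp (t * X z)) UNIV"
      by (simp add: infsetsum_def)
    also have "\<dots> = infsum (\<lambda>z. v z *\<^sub>R iexp (t * X z)) UNIV"
      by (rule infsetsum_infsum[OF abs])
    finally have "((\<lambda>z. v z *\<^sub>R iexp (t * X z)) has_sum char \<mu> t) UNIV"
      using abs unfolding abs_summable_equivalent[symmetric]
      by (simp add: has_sum_iff abs_summable_summable)
    moreover have "((\<lambda>z. v z *\<^sub>R iexp (t * X z)) has_sum char \<mu> t) UNIV \<longleftrightarrow>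
        ((\<lambda>z. w z * iexp (t * X z)) has_sum char \<mu> t) Z"
      by (rule has_sum_cong_neutral) (auto simp: v_def scaleR_conv_of_real)
    ultimately show ?thesis by simp
  qed
  ultimately show ?thesis by (rule that)
qed

text \<open>With total intensity \<open>c\<close>, take a Poisson number of independent jumps whose
  law has the weights w / c. The Poisson generating function at \<open>char \<mu> t\<close> gives
  exp (c * (char \<mu> t - 1)).\<close>

lemma compound_poisson_distribution:
  fixes w :: "'a \<Rightarrow> real" and X :: "'a \<Rightarrow> real"
  assumes w: "\<And>z. z \<in> Z \<Longrightarrow> w z \<ge> 0" "w summable_on Z"
  obtains \<nu> where "real_distribution \<nu>"
    "\<And>t. char \<nu> t = exp (\<Sum>\<^sub>\<infinity>z\<in>Z. w z * (iexp (t * X z) - 1))"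
proof (cases "infsum w Z = 0")
  case True
  \<comment> \<open>Total mass zero cannot be normalized to a jump law; the distribution is then the
    point mass at 0.\<close>
  have "w z = 0" if "z \<in> Z" for z
    using nonneg_infsum_le_0D[of w Z] w True that by auto
  hence "(\<Sum>\<^sub>\<infinity>z\<in>Z. w z * (iexp (t * X z) - 1)) = 0" for t by (intro infsum_0) auto
  thus ?thesis using real_distribution_return[of 0] by (intro that) (auto simp: char_return)
next
  case False
  define c where "c = infsum w Z"
  have c: "c > 0" using infsum_nonneg[of Z w] w False by (simp add: c_def)
  have "((\<lambda>z. w z / c) has_sum (c / c)) Z"
    using w(2) unfolding c_def by (intro has_sum_divide_const) simp
  hence "((\<lambda>z. w z / c) has_sum 1) Z" using c by simp
  then obtain \<mu> where \<mu>: "real_distribution \<mu>"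
    "\<And>t. ((\<lambda>z. complex_of_real (w z / c) * iexp (t * X z)) has_sum char \<mu> t) Z"
    using char_atomic_distribution[of Z "\<lambda>z. w z / c" X] w(1) c by (metis divide_nonneg_pos)
  define \<nu> where "\<nu> = bind (measure_pmf (poisson_pmf c)) (convolution_power \<mu>)"
  have "real_distribution \<nu>"
    unfolding \<nu>_def by (intro char_bind_pmf real_distribution_convolution_power \<mu>)
  moreover have "char \<nu> t = exp (\<Sum>\<^sub>\<infinity>z\<in>Z. w z * (iexp (t * X z) - 1))" for t
  proof -
    have "char \<nu> t = (CLINT n|measure_pmf (poisson_pmf c). char \<mu> t ^ n)"
      unfolding \<nu>_def char_bind_pmf(2)[OF real_distribution_convolution_power[OF \<mu>(1)]]
      by (simp add: char_convolution_power[OF \<mu>(1)])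
    also have "\<dots> = exp (c * (char \<mu> t - 1))"
      by (intro integral_poisson_pmf_power c real_distribution.cmod_char_le_1 \<mu>)
    finally have *: "char \<nu> t = exp (c * (char \<mu> t - 1))" .
    have "((\<lambda>z. complex_of_real (w z)) has_sum complex_of_real c) Z"
      using w(2) unfolding c_def by (intro has_sum_of_real) simp
    from has_sum_add[OF has_sum_cmult_right[OF \<mu>(2)[of t], of c] has_sum_uminusI[OF this]]
    have "(\<Sum>\<^sub>\<infinity>z\<in>Z. w z * (iexp (t * X z) - 1)) = c * (char \<mu> t - 1)"
      using c by (intro infsumI) (simp add: algebra_simps)
    with * show ?thesis by simp
  qed
  ultimately show ?thesis by (rule that)
qed

lemma levy_khintchine_distribution:
  fixes w :: "'a \<Rightarrow> real" and X :: "'a \<Rightarrow> real" and v b :: real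
  assumes w: "\<And>z. z \<in> Z \<Longrightarrow> w z \<ge> 0" "w summable_on Z" and v: "v \<ge> 0"
  obtains \<nu> where "real_distribution \<nu>"
    "\<And>t. char \<nu> t = exp (- (v / 2) * t\<^sup>2 + \<i> * b * t + (\<Sum>\<^sub>\<infinity>z\<in>Z. w z * (iexp (t * X z) - 1)))"
proof -
  obtain \<nu>1 where 1: "real_distribution \<nu>1" "\<And>t. char \<nu>1 t = exp (- ((sqrt v)\<^sup>2 / 2) * t\<^sup>2 + \<i> * b * t)"
    using gaussian_distribution[of "sqrt v" b] by metis
  obtain \<nu>2 where 2: "real_distribution \<nu>2"
    "\<And>t. char \<nu>2 t = exp (\<Sum>\<^sub>\<infinity>z\<in>Z. w z * (iexp (t * X z) - 1))"
    using compound_poisson_distribution[OF w] by metis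
  show ?thesis
    by (rule that[OF real_distribution_convolution[OF 1(1) 2(1)]])
       (use v in \<open>simp add: char_convolution[OF 1(1) 2(1)] 1(2) 2(2) exp_add flip: of_real_power\<close>)
qed

text \<open>The candidate root is built from parameters divided by \<open>n\<close>, so its
  convolution power matches \<open>\<nu>\<close> only in its characteristic function. Levy's
  uniqueness theorem turns this into equality of measures.\<close>

lemma levy_khintchine_infinitely_divisible:
  fixes w :: "'a \<Rightarrow> real" and X :: "'a \<Rightarrow> real" and v b :: real
  assumes w: "\<And>z. z \<in> Z \<Longrightarrow> w z \<ge> 0" "w summable_on Z" and v: "v \<ge> 0"
  obtains \<nu> where "infinitely_divisible \<nu>"
    "\<And>t. char \<nu> t = exp (- (v / 2) * t\<^sup>2 + \<i> * b * t + (\<Sum>\<^sub>\<infinity>z\<in>Z. w z * (iexp (t * X z) - 1)))"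
proof -
  obtain \<nu> where \<nu>: "real_distribution \<nu>"
    "\<And>t. char \<nu> t = exp (- (v / 2) * t\<^sup>2 + \<i> * b * t + (\<Sum>\<^sub>\<infinity>z\<in>Z. w z * (iexp (t * X z) - 1)))"
    by (rule levy_khintchine_distribution[OF w v, where b = b and X = X]) (assumption | rule that)+
  have "\<exists>\<nu>'. real_distribution \<nu>' \<and> \<nu> = convolution_power \<nu>' n" if n: "n \<ge> 1" for n
  proof -
    have w': "w z / n \<ge> 0" if "z \<in> Z" for z using w that by simp
    have w'': "(\<lambda>z. w z / n) summable_on Z"
      using summable_on_cmult_left[OF w(2), of "1 / n"] by simp
    have v': "v / n \<ge> 0" using v by simp
    obtain \<nu>' where \<nu>': "real_distribution \<nu>'"
      "\<And>t. char \<nu>' t = exp (complex_of_real (- ((v / n) / 2) * t\<^sup>2) + \<i> * complex_of_real (b / n) * t + (\<Sum>\<^sub>\<infinity>z\<in>Z. complex_of_real (w z / n) * (iexp (t * X z) - 1)))"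
      by (rule levy_khintchine_distribution[OF w' w'' v', where b = "b / n" and X = X]) (assumption | rule that)+
    have eq: "(\<Sum>\<^sub>\<infinity>z\<in>Z. complex_of_real (w z / n) * (iexp (t * X z) - 1))
        = (\<Sum>\<^sub>\<infinity>z\<in>Z. w z * (iexp (t * X z) - 1)) / n" for t
      using infsum_cmult_right'[of "1 / of_nat n" "\<lambda>z. w z * (iexp (t * X z) - 1)" Z] by (simp add: field_simps)
    have "char \<nu> = char (convolution_power \<nu>' n)"
    proof
      fix t
      have "char (convolution_power \<nu>' n) t = exp (of_nat n * (complex_of_real (- ((v / n) / 2) * t\<^sup>2) + \<i> * complex_of_real (b / n) * t
          + (\<Sum>\<^sub>\<infinity>z\<in>Z. w z * (iexp (t * X z) - 1)) / n))"
        unfolding char_convolution_power[OF \<nu>'(1)] \<nu>'(2) eq exp_of_nat_mult by simp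
      also have "of_nat n * (complex_of_real (- ((v / n) / 2) * t\<^sup>2) + \<i> * complex_of_real (b / n) * t + (\<Sum>\<^sub>\<infinity>z\<in>Z. w z * (iexp (t * X z) - 1)) / n)
          = - (v / 2) * t\<^sup>2 + \<i> * b * t + (\<Sum>\<^sub>\<infinity>z\<in>Z. w z * (iexp (t * X z) - 1))"
        using n by (simp add: field_simps)
      finally show "char \<nu> t = char (convolution_power \<nu>' n) t" by (simp add: \<nu>(2))
    qed
    hence "\<nu> = convolution_power \<nu>' n"
      by (intro Levy_uniqueness \<nu> real_distribution_convolution_power \<nu>')
    thus ?thesis using \<nu>'(1) by blast
  qed
  thus ?thesis using \<nu> by (intro that) (auto simp: infinitely_divisible_def)
qed

section \<open>Consequences of infinite divisibility\<close>

text \<open>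
  Translating the distribution makes \<open>char M t\<close> real and nonnegative; then
  \<open>1 - cos (2 y) \<le> 4 (1 - cos y)\<close> is integrated.
\<close>

lemma (in real_distribution) one_minus_norm_char_double:
  "1 - norm (char M (2 * t)) \<le> 4 * (1 - norm (char M t))"
proof -
  obtain \<alpha> where \<alpha>: "char M t = norm (char M t) * cis \<alpha>"
    by (metis rcis_cmod_Arg rcis_def)
  have int: "integrable M (\<lambda>x. iexp (s * x))" for s
    by (intro integrable_iexp) auto
  have re: "Re (char M s * cis (- \<beta>)) = (LINT x|M. cos (s * x - \<beta>))" for s \<beta>
  proof -
    have "char M s * cis (- \<beta>) = (CLINT x|M. iexp (s * x) * cis (- \<beta>))"
      unfolding char_def by simp
    also have "\<dots> = (CLINT x|M. cis (s * x - \<beta>))"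
      by (simp only: cis_conv_exp[symmetric] cis_mult diff_conv_add_uminus)
    finally have "Re (char M s * cis (- \<beta>)) = Re (CLINT x|M. cis (s * x - \<beta>))" by simp
    also have "integrable M (\<lambda>x. cis (s * x - \<beta>))"
      by (intro integrable_const_bound[of _ 1]) (auto simp: cis_conv_exp)
    hence "Re (CLINT x|M. cis (s * x - \<beta>)) = (LINT x|M. Re (cis (s * x - \<beta>)))"
      by (rule integral_Re[symmetric])
    finally show ?thesis by simp
  qed
  have intc: "integrable M (\<lambda>x. cos (s * x - \<beta>))" for s \<beta>
    by (intro integrable_const_bound[of _ 1]) auto
  \<comment> \<open>At \<open>2 * t\<close> the same translation is kept, so the phase is 2 \<alpha>
    and need not be the argument of \<open>char M (2 * t)\<close>; only an inequality remains, in
    the useful direction.\<close>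
  have "Re (char M (2 * t) * cis (- (2 * \<alpha>))) \<le> norm (char M (2 * t))"
    using complex_Re_le_cmod[of "char M (2 * t) * cis (- (2 * \<alpha>))"] by (simp add: norm_mult)
  hence "1 - norm (char M (2 * t)) \<le> 1 - (LINT x|M. cos (2 * t * x - 2 * \<alpha>))"
    unfolding re by simp
  also have "\<dots> = (LINT x|M. 1 - cos (2 * t * x - 2 * \<alpha>))"
    using intc by (simp add: prob_space del: space_eq_univ)
  also have "\<dots> \<le> (LINT x|M. 4 * (1 - cos (t * x - \<alpha>)))"
  proof (rule integral_mono)
    fix x
    define y where "y = t * x - \<alpha>"
    have "1 - cos (2 * y) = 2 * (1 - cos y) * (1 + cos y)"
      by (simp only: cos_double_cos power2_eq_square) (simp add: algebra_simps)
    also have "\<dots> \<le> 2 * (1 - cos y) * 2"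
      by (intro mult_left_mono) auto
    finally show "1 - cos (2 * t * x - 2 * \<alpha>) \<le> 4 * (1 - cos (t * x - \<alpha>))"
      by (simp add: y_def algebra_simps)
  qed (use intc in auto)
  also have "\<dots> = 4 * (1 - Re (char M t * cis (- \<alpha>)))"
    unfolding re using intc by (simp add: prob_space del: space_eq_univ)
  also have "char M t * cis (- \<alpha>) = norm (char M t)"
    by (subst \<alpha>) (simp add: cis_mult mult.assoc)
  finally show ?thesis by simp
qed

lemma one_minus_exp_div_tendsto:
  "(\<lambda>n. real n * (1 - exp (x / real n))) \<longlonglongrightarrow> - x"
  by real_asymp

text \<open>An n-th root has a characteristic function of norm exactly exp (Re g / n), with no
  branch to choose since norms are nonnegative. Multiplying its doubling inequality by
  \<open>n\<close> and letting \<open>n\<close> grow linearizes the exponentials.\<close>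

lemma infinitely_divisible_exponent:
  assumes \<nu>: "infinitely_divisible \<nu>" and char: "\<And>t. char \<nu> t = exp (g t)"
  shows "Re (g t) \<le> 0" and "- Re (g (2 * t)) \<le> 4 * - Re (g t)"
proof -
  have "exp (Re (g t)) = norm (char \<nu> t)" by (simp add: char)
  also have "\<dots> \<le> 1" using \<nu> by (intro real_distribution.cmod_char_le_1) (simp add: infinitely_divisible_def)
  finally show "Re (g t) \<le> 0" by simp
  have "real n * (1 - exp (Re (g (2 * t)) / n)) \<le> 4 * (real n * (1 - exp (Re (g t) / n)))" if n: "n \<ge> 1" for n
  proof -
    obtain \<nu>' where \<nu>': "real_distribution \<nu>'" "\<nu> = convolution_power \<nu>' n"
      using \<nu> n by (auto simp: infinitely_divisible_def)
    have "norm (char \<nu>' s) = exp (Re (g s) / n)" for s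
    proof -
      have "norm (char \<nu>' s) ^ n = exp (Re (g s))"
        using char[of s] unfolding \<nu>'(2) char_convolution_power[OF \<nu>'(1)] by (metis norm_power norm_exp_eq_Re)
      also have "\<dots> = exp (Re (g s) / n) ^ n" using n by (simp flip: exp_of_nat_mult)
      finally show ?thesis using n power_eq_imp_eq_base[of "norm (char \<nu>' s)" n "exp (Re (g s) / n)"] by simp
    qed
    with real_distribution.one_minus_norm_char_double[OF \<nu>'(1), of t]
    have "1 - exp (Re (g (2 * t)) / n) \<le> 4 * (1 - exp (Re (g t) / n))" by simp
    from mult_left_mono[OF this, of "real n"] show ?thesis by (simp add: mult.left_commute)
  qed
  hence ev: "eventually (\<lambda>n. real n * (1 - exp (Re (g (2 * t)) / n)) \<le> 4 * (real n * (1 - exp (Re (g t) / n)))) sequentially"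
    using eventually_ge_at_top[of 1] by (rule eventually_mono[rotated])
  show "- Re (g (2 * t)) \<le> 4 * - Re (g t)"
    by (rule tendsto_le[OF sequentially_bot _ _ ev])
       (intro tendsto_mult_left one_minus_exp_div_tendsto)+
qed

section \<open>Laplace transform of the exponent\<close>

text \<open>The integral is cut into unit intervals. Each piece is entire in \<open>z\<close>, and
  the pieces are dominated by a geometric series uniformly on every half-plane Im z >= \<delta> >
  0.\<close>

lemma Laplace_transform_holomorphic:
  fixes H :: "real \<Rightarrow> complex"
  assumes cont: "continuous_on {0..} H" and bound: "\<And>t. t \<ge> 0 \<Longrightarrow> norm (H t) \<le> C * (1 + t\<^sup>2)"
  obtains F where "F holomorphic_on {z. Im z > 0}"
    "\<And>z. Im z > 0 \<Longrightarrow> (\<lambda>n. integral {0..real n} (\<lambda>t. H t * exp (\<i> * z * t))) \<longlonglongrightarrow> F z"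
proof -
  have C: "C \<ge> 0" using order.trans[OF norm_ge_zero bound[of 0]] by simp
  define a where "a = (\<lambda>k z. integral {real k..real (Suc k)} (\<lambda>t. H t * exp (\<i> * z * t)))"
  define F where "F = (\<lambda>z. \<Sum>k. a k z)"
  have cont': "continuous_on {x..y} (\<lambda>t. H t * exp (\<i> * z * t))" if "x \<ge> 0" for x y z
    by (intro continuous_intros continuous_on_subset[OF cont]) (use that in auto)
  have hol_a: "a k holomorphic_on UNIV" for k
  proof -
    have "(\<lambda>z. integral (cbox (real k) (real (Suc k))) (\<lambda>t. H t * exp (\<i> * z * t))) holomorphic_on UNIV"
    proof (rule leibniz_rule_holomorphic)
      show "((\<lambda>z. H t * exp (\<i> * z * t)) has_field_derivative H t * exp (\<i> * z * t) * (\<i> * t)) (at z within UNIV)" for z t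
        by (auto intro!: derivative_eq_intros)
      show "(\<lambda>t. H t * exp (\<i> * z * t)) integrable_on cbox (real k) (real (Suc k))" for z
        using cont'[of "real k"] by (intro integrable_continuous) auto
      have "continuous_on (UNIV \<times> cbox (real k) (real (Suc k))) (\<lambda>p. H (snd p))"
        by (rule continuous_on_compose2[OF cont continuous_on_snd]) auto
      thus "continuous_on (UNIV \<times> cbox (real k) (real (Suc k))) (\<lambda>(z, t). H t * exp (\<i> * z * t) * (\<i> * t))"
        unfolding case_prod_beta by (intro continuous_intros) auto
    qed auto
    thus ?thesis by (simp add: a_def)
  qed
  have a_bound: "norm (a k z) \<le> C * (1 + 8 / \<delta>\<^sup>2) * exp (- (\<delta> / 2)) ^ k" if \<delta>: "\<delta> > 0" "Im z \<ge> \<delta>" for k z \<delta>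
  proof -
    have "norm (integral {real k..real (Suc k)} (\<lambda>t. H t * exp (\<i> * z * t)))
        \<le> C * (1 + 8 / \<delta>\<^sup>2) * exp (- (\<delta> / 2)) ^ k * (real (Suc k) - real k)"
    proof (rule integral_bound[OF _ cont'])
      fix t assume t: "t \<in> {real k..real (Suc k)}"
      hence t0: "t \<ge> 0" by simp
      \<comment> \<open>Half of the decay exp (- \<delta> t) = exp (- 2 x) pays for the polynomial
        factor: x^2 / 2 <= exp x means t^2 <= 8 / \<delta>^2 * exp x.\<close>
      define x where "x = \<delta> * t / 2"
      have x: "x \<ge> 0" using t0 \<delta> by (simp add: x_def)
      have "x ^ 2 / 2 \<le> exp x" using exp_lower_Taylor_quadratic[OF x] x by simp
      moreover have "t\<^sup>2 = 8 / \<delta>\<^sup>2 * (x ^ 2 / 2)"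
        using \<delta> by (simp add: x_def power2_eq_square field_simps)
      ultimately have "t\<^sup>2 \<le> 8 / \<delta>\<^sup>2 * exp x" by (metis mult_left_mono zero_le_divide_iff zero_le_numeral zero_le_power2)
      hence "1 + t\<^sup>2 \<le> (1 + 8 / \<delta>\<^sup>2) * exp x"
        using x by (simp add: algebra_simps add_mono)
      hence 1: "norm (H t) \<le> C * ((1 + 8 / \<delta>\<^sup>2) * exp x)"
        using bound[OF t0] C by (meson mult_left_mono order.trans)
      have "norm (exp (\<i> * z * t)) = exp (- (Im z * t))" by simp
      also have "\<dots> \<le> exp (- (2 * x))" using \<delta> t0 by (simp add: x_def mult_right_mono)
      finally have "norm (H t * exp (\<i> * z * t)) \<le> C * ((1 + 8 / \<delta>\<^sup>2) * exp x) * exp (- (2 * x))"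
        unfolding norm_mult using 1 by (intro mult_mono) (use C in auto)
      also have "\<dots> = C * (1 + 8 / \<delta>\<^sup>2) * exp (- x)"
        by (simp add: mult_exp_exp mult.assoc)
      also have "exp (- x) \<le> exp (- (\<delta> / 2)) ^ k"
        using t \<delta> by (simp add: x_def mult_left_mono mult.commute flip: exp_of_nat_mult)
      finally show "norm (H t * exp (\<i> * z * t)) \<le> C * (1 + 8 / \<delta>\<^sup>2) * exp (- (\<delta> / 2)) ^ k"
        using C by (simp add: mult_left_mono)
    qed auto
    thus ?thesis by (simp add: a_def)
  qed
  have geom: "summable (\<lambda>k. C * (1 + 8 / \<delta>\<^sup>2) * exp (- (\<delta> / 2)) ^ k)" if "\<delta> > 0" for \<delta> :: real
    using that by (intro summable_mult summable_geometric) auto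
  have unif: "uniform_limit {z. Im z \<ge> \<delta>} (\<lambda>n z. \<Sum>k<n. a k z) F sequentially" if "\<delta> > 0" for \<delta>
    unfolding F_def by (rule Weierstrass_m_test[OF a_bound[OF that] geom[OF that]]) auto
  have "F holomorphic_on {z. Im z > 0}"
  proof (rule holomorphic_uniform_sequence)
    show "open {z. Im z > 0}" by (rule open_halfspace_Im_gt)
    show "(\<lambda>z. \<Sum>k<n. a k z) holomorphic_on {z. 0 < Im z}" for n
      by (intro holomorphic_intros holomorphic_on_subset[OF hol_a]) auto
    fix z assume z: "z \<in> {z. Im z > 0}"
    have sub: "cball z (Im z / 2) \<subseteq> {w. Im w \<ge> Im z / 2}"
    proof
      fix w assume "w \<in> cball z (Im z / 2)"
      thus "w \<in> {w. Im w \<ge> Im z / 2}"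
        using abs_Im_le_cmod[of "z - w"] by (simp add: dist_norm)
    qed
    show "\<exists>d. 0 < d \<and> cball z d \<subseteq> {z. 0 < Im z} \<and> uniform_limit (cball z d) (\<lambda>n z. \<Sum>k<n. a k z) F sequentially"
      using z sub uniform_limit_on_subset[OF unif sub] by (intro exI[of _ "Im z / 2"]) force
  qed
  moreover have "(\<lambda>n. integral {0..real n} (\<lambda>t. H t * exp (\<i> * z * t))) \<longlonglongrightarrow> F z" if "Im z > 0" for z
  proof -
    have "integral {0..real n} (\<lambda>t. H t * exp (\<i> * z * t)) = (\<Sum>k<n. a k z)" for n
    proof (induction n)
      case (Suc n)
      have "integral {0..real n} (\<lambda>t. H t * exp (\<i> * z * t)) + a n z = integral {0..real (Suc n)} (\<lambda>t. H t * exp (\<i> * z * t))"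
        unfolding a_def by (intro Henstock_Kurzweil_Integration.integral_combine integrable_continuous_real cont') auto
      thus ?case using Suc by simp
    qed auto
    thus ?thesis using tendsto_uniform_limitI[OF unif[OF that], of z] by simp
  qed
  ultimately show ?thesis by (rule that)
qed

lemma integral_exp_tendsto:
  assumes w: "Im w > 0"
  shows "(\<lambda>n. integral {0..real n} (\<lambda>t. exp (\<i> * w * t))) \<longlonglongrightarrow> \<i> / w"
proof -
  have w0: "w \<noteq> 0" using w by auto
  have eq: "integral {0..real n} (\<lambda>t. exp (\<i> * w * t)) = exp (\<i> * w * real n) / (\<i> * w) - 1 / (\<i> * w)" for n
  proof (rule integral_unique)
    have "((\<lambda>t. exp (\<i> * w * of_real t)) has_integral
       (exp (\<i> * w * of_real (real n)) / (\<i> * w) - exp (\<i> * w * of_real 0) / (\<i> * w))) {0..real n}"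
      by (rule fundamental_theorem_of_calculus)
         (use w0 in \<open>auto intro!: has_vector_derivative_real_field derivative_eq_intros\<close>)
    thus "((\<lambda>t. exp (\<i> * w * of_real t)) has_integral (exp (\<i> * w * real n) / (\<i> * w) - 1 / (\<i> * w))) {0..real n}"
      by simp
  qed
  have "(\<lambda>n. exp (- Im w) ^ n) \<longlonglongrightarrow> 0"
    using w by (intro LIMSEQ_realpow_zero) auto
  hence "(\<lambda>n. exp (\<i> * w * real n)) \<longlonglongrightarrow> 0"
    by (rule tendsto_norm_zero_cancel[OF tendsto_eq_rhs[OF Lim_transform_eventually]])
       (auto simp: mult.commute simp flip: exp_of_nat_mult)
  hence "(\<lambda>n. exp (\<i> * w * real n) / (\<i> * w) - 1 / (\<i> * w)) \<longlonglongrightarrow> 0 / (\<i> * w) - 1 / (\<i> * w)"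
    by (intro tendsto_intros) (use w0 in auto)
  moreover have "0 / (\<i> * w) - 1 / (\<i> * w) = \<i> / w"
    using w0 by (simp add: field_simps)
  ultimately show ?thesis by (simp add: eq)
qed

lemma one_minus_cos_eq_exp: "1 - cos (w::complex) = 1 - (exp (\<i> * w) + exp (- (\<i> * w))) / 2"
  by (simp add: cos_exp_eq)

lemma norm_one_minus_cos_le:
  assumes "\<bar>Im \<gamma>\<bar> \<le> Y" "t \<ge> 0"
  shows "norm (1 - cos (\<gamma> * complex_of_real t)) \<le> 2 * exp (Y * t)"
proof -
  have le: "norm (exp (\<i> * w)) \<le> exp (Y * t)" if "\<bar>Im w\<bar> \<le> Y * t" for w
    using that by simp
  have Im: "\<bar>Im (\<gamma> * t)\<bar> \<le> Y * t" using assms by (simp add: abs_mult mult_right_mono)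
  have "norm (exp (\<i> * (\<gamma> * t)) + exp (\<i> * - (\<gamma> * t))) \<le> 2 * exp (Y * t)"
    using norm_triangle_ineq[of "exp (\<i> * (\<gamma> * t))" "exp (\<i> * - (\<gamma> * t))"] le[OF Im] le[of "- (\<gamma> * t)"] Im
    unfolding uminus_complex.sel abs_minus_cancel by linarith
  moreover have "Y * t \<ge> 0" using Im by linarith
  hence "exp (Y * t) \<ge> 1" by simp
  moreover have "norm (1 - cos (\<gamma> * complex_of_real t)) \<le> 1 + norm (exp (\<i> * (\<gamma> * t)) + exp (\<i> * - (\<gamma> * t))) / 2"
    unfolding one_minus_cos_eq_exp
    using norm_triangle_ineq4[of 1 "(exp (\<i> * (\<gamma> * t)) + exp (- (\<i> * (\<gamma> * t)))) / 2"]
    by (simp add: norm_divide)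
  ultimately show ?thesis by linarith
qed

text \<open>Writing the cosine by exponentials leaves three elementary transforms, at z and at z +
  \<gamma>, z - \<gamma>; the condition on \<open>Im z\<close> places all three in the upper
  half-plane. In their combination a factor \<gamma>^2 appears and cancels the denominator.\<close>

lemma integral_one_minus_cos_tendsto:
  assumes "\<bar>Im \<gamma>\<bar> \<le> Y" "Im z > Y" "\<gamma> \<noteq> 0"
  shows "(\<lambda>n. integral {0..real n} (\<lambda>t. (1 - cos (\<gamma> * t)) / \<gamma>\<^sup>2 * exp (\<i> * z * t)))
           \<longlonglongrightarrow> - \<i> / z * (1 / (z\<^sup>2 - \<gamma>\<^sup>2))"
proof -
  have im: "Im z > 0" "Im (z + \<gamma>) > 0" "Im (z - \<gamma>) > 0" using assms by auto
  have nz: "z \<noteq> 0" "z + \<gamma> \<noteq> 0" "z - \<gamma> \<noteq> 0" by (metis im less_irrefl zero_complex.sel(2))+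
  have int: "(\<lambda>t. exp (\<i> * w * complex_of_real t)) integrable_on {0..real n}" for w n
    by (intro integrable_continuous_real continuous_intros)
  have eq: "(1 - cos (\<gamma> * t)) / \<gamma>\<^sup>2 * exp (\<i> * z * t) =
     (exp (\<i> * z * t) - (exp (\<i> * (z + \<gamma>) * t) + exp (\<i> * (z - \<gamma>) * t)) / 2) / \<gamma>\<^sup>2" for t :: complex
    unfolding one_minus_cos_eq_exp by (simp add: algebra_simps add_divide_distrib diff_divide_distrib mult_exp_exp)
  have "(\<lambda>n. (integral {0..real n} (\<lambda>t. exp (\<i> * z * t)) - (integral {0..real n} (\<lambda>t. exp (\<i> * (z + \<gamma>) * t))
        + integral {0..real n} (\<lambda>t. exp (\<i> * (z - \<gamma>) * t))) / 2) / \<gamma>\<^sup>2)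
      \<longlonglongrightarrow> (\<i> / z - (\<i> / (z + \<gamma>) + \<i> / (z - \<gamma>)) / 2) / \<gamma>\<^sup>2"
    by (intro tendsto_intros integral_exp_tendsto im) (use assms in auto)
  also have "(\<lambda>n. (integral {0..real n} (\<lambda>t. exp (\<i> * z * t)) - (integral {0..real n} (\<lambda>t. exp (\<i> * (z + \<gamma>) * t))
        + integral {0..real n} (\<lambda>t. exp (\<i> * (z - \<gamma>) * t))) / 2) / \<gamma>\<^sup>2)
      = (\<lambda>n. integral {0..real n} (\<lambda>t. (1 - cos (\<gamma> * t)) / \<gamma>\<^sup>2 * exp (\<i> * z * t)))"
    unfolding eq by (simp add: integral_diff integral_add int integrable_diff integrable_add integrable_on_divide)
  also have "(\<i> / z - (\<i> / (z + \<gamma>) + \<i> / (z - \<gamma>)) / 2) / \<gamma>\<^sup>2 = - \<i> / z * (1 / (z\<^sup>2 - \<gamma>\<^sup>2))"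
  proof -
    have sq: "z\<^sup>2 - \<gamma>\<^sup>2 = (z + \<gamma>) * (z - \<gamma>)" by (simp add: power2_eq_square algebra_simps)
    show ?thesis unfolding sq using nz assms(3) by (simp add: divide_simps) (simp add: power2_eq_square algebra_simps)
  qed
  finally show ?thesis .
qed

section \<open>Cosine sums and pole sums over points of a strip\<close>

text \<open>This is all the pole argument uses about the zeros. Conjugation symmetry is absent:
  positivity of the weights is what prevents cancellation.\<close>

locale weighted_points =
  fixes Z :: "complex set" and m :: "complex \<Rightarrow> real" and Y :: real
  assumes finite_ball: "finite (Z \<inter> cball 0 R)" and nonzero: "\<gamma> \<in> Z \<Longrightarrow> \<gamma> \<noteq> 0"
    and m_pos: "\<gamma> \<in> Z \<Longrightarrow> m \<gamma> > 0" and summable: "(\<lambda>\<gamma>. m \<gamma> / norm \<gamma> ^ 2) summable_on Z"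
    and strip: "\<gamma> \<in> Z \<Longrightarrow> \<bar>Im \<gamma>\<bar> \<le> Y"
begin

text \<open>For the zeros this is h t - m0 t^2 / 2 in the notation of the overview. It is complex
  valued because the locale has no symmetry from which it could be seen to be real.\<close>

definition cos_sum :: "real \<Rightarrow> complex" where
  "cos_sum t = (\<Sum>\<^sub>\<infinity>\<gamma>\<in>Z. m \<gamma> * ((1 - cos (\<gamma> * t)) / \<gamma>\<^sup>2))"

lemma norm_cos_term_le:
  assumes "\<gamma> \<in> Z" "t \<ge> 0"
  shows "norm (m \<gamma> * ((1 - cos (\<gamma> * complex_of_real t)) / \<gamma>\<^sup>2)) \<le> m \<gamma> / norm \<gamma> ^ 2 * (2 * exp (Y * t))"
  using mult_left_mono[OF norm_one_minus_cos_le[OF strip[OF assms(1)] assms(2)], of "m \<gamma> / norm \<gamma> ^ 2"] m_pos[OF assms(1)]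
  by (simp add: norm_mult norm_divide norm_power)

lemma cos_sum_uniform_limit:
  "uniform_limit {0..T} (\<lambda>S t. \<Sum>\<gamma>\<in>S. m \<gamma> * ((1 - cos (\<gamma> * complex_of_real t)) / \<gamma>\<^sup>2)) cos_sum (finite_subsets_at_top Z)"
  unfolding cos_sum_def
proof (rule Weierstrass_m_test_general)
  show "(\<lambda>\<gamma>. m \<gamma> / norm \<gamma> ^ 2 * (2 * exp (\<bar>Y\<bar> * T))) summable_on Z"
    by (intro summable_on_cmult_left summable)
  fix \<gamma> t assume *: "\<gamma> \<in> Z" "t \<in> {0..T}"
  have "Y * t \<le> \<bar>Y\<bar> * T" using * by (intro mult_mono) auto
  hence "m \<gamma> / norm \<gamma> ^ 2 * (2 * exp (Y * t)) \<le> m \<gamma> / norm \<gamma> ^ 2 * (2 * exp (\<bar>Y\<bar> * T))"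
    using m_pos[OF *(1)] by (intro mult_left_mono) auto
  thus "norm (m \<gamma> * ((1 - cos (\<gamma> * complex_of_real t)) / \<gamma>\<^sup>2)) \<le> m \<gamma> / norm \<gamma> ^ 2 * (2 * exp (\<bar>Y\<bar> * T))"
    using norm_cos_term_le[of \<gamma> t] * by simp
qed

lemma cos_sum_has_sum:
  assumes "t \<ge> 0"
  shows "((\<lambda>\<gamma>. m \<gamma> * ((1 - cos (\<gamma> * complex_of_real t)) / \<gamma>\<^sup>2)) has_sum cos_sum t) Z"
  unfolding has_sum_def using tendsto_uniform_limitI[OF cos_sum_uniform_limit[of t], of t] assms by simp

lemma continuous_cos_sum: "continuous_on {0..} cos_sum"
proof -
  have "continuous_on {0..T} cos_sum" for T
    by (rule uniform_limit_theorem[OF _ cos_sum_uniform_limit])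
       (auto intro!: always_eventually continuous_intros simp: divide_inverse)
  moreover have "at t within {0..} = at t within {0..t + 1}" for t :: real
    by (rule at_within_nhd[of t "{..<t + 1}"]) auto
  ultimately show ?thesis
    unfolding continuous_on_eq_continuous_within
    by (metis atLeastAtMost_iff atLeast_iff less_add_one less_imp_le)
qed

text \<open>The bound separates a tail weight from an explicit exponential in \<open>t\<close>, as
  needed to exchange sum and Laplace integral. With \<open>S\<close> empty it is the growth bound
  for \<open>cos_sum\<close> itself.\<close>

lemma norm_infsum_tail_le:
  assumes S: "finite S" "S \<subseteq> Z" and t: "t \<ge> 0"
  shows "norm (cos_sum t - (\<Sum>\<gamma>\<in>S. m \<gamma> * ((1 - cos (\<gamma> * complex_of_real t)) / \<gamma>\<^sup>2)))
    \<le> (\<Sum>\<^sub>\<infinity>\<gamma>\<in>Z - S. m \<gamma> / norm \<gamma> ^ 2) * (2 * exp (Y * t))"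
proof -
  let ?f = "\<lambda>\<gamma>. m \<gamma> * ((1 - cos (\<gamma> * complex_of_real t)) / \<gamma>\<^sup>2)"
  have sm: "(\<lambda>\<gamma>. m \<gamma> / norm \<gamma> ^ 2 * (2 * exp (Y * t))) summable_on (Z - S)"
    by (intro summable_on_cmult_left summable_on_subset_banach[OF summable]) auto
  have "(?f has_sum (cos_sum t - sum ?f S)) (Z - S)"
    by (intro has_sum_Diff[OF cos_sum_has_sum[OF t]] has_sum_finite S)
  moreover have "((\<lambda>\<gamma>. m \<gamma> / norm \<gamma> ^ 2 * (2 * exp (Y * t))) has_sum
      (\<Sum>\<^sub>\<infinity>\<gamma>\<in>Z - S. m \<gamma> / norm \<gamma> ^ 2) * (2 * exp (Y * t))) (Z - S)"
    by (intro has_sum_cmult_left has_sum_infsum summable_on_subset_banach[OF summable]) auto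
  ultimately show ?thesis
    by (rule norm_infsum_le) (use norm_cos_term_le t in auto)
qed

end

lemma integral_exp_decay_le:
  fixes c :: real
  assumes "c > 0" "T \<ge> 0"
  shows "integral {0..T} (\<lambda>t. exp (- (c * t))) \<le> 1 / c"
proof -
  have "((\<lambda>t. exp (- (c * t))) has_integral (- exp (- (c * T)) / c - (- exp (- (c * 0)) / c))) {0..T}"
    by (rule fundamental_theorem_of_calculus)
       (use assms in \<open>auto intro!: derivative_eq_intros simp flip: has_real_derivative_iff_has_vector_derivative\<close>)
  hence "integral {0..T} (\<lambda>t. exp (- (c * t))) = - exp (- (c * T)) / c - (- exp (- (c * 0)) / c)"
    by (rule integral_unique)
  also have "\<dots> \<le> 1 / c" using assms by simp
  finally show ?thesis .
qed

context weighted_points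
begin

text \<open>The index set is a parameter so that the poles in a disc can be split off from the
  distant ones.\<close>

definition pole_sum :: "complex set \<Rightarrow> complex \<Rightarrow> complex" where
  "pole_sum A z = (\<Sum>\<^sub>\<infinity>\<gamma>\<in>A. m \<gamma> * (1 / (z\<^sup>2 - \<gamma>\<^sup>2)))"

lemma
  assumes R: "R > 0"
  shows pole_sum_uniform_limit: "uniform_limit (cball 0 R) (\<lambda>S z. \<Sum>\<gamma>\<in>S. m \<gamma> * (1 / (z\<^sup>2 - \<gamma>\<^sup>2)))
      (pole_sum (Z - cball 0 (2 * R))) (finite_subsets_at_top (Z - cball 0 (2 * R)))"
    and holomorphic_pole_sum: "pole_sum (Z - cball 0 (2 * R)) holomorphic_on ball 0 R"
proof -
  \<comment> \<open>From |z| <= |\<gamma>| / 2 follows |z^2 - \<gamma>^2| >= 3/4 * |\<gamma>|^2, so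
    distant terms are dominated by the summable weights and have no pole in the disc.\<close>
  have far: "norm (m \<gamma> * (1 / (z\<^sup>2 - \<gamma>\<^sup>2))) \<le> m \<gamma> / norm \<gamma> ^ 2 * (4 / 3) \<and> z\<^sup>2 - \<gamma>\<^sup>2 \<noteq> 0"
    if "\<gamma> \<in> Z - cball 0 (2 * R)" "z \<in> cball 0 R" for \<gamma> z :: complex
  proof -
    have "norm z \<le> norm \<gamma> / 2" "norm \<gamma> > 0" using that R by auto
    hence "norm z ^ 2 \<le> (norm \<gamma> / 2) ^ 2" by (intro power_mono) auto
    hence "norm \<gamma> ^ 2 * (3 / 4) \<le> norm \<gamma> ^ 2 - norm z ^ 2" by (simp add: power_divide)
    also have "\<dots> \<le> norm (z\<^sup>2 - \<gamma>\<^sup>2)"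
      using norm_triangle_ineq2[of "\<gamma>\<^sup>2" "z\<^sup>2"] by (simp add: norm_power norm_minus_commute)
    finally have le: "norm \<gamma> ^ 2 * (3 / 4) \<le> norm (z\<^sup>2 - \<gamma>\<^sup>2)" .
    have pos: "norm \<gamma> ^ 2 * (3 / 4) > 0" using \<open>norm \<gamma> > 0\<close> by simp
    have "m \<gamma> / norm (z\<^sup>2 - \<gamma>\<^sup>2) \<le> m \<gamma> / (norm \<gamma> ^ 2 * (3 / 4))"
      using le pos m_pos[of \<gamma>] that by (intro divide_left_mono mult_pos_pos) auto
    moreover have "norm (m \<gamma> * (1 / (z\<^sup>2 - \<gamma>\<^sup>2))) = m \<gamma> / norm (z\<^sup>2 - \<gamma>\<^sup>2)"
      using m_pos[of \<gamma>] that by (simp add: norm_mult norm_divide)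
    ultimately show ?thesis using le pos by (auto simp: field_simps)
  qed
  have "(\<lambda>\<gamma>. m \<gamma> / norm \<gamma> ^ 2 * (4 / 3)) summable_on (Z - cball 0 (2 * R))"
    by (intro summable_on_cmult_left summable_on_subset_banach[OF summable]) auto
  thus lim: "uniform_limit (cball 0 R) (\<lambda>S z. \<Sum>\<gamma>\<in>S. m \<gamma> * (1 / (z\<^sup>2 - \<gamma>\<^sup>2)))
      (pole_sum (Z - cball 0 (2 * R))) (finite_subsets_at_top (Z - cball 0 (2 * R)))"
    unfolding pole_sum_def by (rule Weierstrass_m_test_general[rotated]) (rule far[THEN conjunct1])
  have hol: "(\<lambda>z. \<Sum>\<gamma>\<in>S. m \<gamma> * (1 / (z\<^sup>2 - \<gamma>\<^sup>2))) holomorphic_on cball 0 R"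
    if "S \<subseteq> Z - cball 0 (2 * R)" for S
    by (intro holomorphic_intros) (use far that in blast)
  have "eventually (\<lambda>S. continuous_on (cball 0 R) (\<lambda>z. \<Sum>\<gamma>\<in>S. m \<gamma> * (1 / (z\<^sup>2 - \<gamma>\<^sup>2))) \<and>
      (\<lambda>z. \<Sum>\<gamma>\<in>S. m \<gamma> * (1 / (z\<^sup>2 - \<gamma>\<^sup>2))) holomorphic_on ball 0 R)
    (finite_subsets_at_top (Z - cball 0 (2 * R)))"
    using hol by (intro eventually_finite_subsets_at_top_weakI conjI holomorphic_on_imp_continuous_on
        holomorphic_on_subset[OF _ ball_subset_cball])
  thus "pole_sum (Z - cball 0 (2 * R)) holomorphic_on ball 0 R"
    using holomorphic_uniform_limit[OF _ lim] by (metis finite_subsets_at_top_neq_bot)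
qed

lemma pole_sum_split:
  assumes "R > 0" "z \<in> cball 0 R"
  shows "((\<lambda>\<gamma>. m \<gamma> * (1 / (z\<^sup>2 - \<gamma>\<^sup>2))) has_sum
    ((\<Sum>\<gamma>\<in>Z \<inter> cball 0 (2 * R). m \<gamma> * (1 / (z\<^sup>2 - \<gamma>\<^sup>2))) + pole_sum (Z - cball 0 (2 * R)) z)) Z"
proof -
  have "((\<lambda>\<gamma>. m \<gamma> * (1 / (z\<^sup>2 - \<gamma>\<^sup>2))) has_sum pole_sum (Z - cball 0 (2 * R)) z) (Z - cball 0 (2 * R))"
    unfolding has_sum_def using tendsto_uniform_limitI[OF pole_sum_uniform_limit[OF assms(1)] assms(2)] by simp
  hence "((\<lambda>\<gamma>. m \<gamma> * (1 / (z\<^sup>2 - \<gamma>\<^sup>2))) has_sum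
    ((\<Sum>\<gamma>\<in>Z \<inter> cball 0 (2 * R). m \<gamma> * (1 / (z\<^sup>2 - \<gamma>\<^sup>2))) + pole_sum (Z - cball 0 (2 * R)) z))
      ((Z \<inter> cball 0 (2 * R)) \<union> (Z - cball 0 (2 * R)))"
    by (intro has_sum_Un_disjoint has_sum_finite finite_ball) auto
  thus ?thesis by (simp add: Int_Diff_Un)
qed

text \<open>Truncating the sum to \<open>S\<close> costs at most \<epsilon> S * 2 / c in the
  integral, uniformly in the length of the interval. Hence the length can go to infinity first and
  \<open>S\<close> can exhaust \<open>Z\<close> afterwards.\<close>

lemma Laplace_cos_sum:
  assumes z: "Im z > 0" "Im z > Y"
    and lim: "(\<lambda>n. integral {0..real n} (\<lambda>t. cos_sum t * exp (\<i> * z * t))) \<longlonglongrightarrow> L"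
  shows "((\<lambda>\<gamma>. m \<gamma> * (1 / (z\<^sup>2 - \<gamma>\<^sup>2))) has_sum \<i> * z * L) Z"
proof -
  define c where "c = Im z - Y"
  have c: "c > 0" using z by (simp add: c_def)
  define f where "f = (\<lambda>\<gamma> t. m \<gamma> * ((1 - cos (\<gamma> * complex_of_real t)) / \<gamma>\<^sup>2))"
  define P where "P = (\<lambda>S. \<Sum>\<gamma>\<in>S. m \<gamma> * (1 / (z\<^sup>2 - \<gamma>\<^sup>2)))"
  define \<epsilon> where "\<epsilon> = (\<lambda>S. \<Sum>\<^sub>\<infinity>\<gamma>\<in>Z - S. m \<gamma> / norm \<gamma> ^ 2)"
  have \<epsilon>_nonneg: "\<epsilon> S \<ge> 0" for S unfolding \<epsilon>_def using m_pos by (intro infsum_nonneg divide_nonneg_nonneg) (auto intro: less_imp_le)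
  have est: "norm (L - - \<i> / z * P S) \<le> \<epsilon> S * (2 / c)" if S: "finite S" "S \<subseteq> Z" for S
  proof -
    have cont_f: "continuous_on A (f \<gamma>)" for A \<gamma>
      unfolding f_def by (auto intro!: continuous_intros simp: divide_inverse)
    have 1: "(\<lambda>t. cos_sum t * exp (\<i> * z * t)) integrable_on {0..real n}" for n
      by (intro integrable_continuous_real continuous_intros continuous_on_subset[OF continuous_cos_sum]) auto
    have 2: "(\<lambda>t. f \<gamma> t * exp (\<i> * z * t)) integrable_on {0..real n}" for \<gamma> n
      by (intro integrable_continuous_real continuous_intros cont_f)
    have "norm (integral {0..real n} (\<lambda>t. cos_sum t * exp (\<i> * z * t)) -
        (\<Sum>\<gamma>\<in>S. integral {0..real n} (\<lambda>t. f \<gamma> t * exp (\<i> * z * t)))) \<le> \<epsilon> S * (2 / c)" for n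
    proof -
      have "integral {0..real n} (\<lambda>t. cos_sum t * exp (\<i> * z * t)) -
        (\<Sum>\<gamma>\<in>S. integral {0..real n} (\<lambda>t. f \<gamma> t * exp (\<i> * z * t)))
        = integral {0..real n} (\<lambda>t. cos_sum t * exp (\<i> * z * t) - (\<Sum>\<gamma>\<in>S. f \<gamma> t * exp (\<i> * z * t)))"
        using 1 2 S by (simp add: integral_diff integral_sum integrable_sum)
      also have "norm \<dots> \<le> integral {0..real n} (\<lambda>t. \<epsilon> S * 2 * exp (- (c * t)))"
      proof (rule integral_norm_bound_integral)
        fix t assume t: "t \<in> {0..real n}"
        have "norm (cos_sum t * exp (\<i> * z * t) - (\<Sum>\<gamma>\<in>S. f \<gamma> t * exp (\<i> * z * t)))
            = norm (cos_sum t - (\<Sum>\<gamma>\<in>S. f \<gamma> t)) * exp (- (Im z * t))"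
          by (simp add: norm_mult flip: sum_distrib_right left_diff_distrib)
        also have "\<dots> \<le> (\<epsilon> S * (2 * exp (Y * t))) * exp (- (Im z * t))"
          using norm_infsum_tail_le[OF S, of t] t by (intro mult_right_mono) (auto simp: \<epsilon>_def f_def)
        also have "\<dots> = \<epsilon> S * 2 * exp (- (c * t))"
          by (simp add: c_def mult_exp_exp algebra_simps)
        finally show "norm (cos_sum t * exp (\<i> * z * t) - (\<Sum>\<gamma>\<in>S. f \<gamma> t * exp (\<i> * z * t))) \<le> \<epsilon> S * 2 * exp (- (c * t))" .
      next
        show "(\<lambda>t. cos_sum t * exp (\<i> * z * t) - (\<Sum>\<gamma>\<in>S. f \<gamma> t * exp (\<i> * z * t))) integrable_on {0..real n}"
          by (intro integrable_diff integrable_sum 1 2 S)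
        show "(\<lambda>t. \<epsilon> S * 2 * exp (- (c * t))) integrable_on {0..real n}"
          by (intro integrable_continuous_real continuous_intros)
      qed
      also have "\<dots> = \<epsilon> S * 2 * integral {0..real n} (\<lambda>t. exp (- (c * t)))" by simp
      also have "\<dots> \<le> \<epsilon> S * 2 * (1 / c)"
        using integral_exp_decay_le[OF c, of "real n"] \<epsilon>_nonneg by (intro mult_left_mono) auto
      finally show ?thesis by simp
    qed
    moreover have "(\<lambda>n. \<Sum>\<gamma>\<in>S. integral {0..real n} (\<lambda>t. f \<gamma> t * exp (\<i> * z * t))) \<longlonglongrightarrow> - \<i> / z * P S"
    proof -
      have "(\<lambda>n. \<Sum>\<gamma>\<in>S. m \<gamma> * integral {0..real n} (\<lambda>t. (1 - cos (\<gamma> * t)) / \<gamma>\<^sup>2 * exp (\<i> * z * t)))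
          \<longlonglongrightarrow> (\<Sum>\<gamma>\<in>S. m \<gamma> * (- \<i> / z * (1 / (z\<^sup>2 - \<gamma>\<^sup>2))))"
        using S strip nonzero z
        by (intro tendsto_sum tendsto_mult_left integral_one_minus_cos_tendsto[where Y = Y]) auto
      moreover have "integral {0..real n} (\<lambda>t. f \<gamma> t * exp (\<i> * z * t))
          = m \<gamma> * integral {0..real n} (\<lambda>t. (1 - cos (\<gamma> * t)) / \<gamma>\<^sup>2 * exp (\<i> * z * t))" for n and \<gamma> :: complex
        unfolding f_def by (simp add: mult.assoc flip: integral_mult_right)
      ultimately show ?thesis by (simp add: P_def sum_distrib_left mult_ac)
    qed
    ultimately show ?thesis
      by (intro tendsto_upperbound[OF tendsto_norm[OF tendsto_diff[OF lim]]]) auto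
  qed
  have \<epsilon>_lim: "(\<epsilon> \<longlongrightarrow> 0) (finite_subsets_at_top Z)"
  proof -
    have "((\<lambda>S. infsum (\<lambda>\<gamma>. m \<gamma> / norm \<gamma> ^ 2) Z - (\<Sum>\<gamma>\<in>S. m \<gamma> / norm \<gamma> ^ 2)) \<longlongrightarrow>
        infsum (\<lambda>\<gamma>. m \<gamma> / norm \<gamma> ^ 2) Z - infsum (\<lambda>\<gamma>. m \<gamma> / norm \<gamma> ^ 2) Z) (finite_subsets_at_top Z)"
      by (intro tendsto_intros infsum_tendsto summable)
    moreover have "\<epsilon> S = infsum (\<lambda>\<gamma>. m \<gamma> / norm \<gamma> ^ 2) Z - (\<Sum>\<gamma>\<in>S. m \<gamma> / norm \<gamma> ^ 2)"
      if "finite S" "S \<subseteq> Z" for S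
      unfolding \<epsilon>_def by (subst infsum_Diff[OF summable]) (use that in auto)
    hence "\<forall>\<^sub>F S in finite_subsets_at_top Z. infsum (\<lambda>\<gamma>. m \<gamma> / norm \<gamma> ^ 2) Z - (\<Sum>\<gamma>\<in>S. m \<gamma> / norm \<gamma> ^ 2) = \<epsilon> S"
      by (intro eventually_finite_subsets_at_top_weakI) auto
    ultimately show ?thesis using Lim_transform_eventually by fastforce
  qed
  have "((\<lambda>S. L - - \<i> / z * P S) \<longlongrightarrow> 0) (finite_subsets_at_top Z)"
  proof (rule Lim_null_comparison)
    show "((\<lambda>S. \<epsilon> S * (2 / c)) \<longlongrightarrow> 0) (finite_subsets_at_top Z)"
      using tendsto_mult_right[OF \<epsilon>_lim, of "2 / c"] by simp
    show "\<forall>\<^sub>F S in finite_subsets_at_top Z. norm (L - - \<i> / z * P S) \<le> \<epsilon> S * (2 / c)"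
      using est by (intro eventually_finite_subsets_at_top_weakI) auto
  qed
  hence "((\<lambda>S. \<i> * z * L - \<i> * z * (L - - \<i> / z * P S)) \<longlongrightarrow> \<i> * z * L - \<i> * z * 0) (finite_subsets_at_top Z)"
    by (intro tendsto_intros)
  moreover have "\<i> * z * L - \<i> * z * (L - - \<i> / z * P S) = P S" for S
    using z by (cases "z = 0") (auto simp: field_simps)
  ultimately show ?thesis by (simp add: has_sum_def P_def)
qed

text \<open>The quadratic bound continues the transform \<open>F\<close> holomorphically to the
  whole upper half-plane. There \<i> z F z must agree with the pole sum, which is singular at every
  point or negative of a point of \<open>Z\<close> off the real axis.\<close>

theorem real_if_cos_sum_quadratic_bound:
  assumes bound: "\<And>t. t \<ge> 0 \<Longrightarrow> norm (cos_sum t) \<le> C * (1 + t\<^sup>2)" and "\<gamma> \<in> Z"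
  shows "Im \<gamma> = 0"
proof (rule ccontr)
  assume "Im \<gamma> \<noteq> 0"
  define z0 where "z0 = (if Im \<gamma> > 0 then \<gamma> else - \<gamma>)"
  have z0: "Im z0 > 0" "z0\<^sup>2 = \<gamma>\<^sup>2" using \<open>Im \<gamma> \<noteq> 0\<close> by (auto simp: z0_def)
  obtain F where F: "F holomorphic_on {z. Im z > 0}"
    "\<And>z. Im z > 0 \<Longrightarrow> (\<lambda>n. integral {0..real n} (\<lambda>t. cos_sum t * exp (\<i> * z * t))) \<longlonglongrightarrow> F z"
    by (rule Laplace_transform_holomorphic[OF continuous_cos_sum bound]) (assumption | rule that)+
  \<comment> \<open>The disc contains \<open>z0\<close> and also points above the height |Y|, where
    the transform is known to equal the pole sum.\<close>
  define R where "R = norm z0 + \<bar>Y\<bar> + 2"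
  have R: "R > 0" "z0 \<in> ball 0 R" by (auto simp: R_def add_nonneg_pos)
  define D where "D = {z. Im z > 0} \<inter> ball 0 R"
  define Z1 where "Z1 = Z \<inter> cball 0 (2 * R)"
  have D: "open D" "convex D" "z0 \<in> D"
    using R z0 by (auto simp: D_def open_halfspace_Im_gt convex_halfspace_Im_gt convex_Int)
  have fin: "finite Z1" by (simp add: Z1_def finite_ball)
  \<comment> \<open>Subtracting the distant poles leaves a function that is holomorphic at
    \<open>z0\<close> as well, to be compared with a finite sum.\<close>
  define E where "E = (\<lambda>z. \<i> * z * F z - pole_sum (Z - cball 0 (2 * R)) z)"
  have hol_E: "E holomorphic_on D"
    unfolding E_def D_def
    by (intro holomorphic_intros holomorphic_on_subset[OF F(1)] holomorphic_on_subset[OF holomorphic_pole_sum[OF R(1)]]) auto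
  define P where "P = (\<lambda>S (z::complex). \<Sum>\<gamma>\<in>S. m \<gamma> * (1 / (z\<^sup>2 - \<gamma>\<^sup>2)))"
  define X where "X = Z1 \<union> uminus ` Z1"
  have X: "z\<^sup>2 - c\<^sup>2 \<noteq> 0" if "z \<notin> X" "c \<in> Z1" for z c :: complex
    using that by (auto simp: X_def power2_eq_iff)
  \<comment> \<open>Removing finitely many points keeps the convex open set \<open>D\<close>
    connected, so the identity continues down from the upper part. The \<open>max Y 0\<close> is due
    to the two requirements: existence of \<open>F\<close> needs Im z > 0, the cosine transforms
    need Im z > Y.\<close>
  have eq: "E z = P Z1 z" if "z \<in> D - X" for z
  proof (rule analytic_continuation_open[where s = "{z. Im z > max Y 0} \<inter> ball 0 R - X" and s' = "D - X" and f = E and g = "P Z1"])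
    show "open ({z. Im z > max Y 0} \<inter> ball 0 R - X)"
      using fin by (intro open_Diff open_Int open_halfspace_Im_gt finite_imp_closed) (auto simp: X_def)
    show "open (D - X)"
      using fin D by (intro open_Diff finite_imp_closed) (auto simp: X_def)
    show "connected (D - X)"
      using fin D by (intro connected_open_diff_countable convex_connected) (auto simp: X_def intro: countable_finite)
    show "{z. Im z > max Y 0} \<inter> ball 0 R - X \<noteq> {}"
    proof -
      have "infinite ((\<lambda>x. \<i> * complex_of_real x) ` {\<bar>Y\<bar><..<\<bar>Y\<bar> + 1})"
        by (subst finite_image_iff) (auto simp: inj_on_def)
      moreover have "finite X" using fin by (simp add: X_def)
      ultimately have "\<not> (\<lambda>x. \<i> * complex_of_real x) ` {\<bar>Y\<bar><..<\<bar>Y\<bar> + 1} \<subseteq> X"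
        using finite_subset by blast
      then obtain x where "x \<in> {\<bar>Y\<bar><..<\<bar>Y\<bar> + 1}" "\<i> * complex_of_real x \<notin> X" by blast
      moreover from this have "\<bar>x\<bar> < \<bar>Y\<bar> + 2" by auto
      hence "norm (\<i> * complex_of_real x) < R"
        using norm_ge_zero[of z0] unfolding R_def norm_mult norm_ii norm_of_real by linarith
      ultimately have "\<i> * complex_of_real x \<in> {z. Im z > max Y 0} \<inter> ball 0 R - X" by auto
      thus ?thesis by blast
    qed
    show "{z. Im z > max Y 0} \<inter> ball 0 R - X \<subseteq> D - X" by (auto simp: D_def)
    show "E holomorphic_on D - X" using hol_E by (rule holomorphic_on_subset) auto
    show "P Z1 holomorphic_on D - X"
      unfolding P_def by (intro holomorphic_intros) (use X in auto)
    show "z \<in> D - X" by fact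
    fix z assume z: "z \<in> {z. Im z > max Y 0} \<inter> ball 0 R - X"
    have "((\<lambda>\<gamma>. m \<gamma> * (1 / (z\<^sup>2 - \<gamma>\<^sup>2))) has_sum \<i> * z * F z) Z"
      using z by (intro Laplace_cos_sum F(2)) auto
    moreover have "((\<lambda>\<gamma>. m \<gamma> * (1 / (z\<^sup>2 - \<gamma>\<^sup>2))) has_sum (P Z1 z + pole_sum (Z - cball 0 (2 * R)) z)) Z"
      unfolding P_def Z1_def using z R by (intro pole_sum_split) auto
    ultimately have "\<i> * z * F z = P Z1 z + pole_sum (Z - cball 0 (2 * R)) z"
      by (rule has_sum_unique)
    thus "E z = P Z1 z" by (simp add: E_def)
  qed
  \<comment> \<open>Both \<open>z0\<close> and its negative may belong to \<open>Z\<close>. Their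
    terms coincide up to weight, so the singular coefficient at \<open>z0\<close> is the positive
    sum \<open>M\<close>.\<close>
  define A where "A = {c \<in> Z1. c\<^sup>2 = z0\<^sup>2}"
  define M where "M = (\<Sum>c\<in>A. m c)"
  have z0_bd: "norm z0 = norm \<gamma>" by (simp add: z0_def)
  have "\<gamma> \<in> A" using \<open>\<gamma> \<in> Z\<close> z0 R z0_bd by (auto simp: A_def Z1_def)
  moreover have "finite A" using fin by (simp add: A_def)
  ultimately have "M > 0" unfolding M_def using m_pos by (intro sum_pos) (auto simp: A_def Z1_def)
  have "open (D - (X - {z0}))" "z0 \<in> D - (X - {z0})"
    using fin D by (auto intro!: open_Diff finite_imp_closed simp: X_def)
  hence "eventually (\<lambda>z. z \<in> D - (X - {z0})) (at z0)"
    by (rule eventually_at_in_open')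
  hence "eventually (\<lambda>z. z \<in> D - X \<and> z \<noteq> - z0 \<and> z \<noteq> z0) (at z0)"
    using eventually_neq_at_within[of z0 z0 UNIV] eventually_neq_at_within[of "- z0" z0 UNIV]
    by eventually_elim auto
  hence ev: "eventually (\<lambda>z. M + (z\<^sup>2 - z0\<^sup>2) * P (Z1 - A) z = (z\<^sup>2 - z0\<^sup>2) * E z) (at z0)"
  proof eventually_elim
    case (elim z)
    hence "z\<^sup>2 - z0\<^sup>2 \<noteq> 0" by (auto simp: power2_eq_iff)
    have "P Z1 z = P A z + P (Z1 - A) z"
      unfolding P_def using fin by (subst sum.subset_diff[of A]) (auto simp: A_def)
    moreover have "(z\<^sup>2 - z0\<^sup>2) * P A z = M"
      using \<open>z\<^sup>2 - z0\<^sup>2 \<noteq> 0\<close> by (simp add: P_def M_def sum_distrib_left A_def)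
    ultimately show ?case using eq[of z] elim by (simp add: algebra_simps)
  qed
  have "isCont E z0" using hol_E D holomorphic_on_imp_continuous_on continuous_on_eq_continuous_at by blast
  moreover have "isCont (P (Z1 - A)) z0"
    unfolding P_def by (intro continuous_intros) (auto simp: A_def)
  ultimately have "((\<lambda>z. M + (z\<^sup>2 - z0\<^sup>2) * P (Z1 - A) z) \<longlongrightarrow> M + (z0\<^sup>2 - z0\<^sup>2) * P (Z1 - A) z0) (at z0)"
    "((\<lambda>z. (z\<^sup>2 - z0\<^sup>2) * E z) \<longlongrightarrow> (z0\<^sup>2 - z0\<^sup>2) * E z0) (at z0)"
    unfolding isCont_def by (intro tendsto_intros; simp)+
  \<comment> \<open>After multiplication by z^2 - z0^2 both sides are continuous at
    \<open>z0\<close>, and the limit reads M = 0.\<close>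
  hence "M + (z0\<^sup>2 - z0\<^sup>2) * P (Z1 - A) z0 = (z0\<^sup>2 - z0\<^sup>2) * E z0"
    using tendsto_cong[OF ev] tendsto_unique[OF at_neq_bot] by blast
  thus False using \<open>M > 0\<close> by simp
qed

end

section \<open>Growth of the completed function\<close>

text \<open>An explicit bound on all of \<open>S\<close> instead of an asymptotic one. The base 1 +
  |s| is at least 1, so exponents can be raised and constant factors absorbed.\<close>

definition order_bound :: "real \<Rightarrow> complex set \<Rightarrow> (complex \<Rightarrow> complex) \<Rightarrow> bool" where
  "order_bound \<kappa> S f \<longleftrightarrow> (\<exists>C\<ge>0. \<forall>s\<in>S. norm (f s) \<le> exp (C * (1 + norm s) powr \<kappa>))"

lemma order_boundI:
  assumes "\<And>s. s \<in> S \<Longrightarrow> norm (f s) \<le> exp (C * (1 + norm s) powr \<kappa>)"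
  shows "order_bound \<kappa> S f"
  unfolding order_bound_def
proof (intro exI[of _ "max C 0"] conjI ballI)
  fix s assume "s \<in> S"
  have "exp (C * (1 + norm s) powr \<kappa>) \<le> exp (max C 0 * (1 + norm s) powr \<kappa>)"
    by (simp add: mult_right_mono)
  thus "norm (f s) \<le> exp (max C 0 * (1 + norm s) powr \<kappa>)"
    using assms[OF \<open>s \<in> S\<close>] by linarith
qed auto

lemma order_boundE:
  assumes "order_bound \<kappa> S f"
  obtains C where "C \<ge> 0" "\<And>s. s \<in> S \<Longrightarrow> norm (f s) \<le> exp (C * (1 + norm s) powr \<kappa>)"
  using assms by (auto simp: order_bound_def)

lemma order_bound_subset: "order_bound \<kappa> S f \<Longrightarrow> T \<subseteq> S \<Longrightarrow> order_bound \<kappa> T f"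
  unfolding order_bound_def by blast

lemma order_bound_mono:
  assumes "order_bound \<kappa> S f" "\<kappa> \<le> \<kappa>'"
  shows "order_bound \<kappa>' S f"
proof -
  obtain C where C: "C \<ge> 0" "\<And>s. s \<in> S \<Longrightarrow> norm (f s) \<le> exp (C * (1 + norm s) powr \<kappa>)"
    using order_boundE[OF assms(1)] by metis
  show ?thesis
  proof (rule order_boundI)
    fix s assume s: "s \<in> S"
    have "C * (1 + norm s) powr \<kappa> \<le> C * (1 + norm s) powr \<kappa>'"
      using C assms by (intro mult_left_mono powr_mono) auto
    thus "norm (f s) \<le> exp (C * (1 + norm s) powr \<kappa>')"
      using C(2)[OF s] by (meson exp_le_cancel_iff order.trans)
  qed
qed

lemma order_bound_Un:
  assumes "order_bound \<kappa> S f" "order_bound \<kappa> T f"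
  shows "order_bound \<kappa> (S \<union> T) f"
proof -
  obtain C where C: "C \<ge> 0" "\<And>s. s \<in> S \<Longrightarrow> norm (f s) \<le> exp (C * (1 + norm s) powr \<kappa>)"
    using order_boundE[OF assms(1)] by metis
  obtain D where D: "D \<ge> 0" "\<And>s. s \<in> T \<Longrightarrow> norm (f s) \<le> exp (D * (1 + norm s) powr \<kappa>)"
    using order_boundE[OF assms(2)] by metis
  show ?thesis
  proof (rule order_boundI)
    fix s assume s: "s \<in> S \<union> T"
    have "exp (C * (1 + norm s) powr \<kappa>) \<le> exp ((C + D) * (1 + norm s) powr \<kappa>)"
      "exp (D * (1 + norm s) powr \<kappa>) \<le> exp ((C + D) * (1 + norm s) powr \<kappa>)"
      using C(1) D(1) by (auto intro!: mult_right_mono)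
    thus "norm (f s) \<le> exp ((C + D) * (1 + norm s) powr \<kappa>)"
      using C(2)[of s] D(2)[of s] s by (meson Un_iff order.trans)
  qed
qed

lemma order_bound_mult:
  assumes "order_bound \<kappa> S f" "order_bound \<kappa> S g"
  shows "order_bound \<kappa> S (\<lambda>s. f s * g s)"
proof -
  obtain C where C: "C \<ge> 0" "\<And>s. s \<in> S \<Longrightarrow> norm (f s) \<le> exp (C * (1 + norm s) powr \<kappa>)"
    using order_boundE[OF assms(1)] by metis
  obtain D where D: "D \<ge> 0" "\<And>s. s \<in> S \<Longrightarrow> norm (g s) \<le> exp (D * (1 + norm s) powr \<kappa>)"
    using order_boundE[OF assms(2)] by metis
  show ?thesis
  proof (rule order_boundI)
    fix s assume s: "s \<in> S"
    have "norm (f s * g s) \<le> exp (C * (1 + norm s) powr \<kappa>) * exp (D * (1 + norm s) powr \<kappa>)"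
      unfolding norm_mult using C(2) D(2) s by (intro mult_mono) auto
    thus "norm (f s * g s) \<le> exp ((C + D) * (1 + norm s) powr \<kappa>)"
      by (simp add: exp_add distrib_right)
  qed
qed

lemma order_bound_bounded:
  assumes "\<And>s. s \<in> S \<Longrightarrow> norm (f s) \<le> B" "\<kappa> \<ge> 0"
  shows "order_bound \<kappa> S f"
proof (rule order_boundI)
  fix s assume "s \<in> S"
  hence "norm (f s) \<le> \<bar>B\<bar>" using assms(1)[of s] by linarith
  also have "\<dots> \<le> exp \<bar>B\<bar>" using exp_ge_add_one_self[of "\<bar>B\<bar>"] by linarith
  also have "\<dots> \<le> exp (\<bar>B\<bar> * (1 + norm s) powr \<kappa>)"
    using mult_left_mono[OF ge_one_powr_ge_zero[of "1 + norm s" \<kappa>], of "\<bar>B\<bar>"] assms(2) by simp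
  finally show "norm (f s) \<le> exp (\<bar>B\<bar> * (1 + norm s) powr \<kappa>)" .
qed

lemma order_bound_prod:
  assumes "\<And>i. i \<in> I \<Longrightarrow> order_bound \<kappa> S (f i)" "\<kappa> \<ge> 0"
  shows "order_bound \<kappa> S (\<lambda>s. \<Prod>i\<in>I. f i s)"
  using assms(1)
proof (induction I rule: infinite_finite_induct)
  case (insert i I)
  thus ?case by (simp add: order_bound_mult)
qed (auto intro!: order_bound_bounded[of _ _ 1] assms(2))

lemma order_bound_power:
  assumes "order_bound \<kappa> S f" "\<kappa> \<ge> 0"
  shows "order_bound \<kappa> S (\<lambda>s. f s ^ n)"
  using order_bound_prod[of "{..<n}" \<kappa> S "\<lambda>_. f"] assms by simp

lemma order_bound_linear_exponent:
  assumes "\<And>s. s \<in> S \<Longrightarrow> norm (f s) \<le> exp (B * (1 + norm s))" "\<kappa> \<ge> 1"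
  shows "order_bound \<kappa> S f"
  by (rule order_bound_mono[OF order_boundI[where C = B and \<kappa> = 1]]) (use assms in auto)

text \<open>In Gauss's limit formula the numerator has the norm of its value at \<open>Re z\<close>,
  while each factor of the Pochhammer denominator can only be larger in norm than at
  \<open>Re z\<close>.\<close>

lemma norm_Gamma_le:
  assumes "Re z > 0"
  shows "norm (Gamma z :: complex) \<le> Gamma (Re z)"
proof (rule LIMSEQ_le[OF tendsto_norm[OF Gamma_series_LIMSEQ] Gamma_series_LIMSEQ])
  have "norm (Gamma_series z n) \<le> Gamma_series (Re z) n" for n
  proof -
    have "pochhammer (Re z) (n + 1) \<le> norm (pochhammer z (n + 1))"
      unfolding pochhammer_prod prod_norm[symmetric]
    proof (rule prod_mono)
      fix i
      show "0 \<le> Re z + of_nat i \<and> Re z + of_nat i \<le> norm (z + of_nat i)"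
        using assms complex_Re_le_cmod[of "z + of_nat i"] by simp
    qed
    moreover have "pochhammer (Re z) (n + 1) > 0" using assms by (rule pochhammer_pos)
    ultimately show ?thesis
      unfolding Gamma_series_def by (simp add: norm_divide norm_mult frac_le)
  qed
  thus "\<exists>N. \<forall>n\<ge>N. norm (Gamma_series z n) \<le> Gamma_series (Re z) n" by blast
qed

text \<open>Comparison with n! <= n^n at the next integer; bounding ln y by 2 sqrt y produces the
  exponent 3/2. Gamma is increasing from 3/2 on.\<close>

lemma Gamma_real_le_exp:
  fixes x :: real
  assumes "x \<ge> 3 / 2"
  shows "Gamma x \<le> exp (2 * (1 + x) powr (3 / 2))"
proof -
  define n where "n = nat \<lceil>x\<rceil>"
  have n: "x \<le> real n" "real n \<le> 1 + x" "n \<ge> 1" using assms by (auto simp: n_def) linarith+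
  have "Gamma x < Gamma (1 + real n)" using n assms by (intro Gamma_real_strict_mono) auto
  also have "\<dots> = fact n" using Gamma_fact[of n, where 'a = real] by (simp add: add.commute)
  also have "fact n \<le> real n ^ n" by (metis fact_le_power of_nat_fact of_nat_le_iff of_nat_power order_refl)
  also have "\<dots> = exp (real n * ln (real n))" using n by (simp add: exp_of_nat_mult)
  also have "\<dots> \<le> exp ((1 + x) * (2 * sqrt (1 + x)))"
  proof -
    have "ln (real n) \<le> ln (1 + x)" using n by simp
    also have "\<dots> = 2 * ln (sqrt (1 + x))" using assms by (simp add: ln_sqrt)
    also have "\<dots> \<le> 2 * sqrt (1 + x)" using ln_le_minus_one[of "sqrt (1 + x)"] assms by simp
    finally have "ln (real n) \<le> 2 * sqrt (1 + x)" .
    thus ?thesis using n assms by (auto intro!: mult_mono)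
  qed
  also have "(1 + x) * (2 * sqrt (1 + x)) = 2 * (1 + x) powr (3 / 2)"
    using assms powr_add[of "1 + x" 1 "1 / 2"] by (simp add: powr_half_sqrt)
  finally show ?thesis by simp
qed

text \<open>The real part \<open>x\<close> of the argument may be small, but it is at least d = lam
  / 2. Two steps of the recurrence move it to \<open>x + 2\<close>, where the real estimate applies,
  at the cost of dividing by x * (x + 1) >= d^2.\<close>

lemma order_bound_Gamma:
  assumes lam: "lam > 0" and mu: "Re mu \<ge> 0"
  shows "order_bound (3 / 2) {s. Re s \<ge> 1 / 2} (\<lambda>s. Gamma (complex_of_real lam * s + mu))"
proof -
  define d where "d = lam / 2"
  define K where "K = 3 + lam + norm mu"
  have "d > 0" "K \<ge> 1" using lam by (auto simp: d_def K_def add_nonneg_nonneg)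
  have o1: "order_bound (3 / 2) {s. Re s \<ge> 1 / 2} (\<lambda>s. complex_of_real (1 / d\<^sup>2))"
    by (intro order_bound_bounded[of _ _ "1 / d\<^sup>2"]) (auto simp: norm_divide norm_power)
  have o2: "order_bound (3 / 2) {s. Re s \<ge> 1 / 2} (\<lambda>s. complex_of_real (d\<^sup>2) * Gamma (complex_of_real lam * s + mu))"
  proof (rule order_boundI)
    fix s assume "s \<in> {s. Re s \<ge> 1 / 2}"
    hence s: "Re s \<ge> 1 / 2" by simp
    define x where "x = lam * Re s + Re mu"
    have "lam * (1 / 2) \<le> lam * Re s" using s lam by (intro mult_left_mono) auto
    hence x: "x \<ge> d" using mu by (simp add: x_def d_def)
    have "x > 0" using x \<open>d > 0\<close> by simp
    have "norm (Gamma (complex_of_real lam * s + mu)) \<le> Gamma x"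
      using norm_Gamma_le[of "complex_of_real lam * s + mu"] \<open>x > 0\<close> by (simp add: x_def)
    moreover have "x * (x + 1) * Gamma x = Gamma (x + 2)"
      using Gamma_plus1[of x] Gamma_plus1[of "x + 1"] \<open>x > 0\<close>
      by (auto simp: nonpos_Ints_def add.assoc mult_ac)
    moreover have "d\<^sup>2 \<le> x * (x + 1)" unfolding power2_eq_square using x \<open>d > 0\<close> by (intro mult_mono) auto
    moreover have "Gamma x > 0" using \<open>x > 0\<close> by (rule Gamma_real_pos)
    ultimately have "d\<^sup>2 * norm (Gamma (complex_of_real lam * s + mu)) \<le> x * (x + 1) * Gamma x"
      by (intro mult_mono) (use \<open>x > 0\<close> in auto)
    also have "\<dots> = Gamma (x + 2)" by fact
    also have "\<dots> \<le> exp (2 * (1 + (x + 2)) powr (3 / 2))"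
      using \<open>x > 0\<close> by (intro Gamma_real_le_exp) auto
    also have "\<dots> \<le> exp (2 * (K * (1 + norm s)) powr (3 / 2))"
    proof -
      have "Re s \<le> norm s" "Re mu \<le> norm mu" by (auto intro: complex_Re_le_cmod)
      hence "lam * Re s \<le> lam * norm s" using lam by (intro mult_left_mono) auto
      moreover have "norm mu * norm s \<ge> 0" by simp
      ultimately have "1 + (x + 2) \<le> K * (1 + norm s)"
        using \<open>Re mu \<le> norm mu\<close> lam norm_ge_zero[of s] unfolding x_def K_def distrib_left distrib_right by linarith
      thus ?thesis using \<open>x > 0\<close> by (auto intro!: powr_mono2)
    qed
    also have "(K * (1 + norm s)) powr (3 / 2) = K powr (3 / 2) * (1 + norm s) powr (3 / 2)"
      using \<open>K \<ge> 1\<close> by (intro powr_mult)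
    finally show "norm (complex_of_real (d\<^sup>2) * Gamma (complex_of_real lam * s + mu)) \<le> exp (2 * K powr (3 / 2) * (1 + norm s) powr (3 / 2))"
      by (simp add: norm_mult norm_power mult.assoc)
  qed
  have "order_bound (3 / 2) {s. Re s \<ge> 1 / 2}
      (\<lambda>s. complex_of_real (1 / d\<^sup>2) * (complex_of_real (d\<^sup>2) * Gamma (complex_of_real lam * s + mu)))"
    by (rule order_bound_mult[OF o1 o2])
  thus ?thesis using \<open>d > 0\<close> by simp
qed

lemma order_bound_finite_order:
  assumes hol: "G holomorphic_on UNIV" and fo: "finite_order G"
  obtains \<kappa> where "\<kappa> \<ge> 3 / 2" "order_bound \<kappa> UNIV G"
proof -
  obtain \<rho> where "(\<lambda>s. norm (G s)) \<in> O[at_infinity](\<lambda>s. exp (norm s powr \<rho>))"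
    using fo by (auto simp: finite_order_def)
  then obtain c where c: "c > 0" "eventually (\<lambda>s. norm (norm (G s)) \<le> c * norm (exp (norm s powr \<rho>))) at_infinity"
    by (elim landau_o.bigE)
  from c(2) obtain b where "\<forall>s::complex. norm s \<ge> b \<longrightarrow> norm (norm (G s)) \<le> c * norm (exp (norm s powr \<rho>))"
    unfolding eventually_at_infinity by blast
  hence b: "norm (G s) \<le> c * exp (norm s powr \<rho>)" if "norm s \<ge> b" for s :: complex using that by simp
  \<comment> \<open>Raising the exponent to at least 3/2 allows multiplication with the bound for
    the Gamma factors, and makes \<open>powr\<close> monotone in the base even if
    \<open>\<rho>\<close> is negative.\<close>
  define \<kappa> where "\<kappa> = max \<rho> (3 / 2)"
  have "compact (G ` cball 0 (max b 1))"
    by (rule compact_continuous_image[OF continuous_on_subset[OF holomorphic_on_imp_continuous_on[OF hol]]]) auto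
  then obtain B where "\<forall>x\<in>G ` cball 0 (max b 1). norm x \<le> B"
    using compact_imp_bounded bounded_iff by metis
  hence B: "norm (G s) \<le> B" if "norm s \<le> max b 1" for s :: complex using that by simp
  have "order_bound \<kappa> {s. norm s \<ge> max b 1} (\<lambda>s. c * (G s / c))"
  proof (rule order_bound_mult)
    show "order_bound \<kappa> {s. norm s \<ge> max b 1} (\<lambda>s. c)"
      by (intro order_bound_bounded[of _ _ c]) (use c in \<open>auto simp: \<kappa>_def\<close>)
    show "order_bound \<kappa> {s. norm s \<ge> max b 1} (\<lambda>s. G s / c)"
    proof (rule order_boundI)
      fix s :: complex assume s: "s \<in> {s. norm s \<ge> max b 1}"
      have "norm (G s / c) \<le> exp (norm s powr \<rho>)"
        using b[of s] s c by (simp add: norm_divide field_simps)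
      also have "norm s powr \<rho> \<le> norm s powr \<kappa>" using s by (intro powr_mono) (auto simp: \<kappa>_def)
      also have "\<dots> \<le> (1 + norm s) powr \<kappa>" by (intro powr_mono2) (auto simp: \<kappa>_def)
      finally show "norm (G s / c) \<le> exp (1 * (1 + norm s) powr \<kappa>)" by simp
    qed
  qed
  moreover have "order_bound \<kappa> (cball 0 (max b 1)) G"
    by (rule order_bound_bounded[of _ _ B]) (use B in \<open>auto simp: \<kappa>_def\<close>)
  ultimately have "order_bound \<kappa> ({s. norm s \<ge> max b 1} \<union> cball 0 (max b 1)) G"
    using c by (intro order_bound_Un) auto
  moreover have "{s. norm s \<ge> max b 1} \<union> cball 0 (max b 1) = (UNIV :: complex set)" by auto
  ultimately show ?thesis by (intro that[of \<kappa>]) (auto simp: \<kappa>_def)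
qed

section \<open>The Phragmen-Lindelof principle\<close>

text \<open>The damping factor exp (- \<epsilon> cosh z) has norm at most 1 on the strip, because Re
  (cosh z) = cosh x * cos y and cos y >= cos 1 > 0. It decays doubly exponentially, which defeats
  any finite order on the vertical sides of a long rectangle; then \<epsilon> tends to 0.\<close>

lemma Phragmen_Lindelof_strip:
  assumes hol: "f holomorphic_on UNIV" and M: "M > 0"
    and edge: "\<And>z. \<bar>Im z\<bar> = 1 \<Longrightarrow> norm (f z) \<le> M"
    and growth: "order_bound \<kappa> {z. \<bar>Im z\<bar> \<le> 1} f" and w: "\<bar>Im w\<bar> \<le> 1"
  shows "norm (f w) \<le> M"
proof -
  define k where "k = max \<kappa> 0"
  have "order_bound k {z. \<bar>Im z\<bar> \<le> 1} f"
    using growth by (rule order_bound_mono) (simp add: k_def)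
  then obtain C where C: "C \<ge> 0" "\<And>z. \<bar>Im z\<bar> \<le> 1 \<Longrightarrow> norm (f z) \<le> exp (C * (1 + norm z) powr k)"
    by (rule order_boundE) auto
  define cosh' :: "complex \<Rightarrow> complex" where "cosh' = (\<lambda>z. (exp z + exp (- z)) / 2)"
  have Re_cosh: "Re (cosh' z) = cosh (Re z) * cos (Im z)" for z
    by (simp add: cosh'_def Re_exp cosh_def algebra_simps)
  have cos1: "cos (1::real) > 0" using pi_gt3 by (intro cos_gt_zero_pi) auto
  have cos_ge: "cos y \<ge> cos 1" if "\<bar>y\<bar> \<le> 1" for y :: real
    using cos_monotone_0_pi_le[of "\<bar>y\<bar>" 1] that pi_gt3 by simp
  have bound: "norm (f w) * exp (- (\<epsilon> * Re (cosh' w))) \<le> M" if \<epsilon>: "\<epsilon> > 0" for \<epsilon>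
  proof -
    define g where "g = (\<lambda>z. f z * exp (- (\<epsilon> * cosh' z)))"
    have ng: "norm (g z) = norm (f z) * exp (- (\<epsilon> * Re (cosh' z)))" for z
      by (simp add: g_def norm_mult)
    have hol_g: "g holomorphic_on UNIV"
      unfolding g_def cosh'_def by (intro holomorphic_intros hol) simp_all
    have lim: "((\<lambda>x. exp (C * (3 + x) powr k - \<epsilon> * (exp x / 2 * cos 1))) \<longlongrightarrow> 0) at_top"
    proof -
      have "((\<lambda>x. C * (3 + x) powr k / exp x) \<longlongrightarrow> 0) at_top" by real_asymp
      hence "((\<lambda>x. C * (3 + x) powr k / exp x - \<epsilon> / 2 * cos 1) \<longlongrightarrow> 0 - \<epsilon> / 2 * cos 1) at_top"
        by (intro tendsto_intros)
      hence "filterlim (\<lambda>x. (C * (3 + x) powr k / exp x - \<epsilon> / 2 * cos 1) * exp x) at_bot at_top"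
        by (rule filterlim_tendsto_neg_mult_at_bot) (use \<epsilon> cos1 exp_at_top in auto)
      hence "filterlim (\<lambda>x. C * (3 + x) powr k - \<epsilon> * (exp x / 2 * cos 1)) at_bot at_top"
        by (simp add: algebra_simps)
      thus ?thesis by (rule filterlim_compose[OF exp_at_bot])
    qed
    have "eventually (\<lambda>x. exp (C * (3 + x) powr k - \<epsilon> * (exp x / 2 * cos 1)) < M) at_top"
      using order_tendstoD(2)[OF lim M] .
    hence "eventually (\<lambda>x. exp (C * (3 + x) powr k - \<epsilon> * (exp x / 2 * cos 1)) < M \<and> x \<ge> \<bar>Re w\<bar> \<and> x \<ge> 1) at_top"
      by (intro eventually_conj eventually_ge_at_top)
    then obtain X where X: "exp (C * (3 + X) powr k - \<epsilon> * (exp X / 2 * cos 1)) < M" "X \<ge> \<bar>Re w\<bar>" "X \<ge> 1"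
      using eventually_happens' trivial_limit_at_top_linorder by blast
    have "norm (g w) \<le> M"
    proof (rule maximum_modulus_frontier[where f = g and S = "cbox (Complex (- X) (- 1)) (Complex X 1)"])
      fix z assume "z \<in> frontier (cbox (Complex (- X) (- 1)) (Complex X 1))"
      hence "z \<in> cbox (Complex (- X) (- 1)) (Complex X 1)" "z \<notin> box (Complex (- X) (- 1)) (Complex X 1)"
        by (auto simp: frontier_cbox)
      hence z: "\<bar>Re z\<bar> \<le> X" "\<bar>Im z\<bar> \<le> 1" "\<bar>Re z\<bar> = X \<or> \<bar>Im z\<bar> = 1"
        by (auto simp: in_cbox_complex_iff in_box_complex_iff)
      have cosh_ge: "Re (cosh' z) \<ge> cosh (Re z) * cos 1"
        unfolding Re_cosh using cos_ge[OF z(2)] cosh_real_pos[of "Re z"] by (intro mult_left_mono) auto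
      hence pos: "Re (cosh' z) \<ge> 0" using cos1 cosh_real_pos[of "Re z"] mult_nonneg_nonneg[of "cosh (Re z)" "cos 1"] by linarith
      show "norm (g z) \<le> M"
      proof (cases "\<bar>Im z\<bar> = 1")
        case True
        have "norm (g z) \<le> M * 1"
          unfolding ng using edge[OF True] M pos \<epsilon> by (intro mult_mono) auto
        thus ?thesis by simp
      next
        case False
        hence X': "\<bar>Re z\<bar> = X" using z by auto
        have c1: "cosh (Re z) = cosh X" using X' by (metis abs_if cosh_minus)
        have "cosh X \<ge> exp X / 2" by (simp add: cosh_def)
        hence "exp X / 2 * cos 1 \<le> cosh X * cos 1"
          using cos1 by (intro mult_right_mono) auto
        hence "Re (cosh' z) \<ge> exp X / 2 * cos 1" using cosh_ge unfolding c1 by linarith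
        hence "exp (- (\<epsilon> * Re (cosh' z))) \<le> exp (- (\<epsilon> * (exp X / 2 * cos 1)))"
          using \<epsilon> by simp
        moreover have "norm (f z) \<le> exp (C * (3 + X) powr k)"
        proof -
          have "1 + norm z \<le> 3 + X" using cmod_le[of z] z by linarith
          hence "C * (1 + norm z) powr k \<le> C * (3 + X) powr k"
            using C(1) by (intro mult_left_mono powr_mono2) (auto simp: k_def)
          thus ?thesis using C(2)[OF z(2)] by (meson exp_le_cancel_iff order.trans)
        qed
        ultimately have "norm (g z) \<le> exp (C * (3 + X) powr k) * exp (- (\<epsilon> * (exp X / 2 * cos 1)))"
          unfolding ng by (intro mult_mono) auto
        also have "\<dots> \<le> M" using X(1) by (simp add: mult_exp_exp)
        finally show ?thesis .
      qed
    qed (use w X in \<open>auto simp: in_cbox_complex_iff intro!: holomorphic_on_imp_continuous_on holomorphic_on_subset[OF hol_g]\<close>)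
    thus ?thesis by (simp add: ng)
  qed
  have "((\<lambda>\<epsilon>. norm (f w) * exp (- (\<epsilon> * Re (cosh' w)))) \<longlongrightarrow> norm (f w) * exp (- (0 * Re (cosh' w)))) (at_right 0)"
    by (intro tendsto_intros)
  hence "((\<lambda>\<epsilon>. norm (f w) * exp (- (\<epsilon> * Re (cosh' w)))) \<longlongrightarrow> norm (f w)) (at_right 0)" by simp
  thus ?thesis
    by (rule tendsto_upperbound) (auto intro!: bound eventually_at_right_less[THEN eventually_mono])
qed

section \<open>Dirichlet series and the completed function\<close>

lemma norm_dirichlet_term:
  assumes "n \<ge> 1"
  shows "norm (dirichlet_term a s n) = norm (a n) / real n powr Re s"
  using assms by (simp add: dirichlet_term_def norm_divide norm_powr_real_powr)

lemma dirichlet_sum_bounded: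
  assumes sm: "\<And>s. Re s > 1 \<Longrightarrow> (\<lambda>n. norm (dirichlet_term a s n)) summable_on {1..}" and x: "x > 1"
  obtains K where "\<And>s. Re s \<ge> x \<Longrightarrow> norm (dirichlet_sum a s) \<le> K"
proof
  fix s assume s: "Re s \<ge> x"
  have "norm (dirichlet_sum a s) \<le> (\<Sum>\<^sub>\<infinity>n\<in>{1..}. norm (dirichlet_term a s n))"
    unfolding dirichlet_sum_def using s x by (intro norm_infsum_bound sm) auto
  also have "\<dots> \<le> (\<Sum>\<^sub>\<infinity>n\<in>{1..}. norm (dirichlet_term a (complex_of_real x) n))"
  proof (rule infsum_mono)
    fix n :: nat assume "n \<in> {1..}"
    hence n: "n \<ge> 1" by simp
    have "real n powr x \<le> real n powr Re s" using n s by (intro powr_mono) auto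
    thus "norm (dirichlet_term a s n) \<le> norm (dirichlet_term a (complex_of_real x) n)"
      using n by (simp add: norm_dirichlet_term divide_left_mono)
  qed (use sm[of s] sm[of "complex_of_real x"] s x in auto)
  finally show "norm (dirichlet_sum a s) \<le> (\<Sum>\<^sub>\<infinity>n\<in>{1..}. norm (dirichlet_term a (complex_of_real x) n))" .
qed

lemma entire_extension_unique:
  assumes "entire_extension a m G" "entire_extension a m H"
  shows "G = H"
proof
  fix z
  show "G z = H z"
  proof (rule analytic_continuation_open[where s = "{s. Re s > 1}" and s' = UNIV and f = G and g = H])
    show "{s. Re s > 1} \<noteq> {}" by (auto intro: exI[of _ 2])
  qed (use assms in \<open>auto simp: entire_extension_def open_halfspace_Re_gt\<close>)
qed

locale selberg =
  fixes a :: "nat \<Rightarrow> complex" and Q :: real and r :: nat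
    and lam :: "nat \<Rightarrow> real" and mu :: "nat \<Rightarrow> complex" and \<omega> :: complex
  assumes in_class: "selberg_class a" and feq: "selberg_functional_equation a Q r lam mu \<omega>"
begin

abbreviation \<xi> :: "complex \<Rightarrow> complex" where "\<xi> \<equiv> selberg_xi a Q r lam mu"
abbreviation m :: nat where "m \<equiv> selberg_m a"

definition G :: "complex \<Rightarrow> complex" where "G = (THE G. entire_extension a m G)"

lemma entire_G: "entire_extension a m G"
proof -
  have "\<exists>m G. entire_extension a m G" using in_class unfolding selberg_class_def by blast
  hence "\<exists>G. entire_extension a m G" unfolding selberg_m_def by (rule LeastI_ex)
  thus ?thesis unfolding G_def by (metis entire_extension_unique theI')
qed

lemma hol_G: "G holomorphic_on UNIV" and finite_order_G: "finite_order G"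
  and G_eq: "Re s > 1 \<Longrightarrow> G s = (s - 1) ^ m * dirichlet_sum a s"
  using entire_G by (auto simp: entire_extension_def)

lemma Q_pos: "Q > 0" and lam_pos: "j \<in> {1..r} \<Longrightarrow> lam j > 0" and mu_nonneg: "j \<in> {1..r} \<Longrightarrow> Re (mu j) \<ge> 0"
  and norm_\<omega>: "norm \<omega> = 1" and xi_feq: "\<xi> s = \<omega> * cnj (\<xi> (1 - cnj s))"
  using feq unfolding selberg_functional_equation_def by blast+

lemma \<omega>_nonzero: "\<omega> \<noteq> 0"
  using norm_\<omega> by auto

text \<open>The factor (s - 1)^m is absorbed in \<open>G\<close>, so on Re s > 0 this form of the
  completed function has no removable singularity left.\<close>

definition xi_right :: "complex \<Rightarrow> complex" where
  "xi_right s = s ^ m * G s * of_real Q powr s * (\<Prod>j=1..r. Gamma (of_real (lam j) * s + mu j))"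

lemma Gamma_arg:
  assumes "Re s > 0" "j \<in> {1..r}"
  shows "of_real (lam j) * s + mu j \<notin> \<int>\<^sub>\<le>\<^sub>0"
proof
  assume "of_real (lam j) * s + mu j \<in> \<int>\<^sub>\<le>\<^sub>0"
  then obtain n where n: "of_real (lam j) * s + mu j = of_int n" "n \<le> 0" by (elim nonpos_Ints_cases)
  have "Re (of_real (lam j) * s + mu j) \<le> 0" unfolding n(1) using n(2) by simp
  moreover have "lam j * Re s > 0" using assms lam_pos by simp
  ultimately show False using mu_nonneg[OF assms(2)] by simp
qed

lemma hol_xi_right: "xi_right holomorphic_on {s. Re s > 0}"
proof -
  have 1: "(\<lambda>s. Gamma (of_real (lam j) * s + mu j)) holomorphic_on {s. Re s > 0}" if "j \<in> {1..r}" for j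
    by (intro holomorphic_intros) (use Gamma_arg that in auto)
  show ?thesis unfolding xi_right_def
    by (intro holomorphic_intros holomorphic_on_subset[OF hol_G] 1) (use Q_pos in auto)
qed

text \<open>\<open>remove_sings\<close> at \<open>s\<close> depends only on a punctured
  neighbourhood, where the defining product equals \<open>xi_right\<close>, and this is analytic at
  \<open>s\<close>.\<close>

lemma xi_eq_right:
  assumes "Re s > 0"
  shows "\<xi> s = xi_right s"
proof -
  have ev: "eventually (\<lambda>w. w ^ m * (w - 1) ^ m * of_real Q powr w *
     (\<Prod>j=1..r. Gamma (of_real (lam j) * w + mu j)) * selberg_fun a w = xi_right w) (at s)"
    using eventually_neq_at_within[of 1 s UNIV]
  proof eventually_elim
    case (elim w)
    thus ?case by (simp add: selberg_fun_def xi_right_def G_def)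
  qed
  have "xi_right analytic_on {s}"
    using hol_xi_right assms open_halfspace_Re_gt[of 0] by (auto simp: analytic_at)
  thus ?thesis
    unfolding selberg_xi_def using remove_sings_cong[OF ev refl] by simp
qed

text \<open>
  On \<open>Re s > 0\<close> the defining product has no pole of a Gamma factor; the remaining points are reached by the
  functional equation, which is assumed everywhere.
\<close>

lemma hol_xi: "\<xi> holomorphic_on UNIV"
proof -
  have 1: "\<xi> holomorphic_on {s. Re s > 0}"
    using hol_xi_right by (rule holomorphic_transform) (simp add: xi_eq_right)
  have "(\<lambda>s. \<xi> (1 - s)) holomorphic_on {s. Re s < 1}"
  proof -
    have "(\<xi> \<circ> (\<lambda>s. 1 - s)) holomorphic_on {s. Re s < 1}"
      by (intro holomorphic_on_compose_gen[OF _ 1] holomorphic_intros) auto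
    thus ?thesis by (simp add: o_def)
  qed
  hence "(\<lambda>s. \<xi> (1 - s)) holomorphic_on cnj ` {s. Re s < 1}"
    by (rule holomorphic_on_subset) auto
  hence "(cnj \<circ> (\<lambda>s. \<xi> (1 - s)) \<circ> cnj) holomorphic_on {s. Re s < 1}"
    by (intro holomorphic_on_compose_cnj_cnj open_halfspace_Re_lt)
  hence "(\<lambda>s. \<omega> * (cnj \<circ> (\<lambda>s. \<xi> (1 - s)) \<circ> cnj) s) holomorphic_on {s. Re s < 1}"
    by (intro holomorphic_intros)
  hence 2: "\<xi> holomorphic_on {s. Re s < 1}"
    by (rule holomorphic_transform) (simp add: xi_feq[symmetric])
  have "\<xi> holomorphic_on ({s. Re s > 0} \<union> {s. Re s < 1})"
    by (intro holomorphic_on_Un 1 2 open_halfspace_Re_gt open_halfspace_Re_lt)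
  moreover have "{s. Re s > 0} \<union> {s. Re s < 1} = (UNIV :: complex set)" by auto
  ultimately show ?thesis by simp
qed

text \<open>(S5) presents the Dirichlet series as an exponential, and the Gamma factors have neither
  zeros nor poles here.\<close>

lemma xi_nonzero_right:
  assumes "Re s > 1"
  shows "\<xi> s \<noteq> 0"
proof -
  obtain b where "\<And>s. Re s > 1 \<Longrightarrow> dirichlet_sum a s = exp (dirichlet_sum b s)"
    using in_class unfolding selberg_class_def by blast
  hence "G s \<noteq> 0" using assms G_eq[of s] by auto
  moreover have "(\<Prod>j=1..r. Gamma (of_real (lam j) * s + mu j)) \<noteq> 0"
    using Gamma_arg[of s] assms by (auto simp: Gamma_eq_zero_iff)
  ultimately show ?thesis
    using assms Q_pos by (auto simp: xi_eq_right xi_right_def)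
qed

lemma xi_zero_strip:
  assumes "\<xi> s = 0"
  shows "0 \<le> Re s" "Re s \<le> 1"
proof -
  show "Re s \<le> 1" using xi_nonzero_right[of s] assms by force
  have "\<xi> (1 - cnj s) = 0" using xi_feq[of s] assms \<omega>_nonzero by simp
  thus "0 \<le> Re s" using xi_nonzero_right[of "1 - cnj s"] by force
qed

lemma order_bound_cofactors:
  "order_bound (3 / 2) {s. Re s \<ge> 1 / 2}
     (\<lambda>s. s ^ m * (of_real Q powr s * (\<Prod>j=1..r. Gamma (of_real (lam j) * s + mu j))))"
proof (intro order_bound_mult order_bound_power order_bound_prod order_bound_Gamma lam_pos mu_nonneg)
  show "order_bound (3 / 2) {s. Re s \<ge> 1 / 2} (\<lambda>s. s)"
  proof (rule order_bound_linear_exponent[where B = 1])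
    show "norm s \<le> exp (1 * (1 + norm s))" for s :: complex
      using exp_ge_add_one_self[of "1 + norm s"] by simp
  qed auto
  show "order_bound (3 / 2) {s. Re s \<ge> 1 / 2} (\<lambda>s. of_real Q powr s)"
  proof (rule order_bound_linear_exponent[where B = "\<bar>ln Q\<bar>"])
    fix s :: complex
    have "norm (of_real Q powr s) = exp (ln Q * Re s)"
      using Q_pos by (simp add: norm_powr_real powr_def mult.commute)
    also have "ln Q * Re s \<le> \<bar>ln Q\<bar> * \<bar>Re s\<bar>" by (metis abs_ge_self abs_mult)
    also have "\<dots> \<le> \<bar>ln Q\<bar> * (1 + norm s)"
      using abs_Re_le_cmod[of s] by (intro mult_left_mono) auto
    finally show "norm (of_real Q powr s) \<le> exp (\<bar>ln Q\<bar> * (1 + norm s))" by simp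
  qed auto
qed auto

lemma xi_eq_cofactors:
  assumes "Re s > 0"
  shows "\<xi> s = s ^ m * (of_real Q powr s * (\<Prod>j=1..r. Gamma (of_real (lam j) * s + mu j))) * G s"
  using assms by (simp add: xi_eq_right xi_right_def mult_ac)

text \<open>The unspecified exponent is inherited from the finite order of \<open>G\<close>; it only
  has to meet the growth hypothesis of \<open>Phragmen_Lindelof_strip\<close>.\<close>

lemma xi_order_strip: obtains \<kappa> where "order_bound \<kappa> {s. Re s \<ge> 1 / 2} \<xi>"
proof -
  obtain \<kappa> where \<kappa>: "\<kappa> \<ge> 3 / 2" "order_bound \<kappa> UNIV G"
    using order_bound_finite_order[OF hol_G finite_order_G] by metis
  have "order_bound \<kappa> {s. Re s \<ge> 1 / 2} (\<lambda>s. s ^ m * (of_real Q powr s * (\<Prod>j=1..r. Gamma (of_real (lam j) * s + mu j))) * G s)"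
    using \<kappa> by (intro order_bound_mult[OF order_bound_mono[OF order_bound_cofactors]] order_bound_subset[OF \<kappa>(2)]) auto
  thus ?thesis using that xi_eq_cofactors by (force simp: order_bound_def)
qed

text \<open>The Dirichlet series is bounded in this half-plane, so the exponent is that of the Gamma
  factors and the order of \<open>G\<close> does not enter.\<close>

lemma xi_order_right: "order_bound (3 / 2) {s. Re s \<ge> 3 / 2} \<xi>"
proof -
  obtain K where K: "\<And>s. Re s \<ge> 3 / 2 \<Longrightarrow> norm (dirichlet_sum a s) \<le> K"
    using dirichlet_sum_bounded[of a "3 / 2"] in_class unfolding selberg_class_def by auto
  have 1: "order_bound (3 / 2) {s. Re s \<ge> 3 / 2} (\<lambda>s. (s - 1) ^ m * dirichlet_sum a s)"
  proof (intro order_bound_mult order_bound_power)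
    show "order_bound (3 / 2) {s. Re s \<ge> 3 / 2} (\<lambda>s. s - 1)"
    proof (rule order_bound_linear_exponent[where B = 1])
      show "norm (s - 1) \<le> exp (1 * (1 + norm s))" for s :: complex
        using exp_ge_add_one_self[of "1 + norm s"] norm_triangle_ineq4[of s 1] by simp
    qed auto
    show "order_bound (3 / 2) {s. Re s \<ge> 3 / 2} (dirichlet_sum a)"
      by (rule order_bound_bounded[of _ _ K]) (use K in auto)
  qed auto
  have "order_bound (3 / 2) {s. Re s \<ge> 3 / 2}
    (\<lambda>s. s ^ m * (of_real Q powr s * (\<Prod>j=1..r. Gamma (of_real (lam j) * s + mu j))) * ((s - 1) ^ m * dirichlet_sum a s))"
    by (intro order_bound_mult[OF order_bound_subset[OF order_bound_cofactors] 1]) auto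
  thus ?thesis by (simp add: order_bound_def xi_eq_cofactors G_eq)
qed

section \<open>Symmetry and growth of the rotated function\<close>

abbreviation f :: "complex \<Rightarrow> complex" where "f \<equiv> critical_rotation \<xi>"

lemma hol_f: "f holomorphic_on UNIV"
proof -
  have "(\<xi> \<circ> (\<lambda>z. 1 / 2 - \<i> * z)) holomorphic_on UNIV"
    by (intro holomorphic_on_compose_gen[OF _ hol_xi] holomorphic_intros) auto
  thus ?thesis by (simp add: o_def critical_rotation_def[abs_def])
qed

lemma f_sym: "f z = \<omega> * cnj (f (cnj z))"
  unfolding critical_rotation_def by (subst xi_feq) simp

lemma norm_f_cnj: "norm (f (cnj z)) = norm (f z)"
  by (subst (2) f_sym) (simp add: norm_mult norm_\<omega>)

lemma f_zero_strip: "f z = 0 \<Longrightarrow> \<bar>Im z\<bar> \<le> 1 / 2"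
  using xi_zero_strip[of "1 / 2 - \<i> * z"] by (auto simp: critical_rotation_def abs_le_iff)

text \<open>The point \<open>\<i>\<close> corresponds to s = 3/2, inside the half-plane of absolute
  convergence.\<close>

lemma f_nonzero: "f \<i> \<noteq> 0"
  using f_zero_strip[of \<i>] by auto

lemma order_bound_f_halfplane:
  assumes "order_bound \<kappa> {s. Re s \<ge> 1 / 2 + y} \<xi>" "\<kappa> \<ge> 0"
  shows "order_bound \<kappa> {z. \<bar>Im z\<bar> \<ge> y} f"
proof -
  obtain C where C: "C \<ge> 0" "\<And>s. Re s \<ge> 1 / 2 + y \<Longrightarrow> norm (\<xi> s) \<le> exp (C * (1 + norm s) powr \<kappa>)"
    using order_boundE[OF assms(1)] by (metis mem_Collect_eq)
  have upper: "norm (f z) \<le> exp (C * 2 powr \<kappa> * (1 + norm z) powr \<kappa>)" if "Im z \<ge> y" for z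
  proof -
    have "norm (f z) \<le> exp (C * (1 + norm (1 / 2 - \<i> * z)) powr \<kappa>)"
      unfolding critical_rotation_def by (rule C(2)) (use that in auto)
    also have "1 + norm (1 / 2 - \<i> * z) \<le> 2 * (1 + norm z)"
    proof -
      have "norm (1 / 2 - \<i> * z) \<le> 1 / 2 + norm z"
        using norm_triangle_ineq4[of "1 / 2" "\<i> * z"] by (simp add: norm_mult)
      also have "\<dots> \<le> 1 + 2 * norm z" using norm_ge_zero[of z] by linarith
      finally show ?thesis by simp
    qed
    hence "(1 + norm (1 / 2 - \<i> * z)) powr \<kappa> \<le> (2 * (1 + norm z)) powr \<kappa>"
      using assms(2) by (intro powr_mono2) auto
    also have "\<dots> = 2 powr \<kappa> * (1 + norm z) powr \<kappa>" by (intro powr_mult)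
    finally show ?thesis using C(1) by (simp add: mult_left_mono mult.assoc)
  qed
  show ?thesis
  proof (rule order_boundI)
    fix z assume z: "z \<in> {z. \<bar>Im z\<bar> \<ge> y}"
    show "norm (f z) \<le> exp (C * 2 powr \<kappa> * (1 + norm z) powr \<kappa>)"
    proof (cases "Im z \<ge> 0")
      case False
      thus ?thesis using upper[of "cnj z"] z norm_f_cnj[of z] by simp
    qed (use upper z in auto)
  qed
qed

end

context selberg
begin

text \<open>
  The strip is handled by a Phragmen-Lindelof argument for \<open>f z * exp (- (z - x0)\<^sup>2)\<close>, with \<open>x0\<close> the real
  part of the point under consideration: the Gaussian localizes the bound on the edges at \<open>x0\<close>.
\<close>

lemma f_growth: "order_bound (3 / 2) UNIV f"
proof -
  obtain \<kappa>0 where \<kappa>0: "order_bound \<kappa>0 {s. Re s \<ge> 1 / 2} \<xi>" by (rule xi_order_strip)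
  define \<kappa> where "\<kappa> = max \<kappa>0 0"
  have "order_bound \<kappa> {s. Re s \<ge> 1 / 2 + 0} \<xi>"
    using order_bound_mono[OF \<kappa>0, of \<kappa>] by (simp add: \<kappa>_def)
  hence "order_bound \<kappa> {z. \<bar>Im z\<bar> \<ge> 0} f"
    by (rule order_bound_f_halfplane) (simp add: \<kappa>_def)
  hence any: "order_bound \<kappa> S f" for S by (rule order_bound_subset) auto
  have outer: "order_bound (3 / 2) {z. \<bar>Im z\<bar> \<ge> 1} f"
    by (rule order_bound_f_halfplane) (use xi_order_right in simp_all)
  then obtain C where C: "C \<ge> 0" "\<And>z. \<bar>Im z\<bar> \<ge> 1 \<Longrightarrow> norm (f z) \<le> exp (C * (1 + norm z) powr (3 / 2))"
    by (rule order_boundE) auto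
  define c where "c = C * 2 powr (3 / 2)"
  have c: "c \<ge> 0" using C by (simp add: c_def)
  \<comment> \<open>If c <= sqrt d, the left side is at most sqrt d * sqrt d ^ 3 = d^2; otherwise it
    is at most c * c^3. The point is to let the Gaussian decay exp (- d^2) absorb the 3/2 power of
    the distance from \<open>x0\<close>.\<close>
  have young: "c * d powr (3 / 2) \<le> d\<^sup>2 + c ^ 4" if d: "d \<ge> 0" for d
  proof -
    have e: "d powr (3 / 2) = sqrt d ^ 3"
      using d by (cases "d = 0") (auto simp: powr_half_sqrt[symmetric] powr_power)
    have d2: "d\<^sup>2 = sqrt d * sqrt d ^ 3" using d by (simp add: power2_eq_square power3_eq_cube)
    have sq: "sqrt d \<ge> 0" using d by simp
    show ?thesis
    proof (cases "c \<le> sqrt d")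
      case True
      hence "c * sqrt d ^ 3 \<le> sqrt d * sqrt d ^ 3" using sq by (intro mult_right_mono) auto
      thus ?thesis unfolding e d2 using zero_le_power[OF c, of 4] by linarith
    next
      case False
      hence "sqrt d ^ 3 \<le> c ^ 3" using sq by (intro power_mono) auto
      hence "c * sqrt d ^ 3 \<le> c * c ^ 3" using c by (intro mult_left_mono)
      also have "c * c ^ 3 = c ^ 4" by (simp add: power_numeral_reduce)
      finally show ?thesis unfolding e using zero_le_power2[of d] by linarith
    qed
  qed
  have add32: "(x + y) powr (3 / 2) \<le> 2 powr (3 / 2) * (x powr (3 / 2) + y powr (3 / 2))"
    if "x \<ge> 0" "y \<ge> 0" for x y :: real
  proof -
    have "(x + y) powr (3 / 2) \<le> (2 * max x y) powr (3 / 2)"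
      using that by (intro powr_mono2) auto
    also have "\<dots> = 2 powr (3 / 2) * max x y powr (3 / 2)" by (intro powr_mult)
    also have "max x y powr (3 / 2) \<le> x powr (3 / 2) + y powr (3 / 2)" by (simp add: max_def)
    finally show ?thesis by simp
  qed
  have "order_bound (3 / 2) {z. \<bar>Im z\<bar> \<le> 1} f"
  proof (rule order_boundI)
    fix w assume "w \<in> {z. \<bar>Im z\<bar> \<le> 1}"
    hence w: "\<bar>Im w\<bar> \<le> 1" by simp
    define x0 where "x0 = Re w"
    \<comment> \<open>The final 1 pays for the growth exp ((Im z)^2) of the Gaussian on the edges,
      where Im z is 1 or -1.\<close>
    define A where "A = c * (2 + \<bar>x0\<bar>) powr (3 / 2) + c ^ 4 + 1"
    have nexp: "norm (exp (- ((z - x0)\<^sup>2))) = exp ((Im z)\<^sup>2 - (Re z - x0)\<^sup>2)" for z :: complex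
      by (simp add: power2_eq_square)
    have "norm (f w * exp (- ((w - x0)\<^sup>2))) \<le> exp A"
    proof (rule Phragmen_Lindelof_strip[where f = "\<lambda>z. f z * exp (- ((z - x0)\<^sup>2))"])
      show "(\<lambda>z. f z * exp (- ((z - x0)\<^sup>2))) holomorphic_on UNIV"
        by (intro holomorphic_intros hol_f)
      show "order_bound \<kappa> {z. \<bar>Im z\<bar> \<le> 1} (\<lambda>z. f z * exp (- ((z - x0)\<^sup>2)))"
      proof (rule order_bound_mult[OF any])
        show "order_bound \<kappa> {z. \<bar>Im z\<bar> \<le> 1} (\<lambda>z. exp (- ((z - x0)\<^sup>2)))"
        proof (rule order_bound_bounded)
          fix z assume "z \<in> {z. \<bar>Im z\<bar> \<le> 1}"
          hence "(Im z)\<^sup>2 \<le> 1" by (simp add: abs_square_le_1)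
          hence "exp ((Im z)\<^sup>2 - (Re z - x0)\<^sup>2) \<le> exp 1" using zero_le_power2[of "Re z - x0"] unfolding exp_le_cancel_iff by linarith
          thus "norm (exp (- ((z - x0)\<^sup>2))) \<le> exp 1" by (simp only: nexp)
        qed (simp add: \<kappa>_def)
      qed
      fix z assume z: "\<bar>Im z\<bar> = 1"
      define d where "d = \<bar>Re z - x0\<bar>"
      have "1 + norm z \<le> (2 + \<bar>x0\<bar>) + d" using cmod_le[of z] z unfolding d_def by linarith
      hence "(1 + norm z) powr (3 / 2) \<le> ((2 + \<bar>x0\<bar>) + d) powr (3 / 2)" by (intro powr_mono2) auto
      also have "\<dots> \<le> 2 powr (3 / 2) * ((2 + \<bar>x0\<bar>) powr (3 / 2) + d powr (3 / 2))"
        by (rule add32) (auto simp: d_def)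
      finally have "C * (1 + norm z) powr (3 / 2) \<le> C * (2 powr (3 / 2) * ((2 + \<bar>x0\<bar>) powr (3 / 2) + d powr (3 / 2)))"
        by (rule mult_left_mono) (rule C(1))
      also have "\<dots> = c * (2 + \<bar>x0\<bar>) powr (3 / 2) + c * d powr (3 / 2)"
        by (simp add: c_def algebra_simps)
      also have "\<dots> \<le> A - 1 + d\<^sup>2" using young[of d] by (simp add: A_def d_def)
      finally have "exp (C * (1 + norm z) powr (3 / 2)) \<le> exp (A - 1 + d\<^sup>2)"
        unfolding exp_le_cancel_iff .
      with C(2)[of z] z have "norm (f z) \<le> exp (A - 1 + d\<^sup>2)" by linarith
      moreover have "(Im z)\<^sup>2 = 1" using z by (metis power2_abs one_power2)
      hence "norm (exp (- ((z - x0)\<^sup>2))) = exp (1 - d\<^sup>2)" unfolding nexp d_def by simp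
      ultimately have "norm (f z * exp (- ((z - x0)\<^sup>2))) \<le> exp (A - 1 + d\<^sup>2) * exp (1 - d\<^sup>2)"
        unfolding norm_mult by (intro mult_mono) auto
      thus "norm (f z * exp (- ((z - x0)\<^sup>2))) \<le> exp A" by (simp add: mult_exp_exp)
    qed (use w in auto)
    hence "norm (f w) * exp ((Im w)\<^sup>2) \<le> exp A" unfolding norm_mult nexp by (simp add: x0_def)
    \<comment> \<open>Since \<open>w\<close> has real part \<open>x0\<close>, the Gaussian has norm
      at least 1 there, and removing it costs nothing.\<close>
    moreover have "norm (f w) * 1 \<le> norm (f w) * exp ((Im w)\<^sup>2)" by (intro mult_left_mono) auto
    ultimately have "norm (f w) \<le> exp A" by simp
    also have "A \<le> (c * 2 powr (3 / 2) + c ^ 4 + 1) * (1 + norm w) powr (3 / 2)"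
    proof -
      have "(2 + \<bar>x0\<bar>) powr (3 / 2) \<le> (2 * (1 + norm w)) powr (3 / 2)"
        using abs_Re_le_cmod[of w] by (intro powr_mono2) (auto simp: x0_def)
      also have "\<dots> = 2 powr (3 / 2) * (1 + norm w) powr (3 / 2)" by (intro powr_mult)
      finally have 1: "c * (2 + \<bar>x0\<bar>) powr (3 / 2) \<le> c * (2 powr (3 / 2) * (1 + norm w) powr (3 / 2))"
        using c by (intro mult_left_mono)
      have "1 \<le> (1 + norm w) powr (3 / 2)" by (intro ge_one_powr_ge_zero) auto
      hence "(c ^ 4 + 1) * 1 \<le> (c ^ 4 + 1) * (1 + norm w) powr (3 / 2)"
        using c by (intro mult_left_mono) auto
      with 1 show ?thesis by (simp add: A_def algebra_simps)
    qed
    finally show "norm (f w) \<le> exp ((c * 2 powr (3 / 2) + c ^ 4 + 1) * (1 + norm w) powr (3 / 2))" by simp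
  qed
  with outer have "order_bound (3 / 2) ({z. \<bar>Im z\<bar> \<ge> 1} \<union> {z. \<bar>Im z\<bar> \<le> 1}) f"
    by (rule order_bound_Un)
  moreover have "{z. \<bar>Im z\<bar> \<ge> 1} \<union> {z. \<bar>Im z\<bar> \<le> 1} = UNIV" by auto
  ultimately show ?thesis by simp
qed

lemma f_subquadratic: obtains u C where "subquadratic_entire f u C (3 / 2)"
proof -
  obtain C where C: "C \<ge> 0" "\<And>s. norm (f s) \<le> exp (C * (1 + norm s) powr (3 / 2))"
    using order_boundE[OF f_growth] by (metis UNIV_I)
  obtain u where "subquadratic_entire f u C (3 / 2)"
    by (rule subquadratic_entireI[OF hol_f f_nonzero C(2) C(1)]) auto
  thus ?thesis by (rule that)
qed

lemma hadamard_B_real: "hadamard_B f \<in> \<real>"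
proof -
  obtain u C where "subquadratic_entire f u C (3 / 2)" by (rule f_subquadratic)
  thus ?thesis using subquadratic_entire.hadamard_B_real \<omega>_nonzero f_sym by blast
qed

sublocale zeros: weighted_points "nonzero_zeros f" "\<lambda>\<gamma>. real (zero_mult f \<gamma>)" "1 / 2"
proof -
  obtain u C where "subquadratic_entire f u C (3 / 2)" by (rule f_subquadratic)
  then interpret F: subquadratic_entire f u C "3 / 2" .
  show "weighted_points (nonzero_zeros f) (\<lambda>\<gamma>. real (zero_mult f \<gamma>)) (1 / 2)"
  proof
    show "finite (nonzero_zeros f \<inter> cball 0 R)" for R by (rule F.finite_zeros)
    show "(\<lambda>\<gamma>. real (zero_mult f \<gamma>) / norm \<gamma> ^ 2) summable_on nonzero_zeros f" by (rule F.summable_zeros)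
    show "real (zero_mult f \<gamma>) > 0" if "\<gamma> \<in> nonzero_zeros f" for \<gamma>
      using zero_mult_pos[OF hol_f f_nonzero] that by (simp add: nonzero_zeros_def)
    show "\<bar>Im \<gamma>\<bar> \<le> 1 / 2" if "\<gamma> \<in> nonzero_zeros f" for \<gamma>
      by (rule f_zero_strip) (use that in \<open>simp add: nonzero_zeros_def\<close>)
  qed (auto simp: nonzero_zeros_def)
qed

section \<open>The two implications\<close>

text \<open>Since s = 1/2 - \<i> z has real part 1/2 + Im z, a zero at z = 0 lies on the critical
  line anyway, so only the nonzero ones matter.\<close>

lemma grand_riemann_hypothesis_iff: "grand_riemann_hypothesis \<xi> \<longleftrightarrow> (\<forall>\<gamma>\<in>nonzero_zeros f. Im \<gamma> = 0)"
proof
  assume "grand_riemann_hypothesis \<xi>"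
  thus "\<forall>\<gamma>\<in>nonzero_zeros f. Im \<gamma> = 0"
    by (force simp: grand_riemann_hypothesis_def nonzero_zeros_def critical_rotation_def)
next
  assume *: "\<forall>\<gamma>\<in>nonzero_zeros f. Im \<gamma> = 0"
  show "grand_riemann_hypothesis \<xi>"
    unfolding grand_riemann_hypothesis_def
  proof (intro allI impI)
    fix s assume s: "\<xi> s = 0"
    define z where "z = \<i> * (s - 1 / 2)"
    have "1 / 2 - \<i> * z = s" by (simp add: z_def algebra_simps flip: mult.assoc)
    hence "f z = 0" using s by (simp add: critical_rotation_def)
    hence "Im z = 0" using * by (cases "z = 0") (auto simp: nonzero_zeros_def)
    thus "Re s = 1 / 2" by (simp add: z_def)
  qed
qed

lemma selberg_g_eq:
  "selberg_g \<xi> t = - (of_nat (zero_mult f 0) / 2) * of_real t ^ 2 + \<i> * hadamard_B f * of_real t +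
     (\<Sum>\<^sub>\<infinity>\<gamma>\<in>nonzero_zeros f. of_nat (zero_mult f \<gamma>) * ((exp (- \<i> * \<gamma> * of_real t) - 1) / \<gamma> ^ 2))"
  by (simp add: selberg_g_def Let_def)

lemma infinitely_divisible_if_grand_riemann_hypothesis:
  assumes "grand_riemann_hypothesis \<xi>"
  obtains \<nu> where "infinitely_divisible \<nu>" "\<And>t. char \<nu> t = exp (selberg_g \<xi> t)"
proof -
  let ?w = "\<lambda>\<gamma>. zero_mult f \<gamma> / norm \<gamma> ^ 2"
  obtain b where b: "hadamard_B f = complex_of_real b" using hadamard_B_real by (elim Reals_cases)
  have w0: "?w \<gamma> \<ge> 0" for \<gamma> by simp
  have v: "real (zero_mult f 0) \<ge> 0" by simp
  obtain \<nu> where \<nu>: "infinitely_divisible \<nu>"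
    "\<And>t. char \<nu> t = exp (- (real (zero_mult f 0) / 2) * t\<^sup>2 + \<i> * b * t +
       (\<Sum>\<^sub>\<infinity>\<gamma>\<in>nonzero_zeros f. ?w \<gamma> * (iexp (t * - Re \<gamma>) - 1)))"
    by (rule levy_khintchine_infinitely_divisible[OF w0 zeros.summable v, where b = b and X = "\<lambda>\<gamma>. - Re \<gamma>"])
       (assumption | rule that)+
  have "char \<nu> t = exp (selberg_g \<xi> t)" for t
  proof -
    have "(\<Sum>\<^sub>\<infinity>\<gamma>\<in>nonzero_zeros f. ?w \<gamma> * (iexp (t * - Re \<gamma>) - 1)) =
      (\<Sum>\<^sub>\<infinity>\<gamma>\<in>nonzero_zeros f. of_nat (zero_mult f \<gamma>) * ((exp (- \<i> * \<gamma> * of_real t) - 1) / \<gamma> ^ 2))"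
    \<comment> \<open>For real \<gamma> the positive intensity m / |\<gamma>|^2 equals m /
      \<gamma>^2; this is where the hypothesis enters.\<close>
    proof (rule infsum_cong)
      fix \<gamma> assume "\<gamma> \<in> nonzero_zeros f"
      hence "Im \<gamma> = 0" using assms grand_riemann_hypothesis_iff by blast
      then obtain x where "\<gamma> = complex_of_real x" by (metis complex_is_Real_iff Reals_cases)
      thus "?w \<gamma> * (iexp (t * - Re \<gamma>) - 1) = of_nat (zero_mult f \<gamma>) * ((exp (- \<i> * \<gamma> * of_real t) - 1) / \<gamma> ^ 2)"
        by (simp add: mult_ac flip: of_real_power)
    qed
    thus ?thesis unfolding \<nu>(2) selberg_g_eq b by simp
  qed
  thus ?thesis using \<nu>(1) by (intro that)
qed

text \<open>Individual terms need not have cosines as real parts when \<gamma> is not real. Instead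
  the conjugation symmetry of the zeros shows that the sums with the two signs in the exponent are
  conjugate, and adding them produces the cosines. The linear term drops out because
  \<open>hadamard_B f\<close> is real.\<close>

lemma Re_selberg_g:
  assumes t: "t \<ge> 0"
  shows "complex_of_real (Re (selberg_g \<xi> t)) = - (zero_mult f 0 / 2 * t\<^sup>2) - zeros.cos_sum t"
proof -
  define e where "e = (\<lambda>s \<gamma>. of_nat (zero_mult f \<gamma>) * ((exp (s * \<i> * \<gamma> * of_real t) - 1) / \<gamma> ^ 2))"
  have e_summable: "e s summable_on nonzero_zeros f" if s: "s = 1 \<or> s = -1" for s
  proof (rule abs_summable_summable, rule summable_on_comparison_test)
    show "(\<lambda>\<gamma>. zero_mult f \<gamma> / norm \<gamma> ^ 2 * (exp (t / 2) + 1)) summable_on nonzero_zeros f"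
      by (intro summable_on_cmult_left zeros.summable)
    fix \<gamma> assume "\<gamma> \<in> nonzero_zeros f"
    hence "\<bar>Im \<gamma>\<bar> * t \<le> 1 / 2 * t" using zeros.strip t by (intro mult_right_mono) auto
    hence "\<bar>Im \<gamma> * t\<bar> \<le> t / 2" using t by (simp add: abs_mult)
    hence "norm (exp (s * \<i> * \<gamma> * of_real t)) \<le> exp (t / 2)" using s by auto
    hence "norm (exp (s * \<i> * \<gamma> * of_real t)) + norm (1 :: complex) \<le> exp (t / 2) + 1"
      by (simp only: norm_one add_le_cancel_right)
    hence "norm (exp (s * \<i> * \<gamma> * of_real t) - 1) \<le> exp (t / 2) + 1"
      by (rule order.trans[OF norm_triangle_ineq4])
    from mult_left_mono[OF this, of "zero_mult f \<gamma> / norm \<gamma> ^ 2"]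
    show "norm (e s \<gamma>) \<le> zero_mult f \<gamma> / norm \<gamma> ^ 2 * (exp (t / 2) + 1)"
      by (simp add: e_def norm_mult norm_divide norm_power)
  qed auto
  define E where "E = (\<lambda>s. infsum (e s) (nonzero_zeros f))"
  have E: "(e (-1) has_sum E (-1)) (nonzero_zeros f)" "(e 1 has_sum E 1) (nonzero_zeros f)"
    using e_summable by (auto simp: E_def)
  have inv: "cnj \<gamma> \<in> nonzero_zeros f" if "\<gamma> \<in> nonzero_zeros f" for \<gamma>
    using nonzero_zeros_cnj[OF hol_f f_nonzero \<omega>_nonzero f_sym] that by blast
  have cnj_e: "cnj (e (-1) \<gamma>) = e 1 (cnj \<gamma>)" for \<gamma>
    unfolding e_def zero_mult_cnj[OF hol_f f_nonzero \<omega>_nonzero f_sym] by (simp add: exp_cnj)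
  have "cnj (E (-1)) = infsum (\<lambda>\<gamma>. e 1 (cnj \<gamma>)) (nonzero_zeros f)"
    unfolding E_def infsum_cnj[symmetric] cnj_e ..
  also have "\<dots> = E 1" unfolding E_def
    by (rule infsum_reindex_bij_witness[of _ cnj cnj]) (auto intro: inv)
  finally have cnjE: "cnj (E (-1)) = E 1" .
  have "((\<lambda>\<gamma>. e (-1) \<gamma> + e 1 \<gamma>) has_sum (E (-1) + E 1)) (nonzero_zeros f)"
    by (intro has_sum_add E)
  moreover have "e (-1) \<gamma> + e 1 \<gamma> = - 2 * (real (zero_mult f \<gamma>) * ((1 - cos (\<gamma> * complex_of_real t)) / \<gamma>\<^sup>2))" for \<gamma>
  proof -
    have alg: "k * ((y - 1) / g) + k * ((x - 1) / g) = - 2 * (k * ((1 - (x + y) / 2) / g))" for k x y g :: complex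
      by (cases "g = 0") (simp_all add: field_simps)
    have "exp (- 1 * \<i> * \<gamma> * of_real t) = exp (- (\<i> * (\<gamma> * complex_of_real t)))"
      "exp (1 * \<i> * \<gamma> * of_real t) = exp (\<i> * (\<gamma> * complex_of_real t))"
      by (simp_all add: mult.assoc)
    thus ?thesis unfolding e_def one_minus_cos_eq_exp by (simp only: alg of_real_of_nat_eq)
  qed
  moreover have "((\<lambda>\<gamma>. - 2 * (real (zero_mult f \<gamma>) * ((1 - cos (\<gamma> * complex_of_real t)) / \<gamma>\<^sup>2)))
      has_sum - 2 * zeros.cos_sum t) (nonzero_zeros f)"
    using t by (intro has_sum_cmult_right zeros.cos_sum_has_sum)
  ultimately have sum: "E (-1) + E 1 = - 2 * zeros.cos_sum t"
    by (simp add: has_sum_unique)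
  obtain b where b: "hadamard_B f = complex_of_real b" using hadamard_B_real by (elim Reals_cases)
  have g: "selberg_g \<xi> t = - (of_nat (zero_mult f 0) / 2) * of_real t ^ 2 + \<i> * of_real b * of_real t + E (-1)"
    unfolding selberg_g_eq b by (simp add: E_def e_def)
  have "2 * complex_of_real (Re (selberg_g \<xi> t)) = selberg_g \<xi> t + cnj (selberg_g \<xi> t)"
    by (simp add: complex_add_cnj)
  also have "\<dots> = - of_nat (zero_mult f 0) * of_real t ^ 2 + (E (-1) + E 1)"
    unfolding g by (simp add: cnjE)
  also have "\<dots> = 2 * (- (zero_mult f 0 / 2 * t\<^sup>2) - zeros.cos_sum t)"
    unfolding sum by simp
  finally show ?thesis by (simp only: mult_cancel_left) simp
qed

text \<open>A bound for \<open>h\<close> on [1, 2] propagates by doubling: t^2 also grows by the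
  factor 4, so the constant does not deteriorate. Nonnegativity of \<open>h\<close> supplies the
  bound from below.\<close>

lemma cos_sum_quadratic_bound:
  assumes \<nu>: "infinitely_divisible \<nu>" "\<And>t. char \<nu> t = exp (selberg_g \<xi> t)"
  obtains C where "\<And>t. t \<ge> 0 \<Longrightarrow> norm (zeros.cos_sum t) \<le> C * (1 + t\<^sup>2)"
proof -
  define h where "h = (\<lambda>t. - Re (selberg_g \<xi> t))"
  have h_nonneg: "h t \<ge> 0" and h_double: "h (2 * t) \<le> 4 * h t" for t
    using infinitely_divisible_exponent[OF \<nu>, of t] by (auto simp: h_def)
  define M where "M = real (zero_mult f 0)"
  have h_eq: "zeros.cos_sum t = complex_of_real (h t - M / 2 * t\<^sup>2)" if "t \<ge> 0" for t
  proof -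
    have "complex_of_real (h t - M / 2 * t\<^sup>2) = - complex_of_real (Re (selberg_g \<xi> t)) - M / 2 * t\<^sup>2"
      by (simp add: h_def)
    thus ?thesis unfolding Re_selberg_g[OF that] by (simp add: M_def)
  qed
  define K where "K = (\<Sum>\<^sub>\<infinity>\<gamma>\<in>nonzero_zeros f. zero_mult f \<gamma> / norm \<gamma> ^ 2)"
  have K: "K \<ge> 0" unfolding K_def by (intro infsum_nonneg) auto
  \<comment> \<open>On [0, 2] the zeros in the strip of half-width 1/2 contribute at most 2 K exp (t
    / 2) <= 2 K exp 1, and the Gaussian part at most M / 2 * 2^2.\<close>
  define H where "H = 2 * K * exp 1 + 2 * M"
  have M: "M \<ge> 0" by (simp add: M_def)
  have H: "H \<ge> 0" using K M by (simp add: H_def)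
  have base: "h t \<le> H" if "0 \<le> t" "t \<le> 2" for t
  proof -
    have "norm (zeros.cos_sum t) \<le> K * (2 * exp (1 / 2 * t))"
      using zeros.norm_infsum_tail_le[of "{}" t] that by (simp add: K_def)
    hence "\<bar>h t - M / 2 * t\<^sup>2\<bar> \<le> K * (2 * exp (1 / 2 * t))"
      unfolding h_eq[OF that(1)] norm_of_real .
    also have "\<dots> \<le> K * (2 * exp 1)" using that K by (intro mult_left_mono) auto
    finally have "h t \<le> K * (2 * exp 1) + M / 2 * t\<^sup>2" by linarith
    moreover have "t\<^sup>2 \<le> 2\<^sup>2" using that by (intro power_mono) auto
    hence "M / 2 * t\<^sup>2 \<le> M / 2 * 2\<^sup>2" using M by (intro mult_left_mono) auto
    ultimately show ?thesis by (simp add: H_def)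
  qed
  have "h t \<le> H * t\<^sup>2" if "1 \<le> t" "t \<le> 2 ^ Suc n" for t n
    using that
  proof (induction n arbitrary: t)
    case 0
    hence "1 \<le> t\<^sup>2" by simp
    thus ?case using base[of t] 0 mult_left_mono[of 1 "t\<^sup>2" H] H by simp
  next
    case (Suc n)
    show ?case
    proof (cases "t \<le> 2")
      case True
      hence "1 \<le> t\<^sup>2" using Suc.prems by simp
      thus ?thesis using base[of t] True Suc.prems mult_left_mono[of 1 "t\<^sup>2" H] H by simp
    next
      case False
      \<comment> \<open>Halving is used only for t > 2, so the argument stays at least 1 and within
        the induction hypothesis.\<close>
      have "h t \<le> 4 * h (t / 2)" using h_double[of "t / 2"] by simp
      also have "h (t / 2) \<le> H * (t / 2)\<^sup>2" using False Suc.prems by (intro Suc.IH) auto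
      finally show ?thesis by (simp add: power_divide)
    qed
  qed
  hence large: "h t \<le> H * t\<^sup>2" if "1 \<le> t" for t
  proof -
    obtain n where "t < 2 ^ n" using real_arch_pow[of 2 t] by auto
    thus ?thesis using \<open>\<And>t n. 1 \<le> t \<Longrightarrow> t \<le> 2 ^ Suc n \<Longrightarrow> h t \<le> H * t\<^sup>2\<close>[of t n] that by simp
  qed
  show ?thesis
  proof (rule that)
    fix t :: real assume t: "t \<ge> 0"
    have "h t \<le> H * (1 + t\<^sup>2)"
    proof (cases "t \<le> 1")
      case True
      thus ?thesis using base[of t] t mult_left_mono[of 1 "1 + t\<^sup>2" H] H by simp
    next
      case False
      thus ?thesis using large[of t] H by (simp add: algebra_simps)
    qed
    moreover have "M / 2 * t\<^sup>2 \<le> M * (1 + t\<^sup>2)" using M by (simp add: algebra_simps)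
    moreover have "0 \<le> M / 2 * t\<^sup>2" using M by simp
    ultimately have "\<bar>h t - M / 2 * t\<^sup>2\<bar> \<le> (H + M) * (1 + t\<^sup>2)"
      using h_nonneg[of t] unfolding distrib_right abs_le_iff by linarith
    thus "norm (zeros.cos_sum t) \<le> (H + M) * (1 + t\<^sup>2)"
      unfolding h_eq[OF t] norm_of_real .
  qed
qed

lemma grand_riemann_hypothesis_if_infinitely_divisible:
  assumes "infinitely_divisible \<nu>" "\<And>t. char \<nu> t = exp (selberg_g \<xi> t)"
  shows "grand_riemann_hypothesis \<xi>"
proof -
  obtain C where "\<And>t. t \<ge> 0 \<Longrightarrow> norm (zeros.cos_sum t) \<le> C * (1 + t\<^sup>2)"
    using cos_sum_quadratic_bound[OF assms] by metis
  thus ?thesis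
    unfolding grand_riemann_hypothesis_iff using zeros.real_if_cos_sum_quadratic_bound by blast
qed

end

theorem theorem2p1:
  fixes a :: "nat \<Rightarrow> complex" and Q :: real and r :: nat
    and lam :: "nat \<Rightarrow> real" and mu :: "nat \<Rightarrow> complex" and \<omega> :: complex
    and \<xi> :: "complex \<Rightarrow> complex"
  assumes "selberg_class a"
    and "selberg_functional_equation a Q r lam mu \<omega>"
    and "\<xi> = selberg_xi a Q r lam mu"
  shows "grand_riemann_hypothesis \<xi> \<longleftrightarrow>
    (\<exists>\<nu>. infinitely_divisible \<nu> \<and> (\<forall>t. char \<nu> t = exp (selberg_g \<xi> t)))"
proof -
  interpret selberg a Q r lam mu \<omega>
    using assms by unfold_locales
  show ?thesis
    unfolding assms(3)
    using infinitely_divisible_if_grand_riemann_hypothesis grand_riemann_hypothesis_if_infinitely_divisible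
    by metis
qed

end
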